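(* For positive integers $p\le q$ with $\gcd(p,q)=1$, \[ m^{L,\circ}_{\frac pq}=m^{R,\circ}_{\frac pq}=6\,m_{\frac pq}-1. \]
   Context: Generalized Markov numbers. Start from the three positions with labels $\tfrac01,\tfrac10,\tfrac{-1}{1}$, each carrying the number $1$. Mutating a position with label $\tfrac ef$ and number $z$, where the other two positions have labels $\tfrac ab,\tfrac cd$ and numbers $x,y$, does two things. It replaces the label by $\tfrac{a+c}{b+d}$, or by $\tfrac{c-a}{d-b}$ if $\tfrac ef=\tfrac{a+c}{b+d}$. It replaces $z$ by $(x^2+xy+y^2)/z$. Consider mutation sequences that start with the position labelled $\tfrac{-1}1$, then the one labelled $\tfrac10$, and never mutate the same position twice in a row. Every reduced $\tfrac pq\in(0,1]$ occurs as a label, always carrying the same number $m_{\frac pq}$ (the generalized Markov number indexed by $\tfrac pq$; e.g. $m_{\frac11}=3$, $m_{\frac12}=13$). These triples are exactly the positive integer solutions of $x^2+y^2+z^2+xy+xz+yz=6xyz$. Orbifold. $\mathcal O_3$ is a sphere with one puncture and three orbifold points of order $3$, with initial triangulation $T_0$ of three pending arcs $\tau_{\frac01},\tau_{\frac10},\tau_{\frac{-1}1}$ at the puncture. Curves on $\mathcal O_3$ are drawn in the plane tiled by the lattice of unit segments on the lines $y=c$, $x=c$, $y=-x+c$ ($c\in\mathbb Z$). Lattice segments of slope $0$, $\infty$, $-1$ represent $\tau_{\frac01}$, $\tau_{\frac10}$, $\tau_{\frac{-1}1}$ respectively. Closed curves. Take the segment from $(0,0)$ to $(q,p)$. Move its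 endpoints to $(\epsilon,\epsilon)$ and $(q+\epsilon,p+\epsilon)$ for small $\epsilon>0$, nudging the path slightly to the left (resp. right) so that it avoids the lattice point $(q,p)$. Then identify the endpoints. This gives a simple closed curve $\gamma^{L,\circ}_{\frac pq}$ (resp. $\gamma^{R,\circ}_{\frac pq}$) on $\mathcal O_3$. Its band graph with respect to $T_0$ is formed from the snake graph of its crossing sequence by gluing an edge of the first tile to an edge of the last tile (standard Musiker–Schiffler–Williams band graph construction, in the orbifold setting of Banaian–Kelley). $m^{L,\circ}_{\frac pq}$ (resp. $m^{R,\circ}_{\frac pq}$) is the number of good matchings of this band graph. Good matchings. A good matching of a band graph with glued edge $e=e'$ is a perfect matching of the underlying snake graph that contains $e$ or $e'$. *)

theory Defs
  imports "HOL-Analysis.Analysis"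
begin

section \<open>Generalized Markov numbers\<close>

text \<open>The three positions are named after their initial labels 0/1, 1/0 and -1/1.
  A label a/b is the pair \<open>(a, b)\<close>, since 1/0 has to be a label.  The numbers
  live in \<^typ>\<open>rat\<close> so that the division in a mutation is the true one.\<close>

datatype position = P01 | P10 | Pm11

type_synonym cluster = "position \<Rightarrow> (int \<times> int) \<times> rat"

definition initial_cluster :: cluster where
  "initial_cluster k = (case k of P01 \<Rightarrow> (0, 1) | P10 \<Rightarrow> (1, 0) | Pm11 \<Rightarrow> (-1, 1), 1)"

fun other_positions :: "position \<Rightarrow> position \<times> position" where
  "other_positions P01 = (P10, Pm11)"
| "other_positions P10 = (P01, Pm11)"
| "other_positions Pm11 = (P01, P10)"

definition mutate :: "position \<Rightarrow> cluster \<Rightarrow> cluster" where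
  "mutate k C =
    (let (i, j) = other_positions k;
         ((a, b), x) = C i; ((c, d), y) = C j; ((e, f), z) = C k
     in C(k := (if e * (b + d) = f * (a + c) then (c - a, d - b) else (a + c, b + d),
                (x^2 + x * y + y^2) / z)))"

definition admissible_sequence :: "position list \<Rightarrow> bool" where
  "admissible_sequence ks \<longleftrightarrow> take 2 ks = [Pm11, P10] \<and> distinct_adj ks"

text \<open>The generalized Markov number indexed by p/q.  It is well defined because p/q
  occurs as a label and always carries the same number.\<close>

definition gen_markov :: "nat \<Rightarrow> nat \<Rightarrow> rat" where
  "gen_markov p q =
    (THE z. \<exists>ks k. admissible_sequence ks \<and>
                   fold mutate ks initial_cluster k = ((int p, int q), z))"


section \<open>Curves and their crossings with the lattice\<close>

type_synonym lattice_point = "int \<times> int"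

definition pt :: "lattice_point \<Rightarrow> real \<times> real" where
  "pt v = (real_of_int (fst v), real_of_int (snd v))"

text \<open>A lattice segment is given by its two endpoints; the three directions
  represent the pending arcs with labels 0/1, 1/0 and -1/1, in this order.\<close>

definition lattice_segments :: "lattice_point set set" where
  "lattice_segments = {{v, v + w} | v w. w \<in> {(1, 0), (0, 1), (1, -1)}}"

datatype side = LeftSide | RightSide

text \<open>A lift of the closed curve to the tiled plane: the segment from (0,0) to (q,p) with
  its endpoints moved to \<open>(\<epsilon>, \<epsilon>)\<close> and \<open>(q + \<epsilon>, p + \<epsilon>)\<close>, pushed to one side of the original
  segment by a detour through a point close to (q,p).  The path then passes
  not only (q,p) but also the midpoint of the original segment on the chosen side.  That
  midpoint is the midpoint of a lattice segment, hence an orbifold point, and passing the two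
  on the same side is what makes the closed curve simple.\<close>

fun closed_curve :: "side \<Rightarrow> nat \<Rightarrow> nat \<Rightarrow> real \<Rightarrow> real \<Rightarrow> real \<times> real" where
  "closed_curve LeftSide p q \<epsilon> =
     linepath (\<epsilon>, \<epsilon>) (real q - \<epsilon>, real p + 2 * \<epsilon>) +++
     linepath (real q - \<epsilon>, real p + 2 * \<epsilon>) (real q + \<epsilon>, real p + \<epsilon>)"
| "closed_curve RightSide p q \<epsilon> =
     linepath (\<epsilon>, \<epsilon>) (real q + 2 * \<epsilon>, real p - \<epsilon>) +++
     linepath (real q + 2 * \<epsilon>, real p - \<epsilon>) (real q + \<epsilon>, real p + \<epsilon>)"

definition segment_at :: "real \<times> real \<Rightarrow> lattice_point set" where
  "segment_at x = (THE s. s \<in> lattice_segments \<and> x \<in> convex hull (pt ` s))"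

definition nearer_endpoint :: "real \<times> real \<Rightarrow> lattice_point" where
  "nearer_endpoint x =
    (THE v. v \<in> segment_at x \<and> (\<forall>w \<in> segment_at x - {v}. dist x (pt v) < dist x (pt w)))"

definition crossing_times :: "(real \<Rightarrow> real \<times> real) \<Rightarrow> real set" where
  "crossing_times \<gamma> = {t \<in> {0..1}. \<exists>s \<in> lattice_segments. \<gamma> t \<in> convex hull (pt ` s)}"

definition crossings :: "(real \<Rightarrow> real \<times> real) \<Rightarrow> (lattice_point set \<times> lattice_point) list" where
  "crossings \<gamma> = map (\<lambda>t. (segment_at (\<gamma> t), nearer_endpoint (\<gamma> t)))
                     (sorted_list_of_set (crossing_times \<gamma>))"

text \<open>A lattice segment stands for a whole monogon, with the orbifold point at the midpoint of
  the segment.  Crossing the segment means crossing the pending arc twice, on entering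
  and on leaving the monogon.  Unfolded at its orbifold point of order 3, the monogon is a
  triangle with three copies of the pending arc as sides; the curve enters through one side
  and leaves through one of the other two, depending on which side of the orbifold point it
  passes.  The entered and the left side meet in the endpoint of the lattice segment nearer
  to the crossing.

  So each segment crossing gives two tiles, and the triangle traversed between
  two consecutive arc crossings is either an unfolded monogon or a triangle of the tiling.  The
  \<^emph>\<open>pivot\<close> of the traversal is the common endpoint of the two crossed arcs.  The list
  below contains the pivots for one full period, the last of them belonging to the
  triangle in which the curve closes up, where the next segment crossed is the translate of
  the first one by \<open>u = (q, p)\<close>.\<close>

definition pivots :: "lattice_point \<Rightarrow> (lattice_point set \<times> lattice_point) list \<Rightarrow> lattice_point list"
  where
  "pivots u cs =
    (let ss = map fst cs; ss' = tl ss @ [(\<lambda>v. v + u) ` hd ss]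
     in concat (map2 (\<lambda>(s, v) s'. [v, the_elem (s \<inter> s')]) cs ss'))"


section \<open>Snake graphs, band graphs and good matchings\<close>

text \<open>Tiles are unit squares, given by their lower left corner.  Graph edges are
  two-element sets of vertices.\<close>

datatype dir = East | North

fun turn :: "dir \<Rightarrow> dir" where
  "turn East = North"
| "turn North = East"

fun step :: "dir \<Rightarrow> int \<times> int \<Rightarrow> int \<times> int" where
  "step East (x, y) = (x + 1, y)"
| "step North (x, y) = (x, y + 1)"

fun entry_edge :: "dir \<Rightarrow> int \<times> int \<Rightarrow> (int \<times> int) set" where
  "entry_edge East (x, y) = {(x, y), (x, y + 1)}"
| "entry_edge North (x, y) = {(x, y), (x + 1, y)}"

definition exit_edge :: "dir \<Rightarrow> int \<times> int \<Rightarrow> (int \<times> int) set" where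
  "exit_edge d t = entry_edge d (step d t)"

definition tile_edges :: "int \<times> int \<Rightarrow> (int \<times> int) set set" where
  "tile_edges t = {entry_edge d t | d. True} \<union> {exit_edge d t | d. True}"

text \<open>Gluing directions.  Consecutive tiles are glued along the third side of the triangle
  traversed between them.  Because the relative orientation of the tiles alternates, three
  consecutive tiles form a straight piece if the two traversed triangles have different pivots,
  and turn a corner if the pivots agree, that is, if the three crossed arcs share an endpoint.\<close>

fun directions :: "dir \<Rightarrow> lattice_point \<Rightarrow> lattice_point list \<Rightarrow> dir list" where
  "directions d v [] = []"
| "directions d v (w # ws) =
     (let d' = (if w = v then turn d else d) in d' # directions d' w ws)"

fun tiles :: "int \<times> int \<Rightarrow> dir list \<Rightarrow> (int \<times> int) list" where
  "tiles t [] = [t]"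
| "tiles t (d # ds) = t # tiles (step d t) ds"

definition snake_graph :: "dir list \<Rightarrow> (int \<times> int) set set" where
  "snake_graph ds = (\<Union>t \<in> set (tiles (0, 0) ds). tile_edges t)"

text \<open>A band graph is recorded as the edge set of the underlying snake graph together with the
  edges \<open>e\<close>, \<open>e'\<close> of the first and last tile that are glued; both represent the
  third side of the triangle in which the curve closes up.  With \<open>n\<close> tiles there are
  \<open>n\<close> pivots, hence \<open>n\<close> directions, the last of which leads out of the last tile through \<open>e'\<close>.
  The pivot before the first tile is the last pivot translated back by one period; up to
  reflection of the plane the first tile may be taken to be entered from the west.\<close>

definition band_graph :: "lattice_point \<Rightarrow> (lattice_point set \<times> lattice_point) list \<Rightarrow>
    (int \<times> int) set set \<times> (int \<times> int) set \<times> (int \<times> int) set" where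
  "band_graph u cs =
    (let vs = pivots u cs;
         ds = directions East (last vs - u) vs;
         ts = tiles (0, 0) (butlast ds)
     in (snake_graph (butlast ds), entry_edge East (hd ts), exit_edge (last ds) (last ts)))"

definition perfect_matching :: "'v set set \<Rightarrow> 'v set set \<Rightarrow> bool" where
  "perfect_matching E M \<longleftrightarrow> M \<subseteq> E \<and> (\<forall>v \<in> \<Union>E. \<exists>!e. e \<in> M \<and> v \<in> e)"

definition good_matchings :: "'v set set \<times> 'v set \<times> 'v set \<Rightarrow> 'v set set set" where
  "good_matchings = (\<lambda>(E, e, e'). {M. perfect_matching E M \<and> (e \<in> M \<or> e' \<in> M)})"

text \<open>All edges count with weight 1: the weight attached to an orbifold point of order 3
  is \<open>2 cos (\<pi>/3) = 1\<close>.\<close>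

definition m_closed :: "side \<Rightarrow> nat \<Rightarrow> nat \<Rightarrow> real \<Rightarrow> nat" where
  "m_closed \<sigma> p q \<epsilon> =
    card (good_matchings (band_graph (int q, int p) (crossings (closed_curve \<sigma> p q \<epsilon>))))"

end

(* The closed curve runs around the puncture and one orbifold point, so its holonomy is a product of a
parabolic matrix Q and an element E of SL(2,Z) with trace 1 (order 3 up to sign); the trace of E * Q
is -1 plus 6 times an off-diagonal entry of E, which is m_{p/q} up to sign.

The good matchings of a band graph are counted by the trace of a product of the matrices
L = (1 1; 0 1) and R = (1 0; 1 1), one for each triangle traversed, according to the side of the curve
on which the pivot lies.  The orbifold points are the midpoints of the lattice segments, so the
letters can be read off from the line of slope p/q in the half lattice: up to a cyclic shift the
product runs along the square of the Christoffel word of p/q, with a letter depending on the position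
modulo 2.  Christoffel words multiply along the Stern-Brocot tree, and moving a path across a
half-lattice point inserts a fixed matrix, of order 3 up to sign at an orbifold point and parabolic
at the puncture.  For neighbours U, V with W = U V this gives t(U) t(W) = t(U W) + t(V) + 3 for the
traces t of the closed curves, which is the Vieta form of the mutation rule for m = (t + 1) / 6. *)

theory Submission
  imports Defs "HOL-Library.Z2"
begin

section \<open>Integer 2 by 2 matrices\<close>

text \<open>Why an induction along the tree is possible: the rotations about the three orbifold
  points and the parabolic element of the puncture multiply to -1, the relation of the orbifold
  fundamental group lifted to determinant 1. A step in the Stern-Brocot tree replaces one rotation
  by a conjugate (a braid move), so the relation survives; \<open>regular\<close> carries it through
  the induction. The constant 3 of the recursion is 2 + 1, where 2 = -tr Q and 1 is the trace of a
  rotation. The geometric obstacle is that the line of slope p/q runs exactly through an orbifold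
  point half way and through a lattice point at its end. All other comparisons are between distinct
  integers and survive a small displacement; these are ties. \<open>offset\<close> settles them by
  switching between strict and weak inequalities, so that one integer function \<open>column\<close>
  serves both sides. For the actual bent curve, the deviation \<delta> from the line must then be
  small, with the right sign at crossings where a tie can occur.\<close>

datatype mat2 = Mat2 (e11: int) (e12: int) (e21: int) (e22: int)

instantiation mat2 :: ring_1
begin
definition "0 = Mat2 0 0 0 0"
definition "1 = Mat2 1 0 0 1"
definition "A + B = Mat2 (e11 A + e11 B) (e12 A + e12 B) (e21 A + e21 B) (e22 A + e22 B)"
definition "- A = Mat2 (- e11 A) (- e12 A) (- e21 A) (- e22 A)"
definition "A - B = Mat2 (e11 A - e11 B) (e12 A - e12 B) (e21 A - e21 B) (e22 A - e22 B)"
definition "A * B =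
  Mat2 (e11 A * e11 B + e12 A * e21 B) (e11 A * e12 B + e12 A * e22 B)
       (e21 A * e11 B + e22 A * e21 B) (e21 A * e12 B + e22 A * e22 B)"
instance
  by standard (auto simp: zero_mat2_def one_mat2_def plus_mat2_def uminus_mat2_def
      minus_mat2_def times_mat2_def algebra_simps intro: mat2.expand)
end

lemmas mat2_defs = zero_mat2_def one_mat2_def plus_mat2_def uminus_mat2_def
  minus_mat2_def times_mat2_def

definition tr2 :: "mat2 \<Rightarrow> int" where "tr2 A = e11 A + e22 A"
definition det2 :: "mat2 \<Rightarrow> int" where "det2 A = e11 A * e22 A - e12 A * e21 A"
definition adj2 :: "mat2 \<Rightarrow> mat2" where "adj2 A = Mat2 (e22 A) (- e12 A) (- e21 A) (e11 A)"

lemma det2_mult [simp]: "det2 (A * B) = det2 A * det2 B"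
  by (simp add: det2_def times_mat2_def algebra_simps)

lemma det2_1 [simp]: "det2 1 = 1"
  by (simp add: det2_def one_mat2_def)

lemma det2_adj2 [simp]: "det2 (adj2 A) = det2 A"
  by (simp add: det2_def adj2_def)

lemma adj2_adj2 [simp]: "adj2 (adj2 A) = A"
  by (simp add: adj2_def)

lemma adj2_mult: "adj2 (A * B) = adj2 B * adj2 A"
  by (simp add: adj2_def times_mat2_def algebra_simps)

lemma adj2_uminus: "adj2 (- A) = - adj2 A"
  by (simp add: adj2_def uminus_mat2_def)

lemma adj2_eq: "adj2 A = (of_int (tr2 A)) - A"
proof -
  have "of_int k = Mat2 k 0 0 k" for k
  proof (induction k rule: int_induct[of _ 0])
    case base then show ?case by (simp add: mat2_defs)
  qed (simp_all add: mat2_defs)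
  then show ?thesis by (simp add: adj2_def tr2_def minus_mat2_def)
qed

lemma mult_adj2:
  assumes "det2 A = 1"
  shows "A * adj2 A = 1" "adj2 A * A = 1" "A * (adj2 A * B) = B" "adj2 A * (A * B) = B"
proof -
  show *: "A * adj2 A = 1" "adj2 A * A = 1"
    using assms by (simp_all add: det2_def adj2_def mat2_defs algebra_simps)
  show "A * (adj2 A * B) = B" "adj2 A * (A * B) = B"
    by (simp_all add: mult.assoc[symmetric] *)
qed

lemma tr2_diff [simp]: "tr2 (A - B) = tr2 A - tr2 B"
  by (simp add: tr2_def minus_mat2_def)

lemma tr2_uminus [simp]: "tr2 (- A) = - tr2 A"
  by (simp add: tr2_def uminus_mat2_def)

lemma tr2_adj2 [simp]: "tr2 (adj2 A) = tr2 A"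
  by (simp add: tr2_def adj2_def)

lemma tr2_commute: "tr2 (A * B) = tr2 (B * A)"
  by (simp add: tr2_def times_mat2_def algebra_simps)

text \<open>From A + adj A = tr A, multiplied by B. For determinant 1 this is Fricke's trace
  identity, the source of the product of two traces in the recursion.\<close>

lemma tr2_adj2_mult: "tr2 (A * B) + tr2 (adj2 A * B) = tr2 A * tr2 B"
  by (simp add: tr2_def times_mat2_def adj2_def algebra_simps)

text \<open>Half-lattice points modulo the lattice, in doubled coordinates: the puncture and three
  orbifold points. Every class is its own inverse, so a displacement made twice returns to the same
  class.\<close>

type_synonym parity = "bit \<times> bit"

lemma parity_add_self [simp]: "(s :: parity) + s = 0" "s + (s + t) = t"
proof -
  show *: "s + s = 0" for s :: parity by (cases s) (simp add: zero_prod_def)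
  show "s + (s + t) = t" by (simp add: add.assoc[symmetric] *)
qed

section \<open>Products of elements of order 3\<close>

text \<open>Families of matrices indexed by the four parity classes of half-lattice points are the holonomies
  of a straight path started next to a point of that class; \<open>P\<close> is the class of the puncture.
  A small loop around a point of class \<open>s\<close> has holonomy \<open>\<rho> s\<close>.  The quadratic relation in
  \<open>regular\<close> pushes a path across the corner of a parallelogram, and \<open>rot U u\<close> is the rotation about
  the orbifold point \<open>P + u\<close>, transported to the puncture along \<open>U\<close>.\<close>

locale torsion =
  fixes P :: parity and Q :: mat2 and \<rho> :: "parity \<Rightarrow> mat2"
  assumes det_Q: "det2 Q = 1" and tr_Q: "tr2 Q = -2"
    and det_\<rho>: "\<And>s. det2 (\<rho> s) = 1"
    and tr_\<rho>: "\<And>s. s \<noteq> P \<Longrightarrow> tr2 (\<rho> s) = 1"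
    and \<rho>_P: "Q * \<rho> P = - adj2 Q"
begin

definition rot :: "(parity \<Rightarrow> mat2) \<Rightarrow> parity \<Rightarrow> mat2" where
  "rot U u = U P * \<rho> (P + u) * adj2 (U P)"

definition loop :: "(parity \<Rightarrow> mat2) \<Rightarrow> parity \<Rightarrow> mat2" where
  "loop U u = U P * U (P + u)"

definition juxt :: "(parity \<Rightarrow> mat2) \<Rightarrow> parity \<Rightarrow> (parity \<Rightarrow> mat2) \<Rightarrow> parity \<Rightarrow> mat2" where
  "juxt U u V = (\<lambda>s. U s * V (s + u))"

text \<open>U and V play the words of two Farey neighbours. The equations for
  \<open>U (P + u)\<close> and \<open>V (P + v)\<close> express the half-turn symmetry of a line
  about the orbifold point in its middle: the second half is the first one reversed, up to local
  holonomies. The last equation is the relation between the three rotations and the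
  puncture.\<close>

definition regular :: "(parity \<Rightarrow> mat2) \<Rightarrow> parity \<Rightarrow> (parity \<Rightarrow> mat2) \<Rightarrow> parity \<Rightarrow> bool" where
  "regular U u V v \<longleftrightarrow>
     (\<forall>s. det2 (U s) = 1) \<and> (\<forall>s. det2 (V s) = 1) \<and> u \<noteq> 0 \<and> v \<noteq> 0 \<and> u \<noteq> v \<and>
     (\<forall>s. U s * V (s + u) = V s * \<rho> (s + v) * U (s + v)) \<and>
     U (P + u) = \<rho> (P + u) * adj2 (U P) * Q \<and>
     V (P + v) = \<rho> (P + v) * adj2 (V P) * Q \<and>
     rot (juxt U u V) (u + v) * rot U u * Q * rot V v = - 1"

text \<open>Trace 1 and determinant 1 give E^2 = E - 1 = -E^(-1), hence E^3 = -1. The form with X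
  rewrites inside products nested to the right.\<close>

lemma \<rho>_square:
  assumes "u \<noteq> 0"
  shows "\<rho> (P + u) * \<rho> (P + u) = - adj2 (\<rho> (P + u))" "\<rho> (P + u) * (\<rho> (P + u) * X) = - adj2 (\<rho> (P + u)) * X"
proof -
  have "P + u \<noteq> P" using assms by simp
  then have a: "adj2 (\<rho> (P + u)) = 1 - \<rho> (P + u)" using tr_\<rho> adj2_eq by simp
  then have "\<rho> (P + u) * (1 - \<rho> (P + u)) = 1" using mult_adj2(1)[OF det_\<rho>, of "P + u"] by simp
  then show 1: "\<rho> (P + u) * \<rho> (P + u) = - adj2 (\<rho> (P + u))"
    unfolding a by (simp add: algebra_simps)
  show "\<rho> (P + u) * (\<rho> (P + u) * X) = - adj2 (\<rho> (P + u)) * X"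
    by (simp add: mult.assoc[symmetric] 1)
qed

text \<open>Let E, F, G be the rotations of U, V and their juxtaposition, so that G E Q F = -1. For
  the pair (U, W) the new rotation is F conjugated by E Q, for (W, V) it is (Q F)^(-1) E (Q F); in
  both cases the cyclic relation passes to the new triple.\<close>

lemma regular_juxt:
  assumes "regular U u V v"
  shows "regular U u (juxt U u V) (u + v)" "regular (juxt U u V) (u + v) V v"
    "juxt U u V (P + (u + v)) = \<rho> (P + (u + v)) * adj2 (juxt U u V P) * Q"
proof -
  let ?W = "juxt U u V"
  have detU: "\<And>s. det2 (U s) = 1" and detV: "\<And>s. det2 (V s) = 1"
    and ne: "u \<noteq> 0" "v \<noteq> 0" "u \<noteq> v"
    and rel: "\<And>s. U s * V (s + u) = V s * \<rho> (s + v) * U (s + v)"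
    and U: "U (P + u) = \<rho> (P + u) * adj2 (U P) * Q"
    and V: "V (P + v) = \<rho> (P + v) * adj2 (V P) * Q"
    and I: "rot ?W (u + v) * rot U u * Q * rot V v = - 1"
    using assms unfolding regular_def by blast+
  have ne': "u + v \<noteq> 0" "u \<noteq> u + v" "u + v \<noteq> v"
  proof -
    show "u + v \<noteq> 0"
    proof
      assume "u + v = 0"
      then have "u + (u + v) = u" by simp
      with ne show False by simp
    qed
    show "u \<noteq> u + v" "u + v \<noteq> v" using ne by auto
  qed
  have detW: "det2 (?W s) = 1" for s by (simp add: juxt_def detU detV)
  note cancel = mult_adj2[OF detU] mult_adj2[OF detV] mult_adj2[OF detW] mult_adj2[OF det_\<rho>]
    mult_adj2[OF det_Q]
  let ?E = "rot U u" and ?F = "rot V v" and ?G = "rot ?W (u + v)"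
  have detr: "det2 ?E = 1" "det2 ?F = 1" "det2 ?G = 1"
    by (simp_all add: rot_def detU detV detW det_\<rho>)
  note cr = mult_adj2[OF detr(1)] mult_adj2[OF detr(2)] mult_adj2[OF detr(3)]
  have I2: "?E * Q * ?F = - adj2 ?G"
  proof -
    have "adj2 ?G * (?G * (?E * Q * ?F)) = adj2 ?G * (- 1)" using I by (simp add: mult.assoc)
    then show ?thesis by (simp add: cr)
  qed
  have I3: "?E * Q * ?F * ?G = - 1" unfolding I2 by (simp add: cr)
  have s: "P + u + u = P" "P + v + v = P" "P + u + v = P + (u + v)" "P + v + u = P + (u + v)"
      "P + (u + v) + u = P + v" "P + (u + v) + v = P + u" "P + u + (u + v) = P + v"
      "P + v + (u + v) = P + u" "u + (u + v) = v" "u + v + v = u"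
    by (simp_all add: add_ac)
  have W: "?W (P + (u + v)) = \<rho> (P + (u + v)) * adj2 (?W P) * Q"
  proof -
    \<comment> \<open>As P + u + u = P, the relation at P + u can be solved for
      \<open>U (P + (u + v))\<close>, which gives the second half of the loop of W.\<close>
    have "U (P + u) * V P = V (P + u) * \<rho> (P + (u + v)) * U (P + (u + v))"
      using rel[of "P + u"] by (simp add: s)
    then have "adj2 (\<rho> (P + (u + v))) * (adj2 (V (P + u)) * (U (P + u) * V P)) = U (P + (u + v))"
      by (simp add: mult.assoc cancel)
    then have "?W (P + (u + v)) =
        adj2 (\<rho> (P + (u + v))) * (adj2 (V (P + u)) * (U (P + u) * V P)) * V (P + v)"
      by (simp add: juxt_def add_ac)
    also have "\<dots> = adj2 (\<rho> (P + (u + v))) * adj2 (?W P) * (?E * Q * ?F) * Q"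
      by (simp add: U V rot_def juxt_def adj2_mult mult.assoc cancel)
    also have "\<dots> = - adj2 (\<rho> (P + (u + v))) * adj2 (\<rho> (P + (u + v))) * adj2 (?W P) * Q"
      unfolding I2 by (simp add: rot_def adj2_mult mult.assoc cancel)
    also have "- adj2 (\<rho> (P + (u + v))) * adj2 (\<rho> (P + (u + v))) = \<rho> (P + (u + v))"
      using \<rho>_square[OF ne'(1)] by (metis adj2_adj2 adj2_mult adj2_uminus minus_mult_left minus_minus)
    finally show ?thesis by (simp add: mult.assoc)
  qed
  then show "?W (P + (u + v)) = \<rho> (P + (u + v)) * adj2 (?W P) * Q" .
  have 1: "rot (juxt U u ?W) (u + (u + v)) * ?E * Q * ?G = -1"
  proof -
    have "U P * ?W (P + u) = ?E * Q * V P"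
      by (simp add: juxt_def U rot_def mult.assoc add_ac)
    then have "rot (juxt U u ?W) (u + (u + v)) = ?E * Q * ?F * adj2 Q * adj2 ?E"
      unfolding rot_def[of "juxt U u ?W"] 
      by (simp add: juxt_def[of U u ?W] adj2_mult) (simp add: rot_def[of V] mult.assoc)
    then show ?thesis using I3 by (simp add: mult.assoc cr cancel)
  qed
  have 2: "rot (juxt ?W (u + v) V) (u + v + v) * ?G * Q * ?F = - 1"
  proof -
    \<comment> \<open>Here the path is pushed across two corners, the orbifold point P + v and then
      the puncture; \<open>\<rho>_P\<close> turns the second one into the inverse of Q.\<close>
    have "?W P * V (P + (u + v)) = V P * \<rho> (P + v) * (U (P + v) * V (P + (u + v)))"
      by (simp add: juxt_def rel[of P] mult.assoc)
    also have "U (P + v) * V (P + (u + v)) = V (P + v) * \<rho> P * U P"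
      using rel[of "P + v"] by (simp add: add_ac)
    also have "V P * \<rho> (P + v) * (V (P + v) * \<rho> P * U P) = adj2 ?F * adj2 Q * U P"
    proof -
      have Q\<rho>: "Q * (\<rho> P * X) = - adj2 Q * X" for X
        by (simp add: mult.assoc[symmetric] \<rho>_P)
      show ?thesis
        by (simp add: V mult.assoc \<rho>_square[OF ne(2)] Q\<rho> rot_def adj2_mult)
    qed
    finally have "rot (juxt ?W (u + v) V) (u + v + v) = adj2 ?F * adj2 Q * ?E * Q * ?F"
      unfolding rot_def[of "juxt ?W (u + v) V"]
      by (simp add: juxt_def[of ?W "u+v" V] adj2_mult add_ac) (simp add: rot_def[of U] mult.assoc)
    moreover have "?E * (Q * (?F * (?G * X))) = - X" for X
      using I3 by (metis mult.assoc mult_1 mult_minus_left)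
    ultimately show ?thesis by (simp add: mult.assoc cr cancel)
  qed
  have r1: "U s * ?W (s + u) = ?W s * \<rho> (s + (u + v)) * U (s + (u + v))" for s
    using rel[of "s + u"] by (simp add: juxt_def mult.assoc add_ac)
  have r2: "?W s * V (s + (u + v)) = V s * \<rho> (s + v) * ?W (s + v)" for s
    using rel[of s] by (simp add: juxt_def mult.assoc[symmetric] add_ac)
  show "regular U u ?W (u + v)"
    unfolding regular_def using detU detW ne ne' r1 U W 1 by blast
  show "regular ?W (u + v) V v"
    unfolding regular_def using detV detW ne ne' r2 V W 2 by blast
qed

lemma loop_eq:
  assumes "U (P + u) = \<rho> (P + u) * adj2 (U P) * Q"
  shows "loop U u = rot U u * Q"
  using assms by (simp add: loop_def rot_def mult.assoc)

text \<open>The trace identity for the loops A of U and C of W. The product of two adjacent loops is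
  the loop of the juxtaposition minus Q, so tr (A C) exceeds the trace of the juxtaposition by 2.
  The matrix A^(-1) C is conjugate to E^(-1) G, and the relation G E Q F = -1 makes its trace that
  of V plus 1. The second claim is symmetric.\<close>

lemma trace_loops:
  assumes "regular U u V v"
  defines "W \<equiv> juxt U u V"
  shows "tr2 (loop U u) * tr2 (loop W (u + v)) = 
           tr2 (loop (juxt U u W) (u + (u + v))) + tr2 (loop V v) + 3"
    and "tr2 (loop W (u + v)) * tr2 (loop V v) = 
           tr2 (loop (juxt W (u + v) V) (u + v + v)) + tr2 (loop U u) + 3"
proof -
  have detr: "det2 (rot U u) = 1" and trr: "adj2 (rot U u) = 1 - rot U u" "tr2 (rot U u) = 1"
    and lp: "loop U u = rot U u * Q"
    and detr': "det2 (rot V v) = 1" and trr': "adj2 (rot V v) = 1 - rot V v" "tr2 (rot V v) = 1"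
    and lp': "loop V v = rot V v * Q"
    if "regular U u V v" for U u V v
  proof -
    have t: "tr2 (rot U u) = 1" if "u \<noteq> 0" "\<And>s. det2 (U s) = 1" for U :: "parity \<Rightarrow> mat2" and u
    proof -
      have "tr2 (rot U u) = tr2 (adj2 (U P) * (U P * \<rho> (P + u)))"
        unfolding rot_def by (rule tr2_commute)
      also have "\<dots> = 1" using that tr_\<rho>[of "P + u"] by (simp add: mult_adj2)
      finally show ?thesis .
    qed
    have d: "det2 (U s) = 1" "det2 (V s) = 1" for s
      using that unfolding regular_def by blast+
    have ne: "u \<noteq> 0" "v \<noteq> 0"
      using that unfolding regular_def by blast+
    show "det2 (rot U u) = 1" "det2 (rot V v) = 1"
      by (simp_all add: rot_def d det_\<rho>)
    show tU: "tr2 (rot U u) = 1" and tV: "tr2 (rot V v) = 1"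
      using t ne d by blast+
    show "adj2 (rot U u) = 1 - rot U u" "adj2 (rot V v) = 1 - rot V v"
      by (simp_all add: adj2_eq tU tV)
    show "loop U u = rot U u * Q" "loop V v = rot V v * Q"
      using that loop_eq unfolding regular_def by blast+
  qed
  have mid: "rot U u * Q * rot V v = - adj2 (rot (juxt U u V) (u + v))"
    and prd: "tr2 (loop U u * loop V v) = tr2 (loop (juxt U u V) (u + v)) + 2"
    if "regular U u V v" for U u V v
  proof -
    let ?W = "juxt U u V"
    have r: "regular U u ?W (u + v)" using regular_juxt that by blast
    have "adj2 (rot ?W (u + v)) * (rot ?W (u + v) * (rot U u * Q * rot V v)) = adj2 (rot ?W (u + v)) * (- 1)"
      using that unfolding regular_def by (simp add: mult.assoc)
    then show m: "rot U u * Q * rot V v = - adj2 (rot ?W (u + v))"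
      by (simp add: mult_adj2[OF detr'[OF r]])
    have "loop U u * loop V v = rot U u * Q * rot V v * Q"
      using lp lp' that by (simp add: mult.assoc)
    also have "\<dots> = loop ?W (u + v) - Q"
      unfolding m trr'[OF r] lp'[OF r] by (simp add: algebra_simps)
    finally show "tr2 (loop U u * loop V v) = tr2 (loop ?W (u + v)) + 2"
      using tr_Q by simp
  qed
  note R = assms(1)
  have RU: "regular U u W (u + v)" and RV: "regular W (u + v) V v"
    using regular_juxt[OF R] by (simp_all add: W_def)
  let ?E = "rot U u" and ?F = "rot V v" and ?G = "rot W (u + v)"
  note cancel = mult_adj2[OF det_Q] mult_adj2[OF detr[OF R]] mult_adj2[OF detr'[OF R]]
  have m: "?E * Q * ?F = - adj2 ?G" using mid[OF R] by (simp add: W_def)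
  have "tr2 (adj2 (loop U u) * loop W (u + v)) = tr2 (adj2 Q * (adj2 ?E * ?G * Q))"
    unfolding lp[OF RU] lp'[OF RU] by (simp add: adj2_mult mult.assoc)
  also have "\<dots> = tr2 (adj2 ?E * ?G * Q * adj2 Q)" by (rule tr2_commute)
  also have "\<dots> = tr2 (adj2 ?E * ?G)" by (simp add: mult.assoc cancel)
  also have "\<dots> = tr2 (loop V v) + 1"
  proof -
    have "adj2 Q * (adj2 ?E * (?E * Q * ?F)) * Q = loop V v"
      by (simp add: mult.assoc cancel lp'[OF R])
    then have "tr2 (loop V v) = tr2 (adj2 Q * (adj2 ?E * (- adj2 ?G)) * Q)"
      unfolding m by simp
    also have "\<dots> = tr2 (Q * (adj2 Q * (adj2 ?E * (- adj2 ?G))))" by (rule tr2_commute)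
    also have "\<dots> = - tr2 (adj2 ?E * (1 - ?G))" by (simp add: cancel trr(1)[OF RV] algebra_simps)
    also have "\<dots> = tr2 (adj2 ?E * ?G) - 1" using trr(2)[OF R] by (simp add: algebra_simps)
    finally show ?thesis by simp
  qed
  finally show "tr2 (loop U u) * tr2 (loop W (u + v)) = 
           tr2 (loop (juxt U u W) (u + (u + v))) + tr2 (loop V v) + 3"
    using prd[OF RU] tr2_adj2_mult[of "loop U u" "loop W (u + v)"] by linarith
  have "tr2 (adj2 (loop V v) * loop W (u + v)) = tr2 (loop W (u + v) * adj2 (loop V v))"
    by (rule tr2_commute)
  also have "\<dots> = tr2 (?G * adj2 ?F)"
    unfolding lp[OF RV] lp'[OF RV] by (simp add: adj2_mult mult.assoc cancel)
  also have "\<dots> = tr2 (loop U u) + 1"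
  proof -
    have "?E * Q * ?F * adj2 ?F = loop U u"
      by (simp add: mult.assoc cancel lp[OF R])
    then have "tr2 (loop U u) = - tr2 ((1 - ?G) * adj2 ?F)"
      unfolding m using trr(1)[OF RV] by (metis minus_mult_left tr2_uminus)
    also have "\<dots> = tr2 (?G * adj2 ?F) - 1" using trr'(2)[OF R] by (simp add: algebra_simps)
    finally show ?thesis by simp
  qed
  finally show "tr2 (loop W (u + v)) * tr2 (loop V v) = 
           tr2 (loop (juxt W (u + v) V) (u + v + v)) + tr2 (loop U u) + 3"
    using prd[OF RV] tr2_adj2_mult[of "loop V v" "loop W (u + v)"]
      tr2_commute[of "loop V v" "loop W (u + v)"] by (simp add: mult.commute)
qed

end

section \<open>Christoffel words\<close>

definition turnL :: mat2 where "turnL = Mat2 1 1 0 1"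
definition turnR :: mat2 where "turnR = Mat2 1 0 1 1"

lemma det2_turn [simp]: "det2 turnL = 1" "det2 turnR = 1"
  by (simp_all add: det2_def turnL_def turnR_def)

text \<open>The letters contributed by one step of a path through the half lattice, where the parity is that
  of the left end of the antidiagonal half segment which is crossed: a lattice segment is crossed
  in its left or right half, which decides the side of its pivot, and a half segment joining two
  orbifold points contributes nothing.\<close>

fun cross :: "parity \<Rightarrow> dir \<Rightarrow> mat2" where
  "cross (a, b) North =
     (if b = 0 then if a = 0 then turnL * turnL * turnL * turnR else turnL * turnR * turnR
      else if a = 0 then 1 else turnR)"
| "cross (a, b) East =
     (if a = 0 then if b = 0 then turnL else 1
      else if b = 0 then turnR * turnL * turnL else turnR * turnR * turnR * turnL)"

fun shift :: "dir \<Rightarrow> parity" where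
  "shift East = (1, 0)"
| "shift North = (0, 1)"

primrec path_mat :: "dir list \<Rightarrow> parity \<Rightarrow> mat2" where
  "path_mat [] s = 1"
| "path_mat (d # ds) s = cross s d * path_mat ds (s + shift d)"

definition disp :: "dir list \<Rightarrow> parity" where "disp ds = sum_list (map shift ds)"

lemma path_mat_append: "path_mat (xs @ ys) s = path_mat xs s * path_mat ys (s + disp xs)"
  by (induction xs arbitrary: s) (simp_all add: disp_def mult.assoc add.assoc)

lemma disp_append: "disp (xs @ ys) = disp xs + disp ys"
  by (simp add: disp_def)

lemma det2_cross [simp]: "det2 (cross s d) = 1"
  by (cases "(s, d)" rule: cross.cases) simp_all

lemma det2_path_mat [simp]: "det2 (path_mat ds s) = 1"
  by (induction ds arbitrary: s) simp_all

text \<open>Added to an integer before a comparison with 0, it makes a strict inequality weak: a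
  point on the undisplaced line is to the right of a curve pushed left, and to the left of a curve
  pushed right.\<close>

fun offset :: "side \<Rightarrow> int" where
  "offset LeftSide = 0"
| "offset RightSide = 1"

text \<open>The line of slope \<open>p/q\<close> through the origin, displaced to the given side, crosses the antidiagonal
  \<open>x + y = K\<close> between the abscissae \<open>column K\<close> and \<open>column K + 1\<close>.  Scaling by 2, the same function
  describes the path through the half lattice.\<close>

definition column :: "side \<Rightarrow> nat \<Rightarrow> nat \<Rightarrow> int \<Rightarrow> int" where
  "column \<sigma> p q K = (int q * K - 1 + offset \<sigma>) div (int p + int q)"

definition column_step :: "side \<Rightarrow> nat \<Rightarrow> nat \<Rightarrow> nat \<Rightarrow> dir" where
  "column_step \<sigma> p q K = (if column \<sigma> p q (int K + 1) = column \<sigma> p q (int K) then North else East)"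

definition christoffel :: "side \<Rightarrow> nat \<Rightarrow> nat \<Rightarrow> dir list" where
  "christoffel \<sigma> p q = map (column_step \<sigma> p q) [0..<p + q]"

section \<open>The Stern-Brocot tree and the factorization of Christoffel words\<close>

inductive stern_brocot :: "nat \<Rightarrow> nat \<Rightarrow> nat \<Rightarrow> nat \<Rightarrow> bool" where
  base: "stern_brocot 0 1 1 1"
| left: "stern_brocot p1 q1 p2 q2 \<Longrightarrow> stern_brocot p1 q1 (p1 + p2) (q1 + q2)"
| right: "stern_brocot p1 q1 p2 q2 \<Longrightarrow> stern_brocot (p1 + p2) (q1 + q2) p2 q2"

lemma stern_brocot_det:
  assumes "stern_brocot p1 q1 p2 q2"
  shows "p2 * q1 = p1 * q2 + 1" "0 < q1" "0 < q2"
  using assms by (induction) (auto simp: algebra_simps)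

lemma div_eq_iff_bounds:
  fixes n m x :: int
  assumes "0 < n"
  shows "x div n = m \<longleftrightarrow> n * m \<le> x \<and> x < n * m + n"
proof
  assume "x div n = m"
  then have "n * m + x mod n = x" using mult_div_mod_eq by blast
  then show "n * m \<le> x \<and> x < n * m + n"
    using assms pos_mod_bound[of n x] pos_mod_sign[of n x] by linarith
next
  assume "n * m \<le> x \<and> x < n * m + n"
  then show "x div n = m"
    using assms by (intro int_div_pos_eq[of _ _ _ "x - n * m"]) auto
qed

text \<open>For the mediant c/N of b/n and a/m the determinant gives a/m - c/N = 1/(m N) and c/N -
  b/n = 1/(n N). In the stated ranges of K the two quotients compared, after the shift by a or b,
  thus differ by less than 1/m or 1/n, and no integer can come in between. The first two claims
  serve the left side, where the - 1 makes the floor a ceiling minus 1.\<close>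

lemma div_mediant:
  fixes a b m n K :: int
  assumes det: "a * n = b * m + 1" and n: "0 < m" "0 < n"
  shows "0 \<le> K \<Longrightarrow> K < m + n \<Longrightarrow> ((a + b) * K - 1) div (m + n) = (a * K - 1) div m"
    and "0 \<le> K \<Longrightarrow> K \<le> n \<Longrightarrow> ((a + b) * (m + K) - 1) div (m + n) = a + (b * K - 1) div n"
    and "0 \<le> K \<Longrightarrow> K < m + n \<Longrightarrow> ((a + b) * K) div (m + n) = (b * K) div n"
    and "0 \<le> K \<Longrightarrow> K \<le> m \<Longrightarrow> ((a + b) * (n + K)) div (m + n) = b + (a * K) div m"
proof -
  define c N where "c = a + b" and "N = m + n"
  have am: "a * N = c * m + 1" and bn: "c * n = b * N + 1"
    using det by (simp_all add: c_def N_def algebra_simps)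
  have mK: "m * (c * K) = N * (a * K) - K" and nK: "n * (c * K) = N * (b * K) + K" for K
  proof -
    have "m * (c * K) = (c * m) * K" "N * (a * K) = (a * N) * K" by simp_all
    then show "m * (c * K) = N * (a * K) - K" using am by (simp add: algebra_simps)
    have "n * (c * K) = (c * n) * K" "N * (b * K) = (b * N) * K" by simp_all
    then show "n * (c * K) = N * (b * K) + K" using bn by (simp add: algebra_simps)
  qed
  have N: "0 < N" "m < N" "n < N" using n by (simp_all add: N_def)
  have lessI: "x < y" if "k * x < k * y" "0 < k" for k x y :: int
    using that by (simp add: mult_less_cancel_left_pos)
  show "((a + b) * K - 1) div (m + n) = (a * K - 1) div m" if K: "0 \<le> K" "K < m + n"
  proof -
    define d where "d = (a * K - 1) div m"
    have d: "m * d + 1 \<le> a * K" "a * K \<le> m * d + m"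
      using div_eq_iff_bounds[OF n(1), of "a * K - 1" d] by (simp_all add: d_def)
    have "N * (m * d + 1) \<le> N * (a * K)" "N * (a * K) \<le> N * (m * d + m)"
      using d N(1) by (simp_all add: mult_left_mono)
    then have "m * (N * d) < m * (c * K)" "m * (c * K) < m * (N * d + N + 1)"
      using mK[of K] K n by (simp_all add: algebra_simps N_def)
    then have "N * d < c * K" "c * K < N * d + N + 1" using lessI n(1) by blast+
    then show ?thesis
      using div_eq_iff_bounds[OF N(1), of "c * K - 1" d] by (simp add: c_def N_def d_def)
  qed
  show "((a + b) * (m + K) - 1) div (m + n) = a + (b * K - 1) div n" if K: "0 \<le> K" "K \<le> n"
  proof -
    define d where "d = (b * K - 1) div n"
    have d: "n * d + 1 \<le> b * K" "b * K \<le> n * d + n"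
      using div_eq_iff_bounds[OF n(2), of "b * K - 1" d] by (simp_all add: d_def)
    have "N * (n * d + 1) \<le> N * (b * K)" "N * (b * K) \<le> N * (n * d + n)"
      using d N(1) by (simp_all add: mult_left_mono)
    then have "n * (N * d + 1) < n * (c * K)" "n * (c * K) < n * (N * d + N + 2)"
      using nK[of K] K n by (simp_all add: algebra_simps N_def)
    then have "N * d + 1 < c * K" "c * K < N * d + N + 2" using lessI n(2) by blast+
    then have "(c * (m + K) - 1) div N = a + d"
      using am by (subst div_eq_iff_bounds[OF N(1)]) (simp add: algebra_simps)
    then show ?thesis by (simp add: c_def N_def d_def)
  qed
  show "((a + b) * K) div (m + n) = (b * K) div n" if K: "0 \<le> K" "K < m + n"
  proof -
    define d where "d = (b * K) div n"
    have d: "n * d \<le> b * K" "b * K + 1 \<le> n * d + n"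
      using div_eq_iff_bounds[OF n(2), of "b * K" d] by (simp_all add: d_def)
    have "N * (n * d) \<le> N * (b * K)" "N * (b * K + 1) \<le> N * (n * d + n)"
      using d N(1) by (simp_all add: mult_left_mono)
    then have "n * (N * d - 1) < n * (c * K)" "n * (c * K) < n * (N * d + N)"
      using nK[of K] K n by (simp_all add: algebra_simps N_def)
    then have "N * d - 1 < c * K" "c * K < N * d + N" using lessI n(2) by blast+
    then show ?thesis
      using div_eq_iff_bounds[OF N(1), of "c * K" d] by (simp add: c_def N_def d_def)
  qed
  show "((a + b) * (n + K)) div (m + n) = b + (a * K) div m" if K: "0 \<le> K" "K \<le> m"
  proof -
    define d where "d = (a * K) div m"
    have d: "m * d \<le> a * K" "a * K + 1 \<le> m * d + m"
      using div_eq_iff_bounds[OF n(1), of "a * K" d] by (simp_all add: d_def)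
    have "N * (m * d) \<le> N * (a * K)" "N * (a * K + 1) \<le> N * (m * d + m)"
      using d N(1) by (simp_all add: mult_left_mono)
    then have "m * (N * d - 2) < m * (c * K)" "m * (c * K) < m * (N * d + N - 1)"
      using mK[of K] K n by (simp_all add: algebra_simps N_def)
    then have "N * d - 2 < c * K" "c * K < N * d + N - 1" using lessI n(1) by blast+
    then have "(c * (n + K)) div N = b + d"
      using bn by (subst div_eq_iff_bounds[OF N(1)]) (simp add: algebra_simps)
    then show ?thesis by (simp add: c_def N_def d_def)
  qed
qed

text \<open>With respect to the line of the mediant, (q1, p1) has height -1 and (q2, p2) height 1. A
  path that keeps lattice points on the line to its right can be bent to pass close by the former,
  one that keeps them to its left close by the latter, so the order of the factors depends on the
  side.\<close>

lemma christoffel_append: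
  assumes "stern_brocot p1 q1 p2 q2"
  shows "christoffel LeftSide (p1 + p2) (q1 + q2) = christoffel LeftSide p1 q1 @ christoffel LeftSide p2 q2"
    and "christoffel RightSide (p1 + p2) (q1 + q2) = christoffel RightSide p2 q2 @ christoffel RightSide p1 q1"
proof -
  have det: "int q1 * (int p2 + int q2) = int q2 * (int p1 + int q1) + 1"
    using arg_cong[OF stern_brocot_det(1)[OF assms], of int] by (simp add: algebra_simps)
  have n: "0 < int p1 + int q1" "0 < int p2 + int q2"
    using stern_brocot_det(2,3)[OF assms] by simp_all
  note M = div_mediant[OF det n]
  have up: "[0..<p1 + p2 + (q1 + q2)] = [0..<p1 + q1] @ map (\<lambda>K. p1 + q1 + K) [0..<p2 + q2]"
    "[0..<p1 + p2 + (q1 + q2)] = [0..<p2 + q2] @ map (\<lambda>K. p2 + q2 + K) [0..<p1 + q1]"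
    using upt_add_eq_append[of 0 "p1 + q1" "p2 + q2"] upt_add_eq_append[of 0 "p2 + q2" "p1 + q1"]
    by (simp_all add: map_add_upt add_ac)
  have "column_step LeftSide (p1 + p2) (q1 + q2) K = column_step LeftSide p1 q1 K" if "K < p1 + q1" for K
    using that M(1)[of "int K"] M(1)[of "int K + 1"] n
    by (simp add: column_step_def column_def algebra_simps)
  moreover have "column_step LeftSide (p1 + p2) (q1 + q2) (p1 + q1 + K) = column_step LeftSide p2 q2 K"
    if "K < p2 + q2" for K
    using that M(2)[of "int K"] M(2)[of "int K + 1"] n
    by (simp add: column_step_def column_def algebra_simps)
  ultimately show "christoffel LeftSide (p1 + p2) (q1 + q2) =
      christoffel LeftSide p1 q1 @ christoffel LeftSide p2 q2"
    by (simp add: christoffel_def up(1))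
  have "column_step RightSide (p1 + p2) (q1 + q2) K = column_step RightSide p2 q2 K" if "K < p2 + q2" for K
    using that M(3)[of "int K"] M(3)[of "int K + 1"] n
    by (simp add: column_step_def column_def algebra_simps)
  moreover have "column_step RightSide (p1 + p2) (q1 + q2) (p2 + q2 + K) = column_step RightSide p1 q1 K"
    if "K < p1 + q1" for K
    using that M(4)[of "int K"] M(4)[of "int K + 1"] n
    by (simp add: column_step_def column_def algebra_simps)
  ultimately show "christoffel RightSide (p1 + p2) (q1 + q2) =
      christoffel RightSide p2 q2 @ christoffel RightSide p1 q1"
    by (simp add: christoffel_def up(2))
qed

text \<open>The left end of the half segment crossed at K = 0: it is (-1, 1) for a path passing left
  of the origin, where \<open>column\<close> is -1, and the origin itself for a path passing right
  of it. The puncture is labelled by the class of this left end.\<close>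

fun base_point :: "side \<Rightarrow> parity" where
  "base_point LeftSide = (1, 1)"
| "base_point RightSide = (0, 0)"

text \<open>The values of \<open>cusp\<close> and \<open>cone\<close> are forced by the relations for the words of 0/1 and 1/1.\<close>

fun cusp :: "side \<Rightarrow> mat2" where
  "cusp LeftSide = Mat2 (-1) 0 (-6) (-1)"
| "cusp RightSide = Mat2 (-1) (-6) 0 (-1)"

fun cone :: "side \<Rightarrow> parity \<Rightarrow> mat2" where
  "cone LeftSide (a, b) =
     (if a = 0 then if b = 0 then Mat2 1 (-1) 1 0 else Mat2 (-1) (-1) 3 2
      else if b = 0 then Mat2 2 (-1) 3 (-1) else Mat2 (-1) 0 12 (-1))"
| "cone RightSide (a, b) =
     (if a = 0 then if b = 0 then Mat2 (-1) 12 0 (-1) else Mat2 2 3 (-1) (-1)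
      else if b = 0 then Mat2 (-1) 3 (-1) 2 else Mat2 0 1 (-1) 1)"

interpretation torsion "base_point \<sigma>" "cusp \<sigma>" "cone \<sigma>" for \<sigma>
proof
  show "det2 (cusp \<sigma>) = 1" "tr2 (cusp \<sigma>) = -2"
    by (cases \<sigma>; simp add: det2_def tr2_def)+
  show "det2 (cone \<sigma> s) = 1" for s
    by (cases "(\<sigma>, s)" rule: cone.cases) (simp_all add: det2_def)
  show "tr2 (cone \<sigma> s) = 1" if "s \<noteq> base_point \<sigma>" for s
    using that by (cases "(\<sigma>, s)" rule: cone.cases) (auto simp: tr2_def)
  show "cusp \<sigma> * cone \<sigma> (base_point \<sigma>) = - adj2 (cusp \<sigma>)"
    by (cases \<sigma>) (simp_all add: adj2_def mat2_defs)
qed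

lemma christoffel_base:
  "christoffel \<sigma> 0 1 = [East]"
  "christoffel LeftSide 1 1 = [East, North]" "christoffel RightSide 1 1 = [North, East]"
  by (cases \<sigma>; simp add: christoffel_def column_step_def column_def)
    (simp_all add: christoffel_def column_step_def column_def upt_rec)

lemma juxt_path_mat: "juxt (path_mat xs) (disp xs) (path_mat ys) = path_mat (xs @ ys)"
  by (rule ext) (simp add: juxt_def path_mat_append)

text \<open>A finite check over the four parity classes. The right side lists the word of 1/1 first,
  because there the factors in \<open>christoffel_append\<close> come in reverse order.\<close>

lemma regular_base:
  "regular LeftSide (path_mat [East]) (1, 0) (path_mat [East, North]) (1, 1)"
  "regular RightSide (path_mat [North, East]) (1, 1) (path_mat [East]) (1, 0)"
  unfolding regular_def juxt_def rot_def
  by (auto simp: zero_prod_def mat2_defs turnL_def turnR_def adj2_def det2_def)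

lemma regular_christoffel:
  assumes "stern_brocot p1 q1 p2 q2"
  defines "w \<equiv> \<lambda>\<sigma>. christoffel \<sigma> p1 q1" and "w' \<equiv> \<lambda>\<sigma>. christoffel \<sigma> p2 q2"
  shows "regular LeftSide (path_mat (w LeftSide)) (disp (w LeftSide)) (path_mat (w' LeftSide)) (disp (w' LeftSide))"
    and "regular RightSide (path_mat (w' RightSide)) (disp (w' RightSide)) (path_mat (w RightSide)) (disp (w RightSide))"
  using assms(1) unfolding w_def w'_def
proof (induction)
  case base
  have disp: "disp [East] = (1, 0)" "disp [East, North] = (1, 1)" "disp [North, East] = (1, 1)"
    by (simp_all add: disp_def)
  {
    case 1
    show ?case by (simp only: christoffel_base disp regular_base)
  next
    case 2
    show ?case by (simp only: christoffel_base disp regular_base)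
  }
next
  case (left p1 q1 p2 q2)
  {
    case 1
    then show ?case using regular_juxt[OF left.IH(1)]
      by (simp add: christoffel_append[OF left.hyps] juxt_path_mat disp_append)
  next
    case 2
    then show ?case using regular_juxt[OF left.IH(2)]
      by (simp add: christoffel_append[OF left.hyps] juxt_path_mat disp_append)
  }
next
  case (right p1 q1 p2 q2)
  {
    case 1
    then show ?case using regular_juxt[OF right.IH(1)]
      by (simp add: christoffel_append[OF right.hyps] juxt_path_mat disp_append)
  next
    case 2
    then show ?case using regular_juxt[OF right.IH(2)]
      by (simp add: christoffel_append[OF right.hyps] juxt_path_mat disp_append)
  }
qed

definition closed_trace :: "side \<Rightarrow> nat \<Rightarrow> nat \<Rightarrow> int" where
  "closed_trace \<sigma> p q =
     tr2 (path_mat (christoffel \<sigma> p q @ christoffel \<sigma> p q) (base_point \<sigma>))"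

lemma closed_trace_eq:
  "closed_trace \<sigma> p q = tr2 (loop \<sigma> (path_mat (christoffel \<sigma> p q)) (disp (christoffel \<sigma> p q)))"
  by (simp add: closed_trace_def loop_def path_mat_append)

text \<open>These are 6 m - 1 for m = 1, 3, 13. Three values are needed because the recursion starts
  from a fraction pair together with its mediant.\<close>

lemma closed_trace_base: "closed_trace \<sigma> 0 1 = 5" "closed_trace \<sigma> 1 1 = 17" "closed_trace \<sigma> 1 2 = 77"
proof -
  have "christoffel \<sigma> 1 2 = christoffel \<sigma> (0 + 1) (1 + 1)" for \<sigma> by (simp add: numeral_2_eq_2)
  then have "christoffel LeftSide 1 2 = [East, East, North]" "christoffel RightSide 1 2 = [North, East, East]"
    using christoffel_append[OF stern_brocot.base]
    by (simp_all only: christoffel_base append.simps)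
  then have "closed_trace \<sigma> 0 1 = 5 \<and> closed_trace \<sigma> 1 1 = 17 \<and> closed_trace \<sigma> 1 2 = 77"
    unfolding closed_trace_def
    by (cases \<sigma>; simp only: christoffel_base base_point.simps append.simps)
      (simp_all add: zero_prod_def mat2_defs turnL_def turnR_def tr2_def)
  then show "closed_trace \<sigma> 0 1 = 5" "closed_trace \<sigma> 1 1 = 17" "closed_trace \<sigma> 1 2 = 77"
    by blast+
qed

lemma closed_trace_mutation:
  fixes \<sigma>
  assumes "stern_brocot p1 q1 p2 q2"
  defines "t \<equiv> closed_trace \<sigma>"
  shows "t p1 q1 * t (p1 + p2) (q1 + q2) = t (p1 + (p1 + p2)) (q1 + (q1 + q2)) + t p2 q2 + 3"
    and "t (p1 + p2) (q1 + q2) * t p2 q2 = t (p1 + p2 + p2) (q1 + q2 + q2) + t p1 q1 + 3"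
proof -
  note a = christoffel_append[OF assms(1)]
    christoffel_append[OF stern_brocot.left[OF assms(1)]]
    christoffel_append[OF stern_brocot.right[OF assms(1)]]
  note R = regular_christoffel[OF assms(1)]
  show "t p1 q1 * t (p1 + p2) (q1 + q2) = t (p1 + (p1 + p2)) (q1 + (q1 + q2)) + t p2 q2 + 3"
    "t (p1 + p2) (q1 + q2) * t p2 q2 = t (p1 + p2 + p2) (q1 + q2 + q2) + t p1 q1 + 3"
    using trace_loops[OF R(1)] trace_loops[OF R(2)] unfolding t_def
    by (cases \<sigma>; simp only: juxt_path_mat disp_append[symmetric] a[symmetric] closed_trace_eq[symmetric];
        simp add: add_ac mult.commute)+
qed

section \<open>Generalized Markov numbers on the Stern-Brocot tree\<close>

definition loop_number :: "side \<Rightarrow> nat \<times> nat \<Rightarrow> rat" where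
  "loop_number \<sigma> = (\<lambda>(p, q). (of_int (closed_trace \<sigma> p q) + 1) / 6)"

lemma loop_number_base:
  "loop_number \<sigma> (0, 1) = 1" "loop_number \<sigma> (1, 1) = 3" "loop_number \<sigma> (1, 2) = 13"
  by (simp_all add: loop_number_def closed_trace_base del: One_nat_def)

text \<open>Under t = 6 m - 1 the constants of the trace recursion cancel, as 1 = -1 - 1 +
  3.\<close>

lemma loop_number_vieta:
  fixes \<sigma>
  assumes "stern_brocot p1 q1 p2 q2"
  defines "x \<equiv> loop_number \<sigma> (p1, q1)" and "y \<equiv> loop_number \<sigma> (p2, q2)"
    and "z \<equiv> loop_number \<sigma> (p1 + p2, q1 + q2)"
  shows "loop_number \<sigma> (p1 + (p1 + p2), q1 + (q1 + q2)) = 6 * x * z - x - z - y"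
    and "loop_number \<sigma> (p1 + p2 + p2, q1 + q2 + q2) = 6 * z * y - z - y - x"
  using arg_cong[OF closed_trace_mutation(1)[OF assms(1)], of "of_int :: int \<Rightarrow> rat" \<sigma>]
    arg_cong[OF closed_trace_mutation(2)[OF assms(1)], of "of_int :: int \<Rightarrow> rat" \<sigma>]
  unfolding x_def y_def z_def loop_number_def
  by (simp_all add: field_simps)

text \<open>For fixed x and y the equation is quadratic in z, with root sum 6 x y - x - y and root
  product x^2 + x y + y^2. The division in a mutation is therefore the passage to the other
  root.\<close>

lemma vieta_jump:
  fixes x y z z' :: rat
  assumes eq: "x\<^sup>2 + y\<^sup>2 + z\<^sup>2 + x * y + x * z + y * z = 6 * x * y * z"
    and z': "z' = 6 * x * y - x - y - z" and pos: "0 < x" "0 < y" "0 < z"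
  shows "z' * z = x\<^sup>2 + x * y + y\<^sup>2" "0 < z'"
    "x\<^sup>2 + y\<^sup>2 + z'\<^sup>2 + x * y + x * z' + y * z' = 6 * x * y * z'"
proof -
  show 1: "z' * z = x\<^sup>2 + x * y + y\<^sup>2"
    using eq unfolding z' by (simp add: algebra_simps power2_eq_square)
  have "0 < z' * z" unfolding 1 using pos by (simp add: add_pos_pos)
  then show "0 < z'" using pos by (simp add: zero_less_mult_iff)
  have "z' * (z + z') = z' * (6 * x * y - x - y)" using z' by simp
  then show "x\<^sup>2 + y\<^sup>2 + z'\<^sup>2 + x * y + x * z' + y * z' = 6 * x * y * z'"
    using 1 by (simp add: algebra_simps power2_eq_square)
qed

lemma loop_number_markov:
  fixes \<sigma>
  assumes "stern_brocot p1 q1 p2 q2"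
  shows "let x = loop_number \<sigma> (p1, q1); y = loop_number \<sigma> (p2, q2);
      z = loop_number \<sigma> (p1 + p2, q1 + q2)
    in x\<^sup>2 + y\<^sup>2 + z\<^sup>2 + x * y + x * z + y * z = 6 * x * y * z \<and> 0 < x \<and> 0 < y \<and> 0 < z"
  using assms
proof induction
  case base
  show ?case
    using loop_number_base[of \<sigma>] by (simp add: Let_def numeral_2_eq_2)
next
  case (left p1 q1 p2 q2)
  then show ?case
    using vieta_jump[OF _ loop_number_vieta(1)[OF left.hyps, of \<sigma>]]
    by (simp add: Let_def algebra_simps)
next
  case (right p1 q1 p2 q2)
  then show ?case
    using vieta_jump[OF _ loop_number_vieta(2)[OF right.hyps, of \<sigma>]]
    by (simp add: Let_def algebra_simps)
qed

lemma loop_number_mutation: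
  fixes \<sigma>
  assumes "stern_brocot p1 q1 p2 q2"
  defines "x \<equiv> loop_number \<sigma> (p1, q1)" and "y \<equiv> loop_number \<sigma> (p2, q2)"
    and "z \<equiv> loop_number \<sigma> (p1 + p2, q1 + q2)"
  shows "(x\<^sup>2 + x * z + z\<^sup>2) / y = loop_number \<sigma> (p1 + (p1 + p2), q1 + (q1 + q2))"
    and "(y\<^sup>2 + y * z + z\<^sup>2) / x = loop_number \<sigma> (p1 + p2 + p2, q1 + q2 + q2)"
proof -
  have m: "x\<^sup>2 + y\<^sup>2 + z\<^sup>2 + x * y + x * z + y * z = 6 * x * y * z" and pos: "0 < x" "0 < y" "0 < z"
    using loop_number_markov[OF assms(1), of \<sigma>] by (simp_all add: Let_def x_def y_def z_def)
  show "(x\<^sup>2 + x * z + z\<^sup>2) / y = loop_number \<sigma> (p1 + (p1 + p2), q1 + (q1 + q2))"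
    using vieta_jump(1)[of x z y, OF _ loop_number_vieta(1)[OF assms(1), of \<sigma>, folded x_def y_def z_def]] m pos
    by (simp add: field_simps)
  show "(y\<^sup>2 + y * z + z\<^sup>2) / x = loop_number \<sigma> (p1 + p2 + p2, q1 + q2 + q2)"
    using vieta_jump(1)[of z y x, OF _ loop_number_vieta(2)[OF assms(1), of \<sigma>, folded x_def y_def z_def]] m pos
    by (simp add: field_simps)
qed

section \<open>Clusters reached by admissible sequences\<close>

definition seed :: "side \<Rightarrow> nat \<times> nat \<Rightarrow> (int \<times> int) \<times> rat" where
  "seed \<sigma> v = ((int (fst v), int (snd v)), loop_number \<sigma> v)"

text \<open>The invariant of admissible sequences: \<open>k\<close> was mutated last and holds the
  mediant of the other two. Mutating \<open>k\<close> again would go back up the tree, which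
  admissibility forbids; mutating \<open>i\<close> or \<open>j\<close> goes down.\<close>

definition seeded :: "side \<Rightarrow> position \<Rightarrow> position \<Rightarrow> position \<Rightarrow> nat \<times> nat \<Rightarrow> nat \<times> nat \<Rightarrow> cluster \<Rightarrow> bool" where
  "seeded \<sigma> i j k v w C \<longleftrightarrow> distinct [i, j, k] \<and> stern_brocot (fst v) (snd v) (fst w) (snd w) \<and>
     C i = seed \<sigma> v \<and> C j = seed \<sigma> w \<and> C k = seed \<sigma> (v + w)"

text \<open>The two other positions may be listed in either order, since the new label and number
  are symmetric in them. The last hypothesis excludes the subtracting branch; under
  \<open>seeded\<close> it follows from unimodularity.\<close>

lemma mutate_eq:
  assumes "distinct [i, j, k]" "C i = ((a, b), x)" "C j = ((c, d), y)" "C k = ((e, f), z)"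
    and "e * (b + d) \<noteq> f * (a + c)"
  shows "mutate k C = C(k := ((a + c, b + d), (x\<^sup>2 + x * y + y\<^sup>2) / z))"
  using assms
  by (cases i; cases j; cases k) (simp_all add: mutate_def algebra_simps)

lemma seeded_mutate:
  assumes "seeded \<sigma> i j k v w C"
  shows "seeded \<sigma> i k j v (v + w) (mutate j C)" "seeded \<sigma> k j i (v + w) w (mutate i C)"
proof -
  obtain p1 q1 p2 q2 where vw: "v = (p1, q1)" "w = (p2, q2)" by (metis surj_pair)
  have d: "distinct [i, k, j]" "distinct [j, k, i]" and sb: "stern_brocot p1 q1 p2 q2"
    and C: "C i = seed \<sigma> (p1, q1)" "C j = seed \<sigma> (p2, q2)" "C k = seed \<sigma> (p1 + p2, q1 + q2)"
    using assms by (auto simp: seeded_def vw)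
  note C' = C[unfolded seed_def fst_conv snd_conv]
  have det: "int p2 * int q1 = int p1 * int q2 + 1"
    using arg_cong[OF stern_brocot_det(1)[OF sb], of int] by simp
  have "mutate j C = C(j := seed \<sigma> (p1 + (p1 + p2), q1 + (q1 + q2)))"
    using det loop_number_mutation(1)[OF sb, of \<sigma>]
    by (subst mutate_eq[OF d(1) C'(1,3,2)]) (simp_all add: seed_def algebra_simps)
  then show "seeded \<sigma> i k j v (v + w) (mutate j C)"
    using d C stern_brocot.left[OF sb] by (simp add: seeded_def vw)
  have "mutate i C = C(i := seed \<sigma> (p1 + p2 + p2, q1 + q2 + q2))"
    using det loop_number_mutation(2)[OF sb, of \<sigma>]
    by (subst mutate_eq[OF d(2) C'(2,3,1)]) (simp_all add: seed_def algebra_simps)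
  then show "seeded \<sigma> k j i (v + w) w (mutate i C)"
    using d C stern_brocot.right[OF sb] by (simp add: seeded_def vw)
qed

lemma seeded_start: "seeded \<sigma> P01 Pm11 P10 (0, 1) (1, 1) (fold mutate [Pm11, P10] initial_cluster)"
proof -
  have "mutate Pm11 initial_cluster = initial_cluster(Pm11 := ((1, 1), 3))"
    using mutate_eq[of P01 P10 Pm11 initial_cluster 0 1 1 1 0 1 "-1" 1 1]
    by (simp add: initial_cluster_def)
  then show ?thesis
    using loop_number_base[of \<sigma>] stern_brocot.base
    by (simp add: mutate_eq[of P01 Pm11 P10] initial_cluster_def seeded_def seed_def numeral_2_eq_2)
qed

lemma admissible_snoc:
  assumes "ks \<noteq> []" "admissible_sequence ks"
  shows "admissible_sequence (ks @ [k]) \<longleftrightarrow> k \<noteq> last ks"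
proof -
  have "2 \<le> length ks"
    using assms(2) unfolding admissible_sequence_def by (cases ks; cases "tl ks") auto
  then show ?thesis
    using assms by (auto simp: admissible_sequence_def distinct_adj_append_iff)
qed

lemma admissible_seeded:
  assumes "admissible_sequence ks"
  shows "\<exists>i j v w. seeded \<sigma> i j (last ks) v w (fold mutate ks initial_cluster)"
proof -
  obtain r where ks: "ks = [Pm11, P10] @ r"
    using assms unfolding admissible_sequence_def by (metis append_take_drop_id)
  show ?thesis using assms unfolding ks
  proof (induction r rule: rev_induct)
    case Nil
    show ?case
      using seeded_start[of \<sigma>]
      by (intro exI[of _ P01] exI[of _ Pm11] exI[of _ "(0, 1)"] exI[of _ "(1, 1)"]) simp
  next
    case (snoc k r)
    let ?ks = "[Pm11, P10] @ r"
    have "admissible_sequence ?ks" and k: "k \<noteq> last ?ks"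
      using snoc.prems by (auto simp: admissible_sequence_def distinct_adj_append_iff simp del: append.simps append_assoc simp flip: append_assoc)
    then obtain i j v w where s: "seeded \<sigma> i j (last ?ks) v w (fold mutate ?ks initial_cluster)"
      using snoc.IH by blast
    then have "k = i \<or> k = j"
      using k unfolding seeded_def by (cases i; cases j; cases k; cases "last ?ks") auto
    then show ?case
    proof
      assume "k = i"
      then show ?thesis using seeded_mutate(2)[OF s]
        by (intro exI[of _ "last ?ks"] exI[of _ j] exI[of _ "v + w"] exI[of _ w]) simp
    next
      assume "k = j"
      then show ?thesis using seeded_mutate(1)[OF s]
        by (intro exI[of _ i] exI[of _ "last ?ks"] exI[of _ v] exI[of _ "v + w"]) simp
    qed
  qed
qed

lemma stern_brocot_seeded:
  assumes "stern_brocot p1 q1 p2 q2"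
  shows "\<exists>ks i j. admissible_sequence ks \<and>
    seeded \<sigma> i j (last ks) (p1, q1) (p2, q2) (fold mutate ks initial_cluster)"
  using assms
proof induction
  case base
  show ?case
    using seeded_start[of \<sigma>] by (intro exI[of _ "[Pm11, P10]"]) (auto simp: admissible_sequence_def)
next
  case (left p1 q1 p2 q2)
  then obtain ks i j where ks: "admissible_sequence ks"
    and s: "seeded \<sigma> i j (last ks) (p1, q1) (p2, q2) (fold mutate ks initial_cluster)" by blast
  have "ks \<noteq> []" using ks by (auto simp: admissible_sequence_def)
  moreover have "j \<noteq> last ks" using s by (auto simp: seeded_def)
  ultimately have "admissible_sequence (ks @ [j])" using ks admissible_snoc by blast
  then show ?case using seeded_mutate(1)[OF s] by (intro exI[of _ "ks @ [j]"]) auto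
next
  case (right p1 q1 p2 q2)
  then obtain ks i j where ks: "admissible_sequence ks"
    and s: "seeded \<sigma> i j (last ks) (p1, q1) (p2, q2) (fold mutate ks initial_cluster)" by blast
  have "ks \<noteq> []" using ks by (auto simp: admissible_sequence_def)
  moreover have "i \<noteq> last ks" using s by (auto simp: seeded_def)
  ultimately have "admissible_sequence (ks @ [i])" using ks admissible_snoc by blast
  then show ?case using seeded_mutate(2)[OF s] by (intro exI[of _ "ks @ [i]"]) auto
qed

text \<open>Subtractive Euclidean algorithm on the denominators: unimodularity makes the numerators
  compare the same way, so the fraction with the smaller denominator can be subtracted from the
  other one. The bounds persist and keep the descent in [0, 1], so it ends at 0/1 and 1/1.\<close>

lemma stern_brocotI:
  assumes "p2 * q1 = p1 * q2 + 1" "p1 \<le> q1" "p2 \<le> q2"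
  shows "stern_brocot p1 q1 p2 q2"
  using assms
proof (induction "q1 + q2" arbitrary: p1 q1 p2 q2 rule: less_induct)
  case less
  have q: "0 < q1" "0 < p2" using less.prems(1) by (auto intro: gr0I)
  then have "0 < q2" using less.prems by simp
  consider "q1 = q2" | "q2 < q1" | "q1 < q2" by linarith
  then show ?case
  proof cases
    case 1
    then have "q1 * (p2 - p1) = 1" using less.prems(1) by (simp add: diff_mult_distrib2 mult.commute)
    then show ?thesis using 1 less.prems stern_brocot.base by (auto simp: nat_mult_eq_1_iff)
  next
    case 2
    then obtain r where r: "q1 = r + q2" "0 < r" by (metis less_imp_add_positive add.commute)
    have "p2 * 1 \<le> p2 * r" using r by (intro mult_le_mono) auto
    moreover have "p2 * q1 = p2 * r + p2 * q2" by (simp add: r algebra_simps)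
    ultimately have "p2 * q2 + p2 \<le> p1 * q2 + 1" using less.prems(1) by linarith
    then have "p2 * q2 \<le> p1 * q2" using q by linarith
    then have "p2 \<le> p1" using \<open>0 < q2\<close> by simp
    then obtain s where s: "p1 = s + p2" by (metis le_add_diff_inverse2)
    have d: "p2 * r = s * q2 + 1" using less.prems(1) by (simp add: r s algebra_simps)
    have "s \<le> r"
    proof (rule ccontr)
      assume "\<not> s \<le> r"
      then have "(r + 1) * p2 \<le> s * q2" using less.prems(3) by (intro mult_le_mono) auto
      then show False using d by (simp add: algebra_simps)
    qed
    then have "stern_brocot s r p2 q2" using less.hyps[of r q2 p2 s] d less.prems(3) \<open>0 < q2\<close> r by simp
    then show ?thesis using stern_brocot.right by (simp add: r s)
  next
    case 3
    then obtain r where r: "q2 = r + q1" "0 < r" by (metis less_imp_add_positive add.commute)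
    have "p1 * q1 \<le> p1 * q2" using 3 by simp
    then have "p1 * q1 < p2 * q1" using less.prems(1) by linarith
    then have "p1 < p2" using q by simp
    then obtain s where s: "p2 = s + p1" by (metis less_imp_le le_add_diff_inverse2)
    have d: "s * q1 = p1 * r + 1" using less.prems(1) by (simp add: r s algebra_simps)
    have "s \<le> r"
    proof (rule ccontr)
      assume "\<not> s \<le> r"
      then have "(r + 1) * q1 \<le> s * q1" by (intro mult_le_mono) auto
      moreover have "p1 * r \<le> q1 * r" using less.prems(2) by simp
      moreover have "(r + 1) * q1 = q1 * r + q1" by (simp add: algebra_simps)
      ultimately have "q1 \<le> 1" using d by linarith
      then have "q1 = 1" using q by simp
      then show False using d \<open>\<not> s \<le> r\<close> r s less.prems(2,3)
        by (cases p1) auto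
    qed
    then have "stern_brocot p1 q1 s r" using less.hyps[of q1 r s p1] d less.prems(2) q r by simp
    then show ?thesis using stern_brocot.left[of p1 q1 s r] by (simp add: r s add.commute)
  qed
qed

lemma stern_brocot_exists:
  assumes "0 < p" "p < q" "gcd p q = 1"
  shows "\<exists>p1 q1 p2 q2. stern_brocot p1 q1 p2 q2 \<and> p = p1 + p2 \<and> q = q1 + q2"
proof -
  obtain x y where xy: "p * x = q * y + 1"
    using bezout_nat[of p q] assms by auto
  \<comment> \<open>The inverse of p modulo q is the denominator of the left parent of p/q; the
    right parent is what remains.\<close>
  define q1 p1 where "q1 = x mod q" and "p1 = (p * q1) div q"
  have "2 \<le> q" using assms by linarith
  have "(p * q1) mod q = (p * x) mod q" by (simp add: q1_def mod_mult_right_eq)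
  also have "\<dots> = 1" using mod_mult_self2[of 1 q y] \<open>2 \<le> q\<close> by (simp add: xy)
  finally have e: "p * q1 = p1 * q + 1"
    using div_mult_mod_eq[of "p * q1" q] by (simp add: p1_def)
  have q1: "q1 < q" using assms by (simp add: q1_def)
  have "p1 * q < p * q" using e q1 assms(1) by (metis add_lessD1 less_add_one mult_less_mono2 less_trans)
  then have p1: "p1 < p" by simp
  obtain r where r: "q = q1 + r" "0 < r" using q1 by (metis less_imp_add_positive)
  obtain s where s: "p = p1 + s" using p1 by (metis less_imp_le le_add_diff_inverse)
  have d: "s * q1 = p1 * r + 1" using e by (simp add: r s algebra_simps)
  have "p1 * q < p * q1" using e by simp
  also have "\<dots> \<le> q * q1" using assms by simp
  finally have "p1 < q1" by (simp add: mult.commute)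
  moreover have "s \<le> r"
  proof (rule ccontr)
    assume "\<not> s \<le> r"
    then have "(r + 1) * q1 \<le> s * q1" by (intro mult_le_mono) auto
    moreover have "(p1 + 1) * r \<le> q1 * r" using \<open>p1 < q1\<close> by (intro mult_le_mono) auto
    ultimately have "r + q1 \<le> 1" using d by (simp add: algebra_simps)
    then show False using \<open>2 \<le> q\<close> r by simp
  qed
  ultimately have "stern_brocot p1 q1 s r" using stern_brocotI[OF d] by simp
  then show ?thesis using r s by blast
qed

theorem gen_markov_eq:
  assumes "0 < p" "p \<le> q" "gcd p q = 1"
  shows "gen_markov p q = loop_number \<sigma> (p, q)"
  unfolding gen_markov_def
proof (rule the_equality)
  have "\<exists>ks k. admissible_sequence ks \<and> fold mutate ks initial_cluster k = seed \<sigma> (p, q)"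
  \<comment> \<open>Every other fraction is a mediant in the tree; 1/1 occurs as an end of the root
    pair.\<close>
  proof (cases "p = q")
    case True
    then have "p = 1" "q = 1" using assms by auto
    obtain ks i j where "admissible_sequence ks" 
      "seeded \<sigma> i j (last ks) (0, 1) (1, 1) (fold mutate ks initial_cluster)"
      using stern_brocot_seeded[OF stern_brocot.base] by blast
    then show ?thesis unfolding seeded_def \<open>p = 1\<close> \<open>q = 1\<close> by blast
  next
    case False
    then obtain p1 q1 p2 q2 where sb: "stern_brocot p1 q1 p2 q2" and "p = p1 + p2" "q = q1 + q2"
      using stern_brocot_exists[of p q] assms by auto
    obtain ks i j where "admissible_sequence ks" 
      "seeded \<sigma> i j (last ks) (p1, q1) (p2, q2) (fold mutate ks initial_cluster)"
      using stern_brocot_seeded[OF sb] by blast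
    then show ?thesis unfolding seeded_def \<open>p = _\<close> \<open>q = _\<close> by auto
  qed
  then show "\<exists>ks k. admissible_sequence ks \<and>
      fold mutate ks initial_cluster k = ((int p, int q), loop_number \<sigma> (p, q))"
    by (simp add: seed_def)
next
  fix z
  assume "\<exists>ks k. admissible_sequence ks \<and> fold mutate ks initial_cluster k = ((int p, int q), z)"
  then obtain ks k where "admissible_sequence ks"
    and k: "fold mutate ks initial_cluster k = ((int p, int q), z)" by blast
  then obtain i j v w where s: "seeded \<sigma> i j (last ks) v w (fold mutate ks initial_cluster)"
    using admissible_seeded by blast
  then have "k = i \<or> k = j \<or> k = last ks"
    unfolding seeded_def by (cases i; cases j; cases k; cases "last ks") auto
  \<comment> \<open>Uniqueness: in a reachable cluster the label determines the number.\<close>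
  then obtain v where "fold mutate ks initial_cluster k = seed \<sigma> v"
    using s unfolding seeded_def by blast
  with k show "z = loop_number \<sigma> (p, q)" by (cases v) (simp add: seed_def)
qed

section \<open>Good matchings as a trace\<close>

lemma perfect_matching_singleton: "perfect_matching {e} M \<longleftrightarrow> M = {e}" if "e \<noteq> {}"
  using that by (auto simp: perfect_matching_def)

text \<open>A tile is attached along xy, with new vertices a and b. A matching without ab must use
  ax and by; replacing these two by xy gives a matching of the old graph that uses xy.\<close>

lemma perfect_matching_add_tile:
  fixes E' :: "'v set set"
  assumes xy: "{x, y} \<in> E'" "x \<noteq> y" and ab: "a \<noteq> b" "a \<notin> \<Union>E'" "b \<notin> \<Union>E'"
  defines "E \<equiv> insert {a, b} (insert {a, x} (insert {b, y} E'))"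
  shows "{M. perfect_matching E M} =
      insert {a, b} ` {M. perfect_matching E' M} \<union>
      (\<lambda>M. insert {a, x} (insert {b, y} (M - {{x, y}}))) ` {M. perfect_matching E' M \<and> {x, y} \<in> M}"
    (is "?L = ?f ` ?A \<union> ?g ` ?B")
proof (intro equalityI subsetI)
  have ne: "a \<noteq> x" "a \<noteq> y" "b \<noteq> x" "b \<noteq> y" using xy ab by blast+
  have V: "\<Union>E = insert a (insert b (\<Union>E'))" using xy by (auto simp: E_def)
  fix M
  {
    assume "M \<in> ?L"
    then have ME: "M \<subseteq> E" and M: "\<And>v. v \<in> \<Union>E \<Longrightarrow> \<exists>!e. e \<in> M \<and> v \<in> e"
      unfolding perfect_matching_def mem_Collect_eq by blast+
    have uniq: "e = e'" if "e \<in> M" "e' \<in> M" "v \<in> e" "v \<in> e'" for e e' v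
      using M[of v] that ME by blast
    have E': "e \<in> E' \<longleftrightarrow> a \<notin> e \<and> b \<notin> e" if "e \<in> M" for e
      using that ME ab by (auto simp: E_def)
    show "M \<in> ?f ` ?A \<union> ?g ` ?B"
    proof (cases "{a, b} \<in> M")
      case True
      let ?M = "M - {{a, b}}"
      have sub: "?M \<subseteq> E'"
      proof
        fix e assume e: "e \<in> ?M"
        then have "a \<notin> e" "b \<notin> e" using uniq[of e "{a, b}"] True by auto
        then show "e \<in> E'" using e E' by blast
      qed
      have "perfect_matching E' ?M"
        unfolding perfect_matching_def
      proof (intro conjI ballI sub)
        fix v assume v: "v \<in> \<Union>E'"
        then have "v \<noteq> a" "v \<noteq> b" using ab by blast+
        then show "\<exists>!e. e \<in> ?M \<and> v \<in> e" using M[of v] v V by auto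
      qed
      moreover have "M = ?f ?M" using True by blast
      ultimately show ?thesis by blast
    next
      case False
      have "\<exists>e. e \<in> M \<and> a \<in> e" "\<exists>e. e \<in> M \<and> b \<in> e" using M[THEN ex1_implies_ex] by (simp_all add: V)
      then have ax: "{a, x} \<in> M" and yb: "{b, y} \<in> M"
        using ME ab ne False by (auto simp: E_def)
      let ?M' = "M - {{a, x}, {b, y}}"
      let ?M = "insert {x, y} ?M'"
      have xyM: "{x, y} \<notin> M"
        using uniq[of "{x, y}" "{a, x}" x] ax ne by (auto simp: doubleton_eq_iff)
      have sub: "?M \<subseteq> E'"
      proof
        fix e assume e: "e \<in> ?M"
        show "e \<in> E'"
        proof (cases "e = {x, y}")
          case True then show ?thesis using xy by simp
        next
          case False
          then have "e \<in> M" "a \<notin> e" "b \<notin> e" using e uniq[of e "{a, x}"] uniq[of e "{b, y}"] ax yb by auto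
          then show ?thesis using E' by blast
        qed
      qed
      have "perfect_matching E' ?M"
        unfolding perfect_matching_def
      proof (intro conjI ballI sub)
        fix v assume v: "v \<in> \<Union>E'"
        then have vab: "v \<noteq> a" "v \<noteq> b" using ab by blast+
        show "\<exists>!e. e \<in> ?M \<and> v \<in> e"
        proof (cases "v = x \<or> v = y")
          case True
          have "e = {x, y}" if "e \<in> ?M" "v \<in> e" for e
          proof (rule ccontr)
            assume "e \<noteq> {x, y}"
            then have "e \<in> M" "e \<noteq> {a, x}" "e \<noteq> {b, y}" using that by auto
            then show False using uniq[of e "{a, x}" v] uniq[of e "{b, y}" v] ax yb that True by blast
          qed
          then show ?thesis using True by (intro ex1I[of _ "{x, y}"]) auto
        next
          case False
          obtain e where e: "e \<in> M" "v \<in> e" using M[of v] v V by blast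
          then have "e \<in> ?M" using vab False by auto
          moreover have "e' = e" if "e' \<in> ?M" "v \<in> e'" for e'
            using that False e uniq[of e' e v] by auto
          ultimately show ?thesis using e by (intro ex1I[of _ e]) auto
        qed
      qed
      moreover have "M = ?g ?M"
      proof -
        have "?M - {{x, y}} = ?M'" using xyM by blast
        then show ?thesis using ax yb by auto
      qed
      ultimately show ?thesis by blast
    qed
  }
  {
    assume "M \<in> ?f ` ?A \<union> ?g ` ?B"
    then consider (f) M' where "perfect_matching E' M'" "M = ?f M'"
      | (g) M' where "perfect_matching E' M'" "{x, y} \<in> M'" "M = ?g M'" by blast
    then show "M \<in> ?L"
    proof cases
      case f
      then have sub: "M' \<subseteq> E'" and M': "\<And>v. v \<in> \<Union>E' \<Longrightarrow> \<exists>!e. e \<in> M' \<and> v \<in> e"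
        unfolding perfect_matching_def by blast+
      have nab: "e \<notin> M'" if "a \<in> e \<or> b \<in> e" for e using that sub ab by blast
      have uq: "\<exists>!e. e \<in> M \<and> v \<in> e" if "v \<in> \<Union>E" for v
      proof (cases "v = a \<or> v = b")
        case True
        then show ?thesis using nab by (intro ex1I[of _ "{a, b}"]) (auto simp: f)
      next
        case False
        then have "v \<in> \<Union>E'" using that V by blast
        then obtain e where e: "e \<in> M'" "v \<in> e" "\<And>e'. e' \<in> M' \<Longrightarrow> v \<in> e' \<Longrightarrow> e' = e"
          using M' by metis
        show ?thesis
        proof (rule ex1I[of _ e])
          show "e \<in> M \<and> v \<in> e" using e f by blast
          show "e' = e" if "e' \<in> M \<and> v \<in> e'" for e' using that e(3)[of e'] False f by blast
        qed
      qed
      have "M \<subseteq> E" using sub unfolding E_def f by blast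
      then show ?thesis using uq unfolding perfect_matching_def mem_Collect_eq by (intro conjI ballI)
    next
      case g
      then have sub: "M' \<subseteq> E'" and M': "\<And>v. v \<in> \<Union>E' \<Longrightarrow> \<exists>!e. e \<in> M' \<and> v \<in> e"
        unfolding perfect_matching_def by blast+
      have nab: "e \<notin> M'" if "a \<in> e \<or> b \<in> e" for e using that sub ab by blast
      have xyu: "e = {x, y}" if "e \<in> M'" "x \<in> e \<or> y \<in> e" for e
      proof -
        have "x \<in> \<Union>E'" "y \<in> \<Union>E'" using xy(1) by blast+
        with M' have "\<exists>!e. e \<in> M' \<and> x \<in> e" "\<exists>!e. e \<in> M' \<and> y \<in> e" by blast+
        moreover have "x \<in> {x, y}" "y \<in> {x, y}" by simp_all
        ultimately show ?thesis using that g(2) by metis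
      qed
      have uq: "\<exists>!e. e \<in> M \<and> v \<in> e" if "v \<in> \<Union>E" for v
      proof -
        have none: "u \<notin> e" if "e \<in> M' - {{x, y}}" "u \<in> {a, b, x, y}" for e u
          using nab[of e] xyu[of e] that by blast
        consider "v = a \<or> v = x" | "v = b \<or> v = y" | "v \<notin> {a, b, x, y}" by blast
        then show ?thesis
        proof cases
          case 1
          then have "v \<notin> {b, y}" and v: "v \<in> {a, b, x, y}" using ne xy(2) ab(1) by auto
          show ?thesis
          proof (rule ex1I[of _ "{a, x}"])
            show "{a, x} \<in> M \<and> v \<in> {a, x}" using 1 g(3) by blast
            fix e assume "e \<in> M \<and> v \<in> e"
            moreover from this have "e = {a, x} \<or> e = {b, y} \<or> e \<in> M' - {{x, y}}" using g(3) by blast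
            ultimately show "e = {a, x}" using none[OF _ v] \<open>v \<notin> {b, y}\<close> by blast
          qed
        next
          case 2
          then have "v \<notin> {a, x}" and v: "v \<in> {a, b, x, y}" using ne xy(2) ab(1) by auto
          show ?thesis
          proof (rule ex1I[of _ "{b, y}"])
            show "{b, y} \<in> M \<and> v \<in> {b, y}" using 2 g(3) by blast
            fix e assume "e \<in> M \<and> v \<in> e"
            moreover from this have "e = {b, y} \<or> e = {a, x} \<or> e \<in> M' - {{x, y}}" using g(3) by blast
            ultimately show "e = {b, y}" using none[OF _ v] \<open>v \<notin> {a, x}\<close> by blast
          qed
        next
          case 3
          then have "v \<in> \<Union>E'" using that V by blast
          then obtain e where e: "e \<in> M'" "v \<in> e" "\<And>e'. e' \<in> M' \<Longrightarrow> v \<in> e' \<Longrightarrow> e' = e"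
            using M' by metis
          show ?thesis
          proof (rule ex1I[of _ e])
            show "e \<in> M \<and> v \<in> e" using e 3 g(3) by blast
            show "e' = e" if "e' \<in> M \<and> v \<in> e'" for e' using that e(3)[of e'] 3 g(3) by blast
          qed
        qed
      qed
      have "M \<subseteq> E" using sub unfolding E_def g(3) by blast
      then show ?thesis using uq unfolding perfect_matching_def mem_Collect_eq by (intro conjI ballI)
    qed
  }
qed

section \<open>Transfer matrices of snake graphs\<close>

definition match_count :: "'v set set \<Rightarrow> 'v set \<Rightarrow> 'v set \<Rightarrow> bool \<Rightarrow> bool \<Rightarrow> nat" where
  "match_count E e e' i j = card {M. perfect_matching E M \<and> (e \<in> M \<longleftrightarrow> i) \<and> (e' \<in> M \<longleftrightarrow> j)}"

text \<open>Rows record whether e is used and columns whether e' is used, so that attaching a tile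
  becomes a matrix multiplication.\<close>

definition match_mat :: "'v set set \<Rightarrow> 'v set \<Rightarrow> 'v set \<Rightarrow> mat2" where
  "match_mat E e e' =
     Mat2 (match_count E e e' True True) (match_count E e e' True False)
       (match_count E e e' False True) (match_count E e e' False False)"

definition straight_mat :: mat2 where "straight_mat = Mat2 1 1 1 0"

lemma finite_perfect_matchings: "finite E \<Longrightarrow> finite {M. perfect_matching E M}"
  by (rule finite_subset[of _ "Pow E"]) (auto simp: perfect_matching_def)

lemma Collect_split_image:
  assumes "\<And>x. P x \<longleftrightarrow> x \<in> f ` A \<union> g ` B"
    and "\<And>x. x \<in> A \<Longrightarrow> Q (f x)" "\<And>x. x \<in> B \<Longrightarrow> \<not> Q (g x)"
    and "\<And>x. R (f x) \<longleftrightarrow> R x" "\<And>x. R (g x) \<longleftrightarrow> R x"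
  shows "{x. P x \<and> Q x \<and> R x} = f ` {x \<in> A. R x}"
    and "{x. P x \<and> \<not> Q x \<and> R x} = g ` {x \<in> B. R x}"
  by (auto simp: assms)

text \<open>The new row edge is either opposite to the shared edge (straight piece) or adjacent to
  it (corner). The edge e' must differ from xy, because the matchings of the second kind drop xy and
  would change the column.\<close>

lemma match_mat_add_tile:
  fixes E' :: "'v set set"
  assumes xy: "{x, y} \<in> E'" "x \<noteq> y" and ab: "a \<noteq> b" "a \<notin> \<Union>E'" "b \<notin> \<Union>E'"
    and e': "e' \<in> E'" "e' \<noteq> {x, y}" and fin: "finite E'"
  defines "E \<equiv> insert {a, b} (insert {a, x} (insert {b, y} E'))"
  shows "match_mat E {a, b} e' = straight_mat * match_mat E' {x, y} e'"
    and "match_mat E {a, x} e' = turnR * match_mat E' {x, y} e'"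
proof -
  have ne: "a \<noteq> x" "a \<noteq> y" "b \<noteq> x" "b \<noteq> y" using xy ab by blast+
  let ?f = "insert {a, b}" and ?g = "\<lambda>M. insert {a, x} (insert {b, y} (M - {{x, y}}))"
  let ?PM = "\<lambda>E j. {M. perfect_matching E M \<and> (e' \<in> M \<longleftrightarrow> j)}"
  let ?PX = "\<lambda>j. {M \<in> ?PM E' j. {x, y} \<in> M}"
  have nab: "e \<notin> M" if "perfect_matching E' M" "a \<in> e \<or> b \<in> e" for e M
    using that ab by (auto simp: perfect_matching_def)
  have ae: "a \<notin> e'" "b \<notin> e'" using e' ab by blast+
  have ef: "e' \<in> ?f M \<longleftrightarrow> e' \<in> M" "e' \<in> ?g M \<longleftrightarrow> e' \<in> M" for M
    using ae e' by auto
  have PM: "perfect_matching E M \<longleftrightarrow>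
      M \<in> ?f ` {M. perfect_matching E' M} \<union> ?g ` {M. perfect_matching E' M \<and> {x, y} \<in> M}" for M
    using perfect_matching_add_tile[OF xy ab] unfolding E_def by blast
  have ab_no: "{a, b} \<notin> ?g M" "{a, x} \<notin> ?f M" if "perfect_matching E' M" for M
    using nab[OF that] ne ab(1) by (auto simp: doubleton_eq_iff)
  let ?A = "{M. perfect_matching E' M}" and ?B = "{M. perfect_matching E' M \<and> {x, y} \<in> M}"
  have AB: "{M \<in> ?A. e' \<in> M \<longleftrightarrow> j} = ?PM E' j" "{M \<in> ?B. e' \<in> M \<longleftrightarrow> j} = ?PX j" for j by blast+
  let ?A = "{M. perfect_matching E' M}" and ?B = "{M. perfect_matching E' M \<and> {x, y} \<in> M}"
  have AB: "{M \<in> ?A. e' \<in> M \<longleftrightarrow> j} = ?PM E' j" "{M \<in> ?B. e' \<in> M \<longleftrightarrow> j} = ?PX j" for j by blast+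
  have F: "{M. perfect_matching E M \<and> {a, b} \<in> M \<and> (e' \<in> M \<longleftrightarrow> j)} = ?f ` ?PM E' j"
    and G: "{M. perfect_matching E M \<and> \<not> {a, b} \<in> M \<and> (e' \<in> M \<longleftrightarrow> j)} = ?g ` ?PX j" for j
  proof -
    have 1: "M \<in> ?A \<Longrightarrow> {a, b} \<in> ?f M" and 2: "M \<in> ?B \<Longrightarrow> \<not> {a, b} \<in> ?g M" for M using ab_no by blast+
    have 3: "(e' \<in> ?f M \<longleftrightarrow> j) \<longleftrightarrow> (e' \<in> M \<longleftrightarrow> j)" and 4: "(e' \<in> ?g M \<longleftrightarrow> j) \<longleftrightarrow> (e' \<in> M \<longleftrightarrow> j)" for M
      unfolding ef by (rule refl)+
    note C = Collect_split_image[of "perfect_matching E" ?f ?A ?g ?B "\<lambda>M. {a, b} \<in> M" "\<lambda>M. e' \<in> M \<longleftrightarrow> j", OF PM 1 2 3 4]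
    show "{M. perfect_matching E M \<and> {a, b} \<in> M \<and> (e' \<in> M \<longleftrightarrow> j)} = ?f ` ?PM E' j"
      "{M. perfect_matching E M \<and> \<not> {a, b} \<in> M \<and> (e' \<in> M \<longleftrightarrow> j)} = ?g ` ?PX j"
      using C unfolding AB by simp_all
  qed
  have F': "{M. perfect_matching E M \<and> {a, x} \<notin> M \<and> (e' \<in> M \<longleftrightarrow> j)} = ?f ` ?PM E' j"
    and G': "{M. perfect_matching E M \<and> \<not> {a, x} \<notin> M \<and> (e' \<in> M \<longleftrightarrow> j)} = ?g ` ?PX j" for j
  proof -
    have 1: "M \<in> ?A \<Longrightarrow> {a, x} \<notin> ?f M" and 2: "M \<in> ?B \<Longrightarrow> \<not> {a, x} \<notin> ?g M" for M using ab_no by blast+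
    have 3: "(e' \<in> ?f M \<longleftrightarrow> j) \<longleftrightarrow> (e' \<in> M \<longleftrightarrow> j)" and 4: "(e' \<in> ?g M \<longleftrightarrow> j) \<longleftrightarrow> (e' \<in> M \<longleftrightarrow> j)" for M
      unfolding ef by (rule refl)+
    note C = Collect_split_image[of "perfect_matching E" ?f ?A ?g ?B "\<lambda>M. {a, x} \<notin> M" "\<lambda>M. e' \<in> M \<longleftrightarrow> j", OF PM 1 2 3 4]
    show "{M. perfect_matching E M \<and> {a, x} \<notin> M \<and> (e' \<in> M \<longleftrightarrow> j)} = ?f ` ?PM E' j"
      "{M. perfect_matching E M \<and> \<not> {a, x} \<notin> M \<and> (e' \<in> M \<longleftrightarrow> j)} = ?g ` ?PX j"
      using C unfolding AB by simp_all
  qed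
  have "inj_on ?f (?PM E' j)" for j
  proof (rule inj_onI)
    fix M N assume "M \<in> ?PM E' j" "N \<in> ?PM E' j" "?f M = ?f N"
    then show "M = N" using nab[of M "{a, b}"] nab[of N "{a, b}"] by (auto simp: insert_ident)
  qed
  then have cF: "card (?f ` ?PM E' j) = card (?PM E' j)" for j by (rule card_image)
  have "inj_on ?g (?PX j)" for j
  proof (rule inj_onI)
    fix M N assume MN: "M \<in> ?PX j" "N \<in> ?PX j" "?g M = ?g N"
    have inv: "insert f (insert c (insert d (M - {f})) - {c, d}) = M" if "c \<notin> M" "d \<notin> M" "f \<in> M" for M and c d f :: "'v set"
      using that by blast
    have g: "insert {x, y} (?g M - {{a, x}, {b, y}}) = M" if "M \<in> ?PX j" for M
      using that nab[of M "{a, x}"] nab[of M "{b, y}"] by (intro inv) simp_all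
    have "M = insert {x, y} (?g M - {{a, x}, {b, y}})" by (rule g[OF MN(1), symmetric])
    also have "\<dots> = insert {x, y} (?g N - {{a, x}, {b, y}})" unfolding MN(3) by (rule refl)
    also have "\<dots> = N" by (rule g[OF MN(2)])
    finally show "M = N" .
  qed
  then have cG: "card (?g ` ?PX j) = card (?PX j)" for j by (rule card_image)
  have X: "card (?PX j) = match_count E' {x, y} e' True j" for j
    unfolding match_count_def by (rule arg_cong[of _ _ card]) auto
  have all: "card (?PM E' j) = match_count E' {x, y} e' True j + match_count E' {x, y} e' False j" for j
  proof -
    have "?PM E' j = {M. perfect_matching E' M \<and> ({x, y} \<in> M \<longleftrightarrow> True) \<and> (e' \<in> M \<longleftrightarrow> j)} \<union>
        {M. perfect_matching E' M \<and> ({x, y} \<in> M \<longleftrightarrow> False) \<and> (e' \<in> M \<longleftrightarrow> j)}" by auto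
    also have "card \<dots> = match_count E' {x, y} e' True j + match_count E' {x, y} e' False j"
      unfolding match_count_def
      by (rule card_Un_disjoint) (auto intro: finite_subset[OF _ finite_perfect_matchings[OF fin]])
    finally show ?thesis .
  qed
  have mc: "match_count E {a, b} e' True j = match_count E' {x, y} e' True j + match_count E' {x, y} e' False j"
      "match_count E {a, b} e' False j = match_count E' {x, y} e' True j"
      "match_count E {a, x} e' False j = match_count E' {x, y} e' True j + match_count E' {x, y} e' False j"
      "match_count E {a, x} e' True j = match_count E' {x, y} e' True j" for j
    using F[of j] G[of j] F'[of j] G'[of j] cF[of j] cG[of j] X[of j] all[of j]
    unfolding match_count_def by simp_all
  show "match_mat E {a, b} e' = straight_mat * match_mat E' {x, y} e'"
    "match_mat E {a, x} e' = turnR * match_mat E' {x, y} e'"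
    by (simp_all add: match_mat_def mc straight_mat_def turnR_def times_mat2_def)
qed

text \<open>A square has two perfect matchings. Opposite edges lie in the same one, adjacent edges
  in different ones.\<close>

lemma match_mat_single_tile:
  assumes "distinct [a, b, x, y]"
  defines "E \<equiv> {{a, b}, {a, x}, {b, y}, {x, y}}"
  shows "match_mat E {a, b} {x, y} = 1" "match_mat E {a, x} {x, y} = Mat2 0 1 1 0"
proof -
  have P: "perfect_matching E M \<longleftrightarrow> M = {{a, b}, {x, y}} \<or> M = {{a, x}, {b, y}}" for M
  proof -
    have 1: "{M. perfect_matching {{x, y}} M} = {{{x, y}}}"
      "{M. perfect_matching {{x, y}} M \<and> {x, y} \<in> M} = {{{x, y}}}"
      by (auto simp: perfect_matching_singleton)
    have "{M. perfect_matching E M} = {{{a, b}, {x, y}}, {{a, x}, {b, y}}}"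
      using perfect_matching_add_tile[of x y "{{x, y}}" a b] assms(1) unfolding 1 E_def by (simp add: insert_commute)
    then show ?thesis by blast
  qed
  have two: "card {M. (M = A \<or> M = B) \<and> Q M} = (if Q A then 1 else 0) + (if Q B then 1 else 0)"
    if "A \<noteq> B" for A B :: "'a set set" and Q
  proof -
    have "{M. (M = A \<or> M = B) \<and> Q M} = (if Q A then {A} else {}) \<union> (if Q B then {B} else {})" by auto
    then show ?thesis using that by simp
  qed
  let ?A = "{{a, b}, {x, y}}" and ?B = "{{a, x}, {b, y}}"
  have neq: "?A \<noteq> ?B" using assms(1) by (auto simp: doubleton_eq_iff)
  have "match_count E e e' i j =
      (if (e \<in> ?A \<longleftrightarrow> i) \<and> (e' \<in> ?A \<longleftrightarrow> j) then 1 else 0) + (if (e \<in> ?B \<longleftrightarrow> i) \<and> (e' \<in> ?B \<longleftrightarrow> j) then 1 else 0)" for e e' i j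
    unfolding match_count_def P by (rule two[OF neq])
  then show "match_mat E {a, b} {x, y} = 1" "match_mat E {a, x} {x, y} = Mat2 0 1 1 0"
    using assms(1) by (auto simp: match_mat_def one_mat2_def doubleton_eq_iff)
qed

text \<open>The trace against \<open>straight_mat\<close> adds up all entries except the one where
  neither e nor e' is used.\<close>

lemma card_good_matchings:
  assumes "finite E"
  shows "int (card (good_matchings (E, e, e'))) = tr2 (match_mat E e e' * straight_mat)"
proof -
  let ?S = "\<lambda>i j. {M. perfect_matching E M \<and> (e \<in> M \<longleftrightarrow> i) \<and> (e' \<in> M \<longleftrightarrow> j)}"
  have "good_matchings (E, e, e') = ?S True True \<union> ?S True False \<union> ?S False True"
    by (auto simp: good_matchings_def)
  moreover have "?S True True \<inter> ?S True False = {}" "(?S True True \<union> ?S True False) \<inter> ?S False True = {}"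
    by auto
  moreover have "finite (?S i j)" for i j
    using finite_perfect_matchings[OF assms] by (rule finite_subset[rotated]) auto
  ultimately have "card (good_matchings (E, e, e')) =
      card (?S True True) + card (?S True False) + card (?S False True)"
    by (simp only: card_Un_disjoint finite_Un)
  then show ?thesis
    by (simp add: match_mat_def match_count_def straight_mat_def times_mat2_def tr2_def)
qed

fun transfer :: "dir \<Rightarrow> dir list \<Rightarrow> mat2" where
  "transfer d [] = 1"
| "transfer d (d' # ds) = (if d' = d then straight_mat else turnR) * transfer d' ds"

definition snake :: "int \<times> int \<Rightarrow> dir list \<Rightarrow> (int \<times> int) set set" where
  "snake t ds = (\<Union>t \<in> set (tiles t ds). tile_edges t)"

lemma tile_edges_eq:
  "tile_edges t = {entry_edge East t, entry_edge North t, exit_edge East t, exit_edge North t}"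
  by (auto simp: tile_edges_def) (metis dir.exhaust)+

lemma tiles_not_Nil [simp]: "tiles t ds \<noteq> []"
  by (cases ds) auto

lemma hd_tiles [simp]: "hd (tiles t ds) = t"
  by (cases ds) auto

lemma finite_snake: "finite (snake t ds)"
  by (simp add: snake_def tile_edges_eq)

lemma entry_in_snake: "entry_edge d t \<in> snake t ds"
  by (cases ds; cases d) (auto simp: snake_def tile_edges_eq)

lemma tiles_ge: "t' \<in> set (tiles t ds) \<Longrightarrow> fst t \<le> fst t' \<and> snd t \<le> snd t'"
proof (induction ds arbitrary: t)
  case (Cons d ds)
  then show ?case by (cases d; cases t) fastforce+
qed simp

lemma snake_ge: "v \<in> \<Union>(snake t ds) \<Longrightarrow> fst t \<le> fst v \<and> snd t \<le> snd v"
  unfolding snake_def using tiles_ge by (fastforce simp: tile_edges_eq exit_edge_def)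

text \<open>The factor \<open>straight_mat\<close> that closes the band is absorbed by the last
  tile: the identity gives \<open>straight_mat\<close> and the swap gives \<open>turnR\<close>. So
  the gluing of the two ends contributes a factor of the same kind as every other gluing.\<close>

lemma match_mat_snake:
  assumes "ds \<noteq> []"
  shows "match_mat (snake t (butlast ds)) (entry_edge d t) (exit_edge (last ds) (last (tiles t (butlast ds))))
      * straight_mat = transfer d ds"
  using assms
proof (induction ds arbitrary: d t rule: list_nonempty_induct)
  case (single d')
  obtain x y where t: "t = (x, y)" by force
  have turn: "Mat2 0 1 1 0 * straight_mat = turnR"
    by (simp add: straight_mat_def turnR_def times_mat2_def)
  have *: "distinct [(x, y), (x, y + 1), (x + 1, y), (x + 1, y + 1)]"
    "distinct [(x, y), (x + 1, y), (x, y + 1), (x + 1, y + 1)]" by auto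
  have E: "snake t [] = {{(x, y), (x, y + 1)}, {(x, y), (x + 1, y)}, {(x, y + 1), (x + 1, y + 1)}, {(x + 1, y), (x + 1, y + 1)}}"
    "snake t [] = {{(x, y), (x + 1, y)}, {(x, y), (x, y + 1)}, {(x + 1, y), (x + 1, y + 1)}, {(x, y + 1), (x + 1, y + 1)}}"
    by (auto simp: snake_def tile_edges_eq exit_edge_def t)
  note m = match_mat_single_tile[OF *(1), folded E] match_mat_single_tile[OF *(2), folded E]
  show ?case
    using m turn by (cases d; cases d') (simp_all add: t exit_edge_def)
next
  case (cons d' ds)
  obtain x y where t: "t = (x, y)" by force
  let ?t = "step d' t"
  let ?E = "snake ?t (butlast ds)" and ?e = "exit_edge (last ds) (last (tiles ?t (butlast ds)))"
  have E: "snake t (butlast (d' # ds)) = tile_edges t \<union> ?E"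
    using cons.hyps by (simp add: snake_def)
  have last: "exit_edge (last (d' # ds)) (last (tiles t (butlast (d' # ds)))) = ?e"
    using cons.hyps by simp
  have in_E: "entry_edge d' ?t \<in> ?E" by (rule entry_in_snake)
  have lt: "last (tiles ?t (butlast ds)) \<in> set (tiles ?t (butlast ds))" by simp
  then have e: "?e \<in> ?E"
    by (cases "last ds") (auto simp: snake_def tile_edges_eq)
  have "?t \<notin> ?e"
    using tiles_ge[OF lt] by (cases "last ds"; cases "last (tiles ?t (butlast ds))"; cases ?t) (auto simp: exit_edge_def)
  then have e_ne: "?e \<noteq> entry_edge d' ?t"
    by (cases d'; cases ?t) auto
  note ge = snake_ge[of _ ?t "butlast ds"]
  have IH: "match_mat ?E (entry_edge d' ?t) ?e * straight_mat = transfer d' ds" by (rule cons.IH)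
  show ?case
  proof (cases d')
    case East
    have E': "snake t (butlast (d' # ds)) = insert {(x, y), (x, y + 1)}
        (insert {(x, y), (x + 1, y)} (insert {(x, y + 1), (x + 1, y + 1)} ?E))"
      using in_E unfolding E by (auto simp: tile_edges_eq exit_edge_def t East)
    have ent: "entry_edge d' ?t = {(x + 1, y), (x + 1, y + 1)}" by (simp add: East t)
    have nin: "(x, y) \<notin> \<Union>?E" "(x, y + 1) \<notin> \<Union>?E"
      using ge[of "(x, y)"] ge[of "(x, y + 1)"] unfolding East t step.simps fst_conv snd_conv by linarith+
    have m: "match_mat (snake t (butlast (d' # ds))) {(x, y), (x, y + 1)} ?e = straight_mat * match_mat ?E (entry_edge d' ?t) ?e"
      "match_mat (snake t (butlast (d' # ds))) {(x, y), (x + 1, y)} ?e = turnR * match_mat ?E (entry_edge d' ?t) ?e"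
      unfolding E' ent
      by (rule match_mat_add_tile[OF _ _ _ nin e]; use in_E e_ne in \<open>simp add: ent finite_snake\<close>)+
    show ?thesis
      unfolding last using m IH by (cases d) (simp_all add: t East mult.assoc)
  next
    case North
    have E': "snake t (butlast (d' # ds)) = insert {(x, y), (x + 1, y)}
        (insert {(x, y), (x, y + 1)} (insert {(x + 1, y), (x + 1, y + 1)} ?E))"
      using in_E unfolding E by (auto simp: tile_edges_eq exit_edge_def t North)
    have ent: "entry_edge d' ?t = {(x, y + 1), (x + 1, y + 1)}" by (simp add: North t)
    have nin: "(x, y) \<notin> \<Union>?E" "(x + 1, y) \<notin> \<Union>?E"
      using ge[of "(x, y)"] ge[of "(x + 1, y)"] unfolding North t step.simps fst_conv snd_conv by linarith+
    have m: "match_mat (snake t (butlast (d' # ds))) {(x, y), (x + 1, y)} ?e = straight_mat * match_mat ?E (entry_edge d' ?t) ?e"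
      "match_mat (snake t (butlast (d' # ds))) {(x, y), (x, y + 1)} ?e = turnR * match_mat ?E (entry_edge d' ?t) ?e"
      unfolding E' ent
      by (rule match_mat_add_tile[OF _ _ _ nin e]; use in_E e_ne in \<open>simp add: ent finite_snake\<close>)+
    show ?thesis
      unfolding last using m IH by (cases d) (simp_all add: t North mult.assoc)
  qed
qed

section \<open>From straight pieces and corners to left and right letters\<close>

definition flip_mat :: "bool \<Rightarrow> mat2" where
  "flip_mat l = (if l then Mat2 0 1 1 0 else 1)"

definition letter :: "bool \<Rightarrow> mat2" where
  "letter l = (if l then turnL else turnR)"

text \<open>With the swap J, \<open>straight_mat\<close> = L J and J R J = L. Carrying J along while
  the pivot is on the left converts straight pieces and corners into letters; the hypothesis says
  that the pivot is kept exactly when its side is kept.\<close>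

lemma transfer_directions:
  assumes "successively (\<lambda>v w. w = v \<longleftrightarrow> (l w \<longleftrightarrow> l v)) (v # ws)"
  shows "flip_mat (l v) * transfer d (directions d v ws) =
    prod_list (map (letter \<circ> l) ws) * flip_mat (l (last (v # ws)))"
  using assms
proof (induction ws arbitrary: v d)
  case (Cons w ws)
  have ne: "turn d \<noteq> d" for d by (cases d) auto
  let ?d = "if w = v then turn d else d"
  have "flip_mat (l v) * (if ?d = d then straight_mat else turnR) = letter (l w) * flip_mat (l w)"
    using Cons.prems ne[of d]
    by (auto simp: flip_mat_def letter_def straight_mat_def turnR_def turnL_def mat2_defs)
  then have "flip_mat (l v) * transfer d (directions d v (w # ws)) =
      letter (l w) * (flip_mat (l w) * transfer ?d (directions ?d w ws))"
    by (simp add: Let_def mult.assoc[symmetric])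
  also have "\<dots> = prod_list (map (letter \<circ> l) (w # ws)) * flip_mat (l (last (v # w # ws)))"
    using Cons.IH[of w ?d] Cons.prems by (simp add: mult.assoc comp_def)
  finally show ?case .
qed simp

lemma length_directions [simp]: "length (directions d v ws) = length ws"
  by (induction ws arbitrary: d v) (simp_all add: Let_def)

lemma card_good_matchings_band:
  assumes "pivots u cs = vs" "vs \<noteq> []"
    and "successively (\<lambda>v w. w = v \<longleftrightarrow> (l w \<longleftrightarrow> l v)) ((last vs - u) # vs)"
    and "l (last vs - u) \<longleftrightarrow> l (last vs)"
  shows "int (card (good_matchings (band_graph u cs))) = tr2 (prod_list (map (letter \<circ> l) vs))"
proof -
  define ds where "ds = directions East (last vs - u) vs"
  have "ds \<noteq> []" using assms(2) length_directions[of East "last vs - u" vs] unfolding ds_def by force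
  have "band_graph u cs = (snake (0, 0) (butlast ds), entry_edge East (0, 0),
      exit_edge (last ds) (last (tiles (0, 0) (butlast ds))))"
    by (simp add: band_graph_def Let_def assms(1) ds_def snake_def snake_graph_def)
  then have "int (card (good_matchings (band_graph u cs))) = tr2 (transfer East ds)"
    using card_good_matchings[OF finite_snake] match_mat_snake[OF \<open>ds \<noteq> []\<close>] by (simp del: entry_edge.simps)
  also have "\<dots> = tr2 (prod_list (map (letter \<circ> l) vs))"
  proof -
    \<comment> \<open>By periodicity the same swap stands at both ends and cancels in the
      trace.\<close>
    let ?J = "flip_mat (l (last vs))" and ?A = "prod_list (map (letter \<circ> l) vs)"
    have J: "?J * ?J = 1" by (simp add: flip_mat_def mat2_defs)
    have "?J * transfer East ds = ?A * ?J"
      using transfer_directions[OF assms(3), of East] assms(2,4) by (simp add: ds_def)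
    then have "transfer East ds = ?J * (?A * ?J)" using J by (metis mult.assoc mult_1)
    then have "tr2 (transfer East ds) = tr2 (?A * ?J * ?J)" using tr2_commute by metis
    then show ?thesis by (simp add: mult.assoc J)
  qed
  finally show ?thesis .
qed

section \<open>The crossing sequence of a line\<close>

definition lvert :: "side \<Rightarrow> nat \<Rightarrow> nat \<Rightarrow> int \<Rightarrow> lattice_point" where
  "lvert \<sigma> p q k = (column \<sigma> p q k, k - column \<sigma> p q k)"

definition rvert :: "side \<Rightarrow> nat \<Rightarrow> nat \<Rightarrow> int \<Rightarrow> lattice_point" where
  "rvert \<sigma> p q k = (column \<sigma> p q k + 1, k - column \<sigma> p q k - 1)"

text \<open>Crossings \<open>2 * k\<close> and \<open>2 * k + 1\<close> are the crossing with the antidiagonal \<open>x + y = k\<close> and the one with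
  a horizontal or vertical segment right after it.\<close>

definition left_end :: "side \<Rightarrow> nat \<Rightarrow> nat \<Rightarrow> nat \<Rightarrow> lattice_point" where
  "left_end \<sigma> p q j = (let k = int (j div 2) in
     if even j \<or> column \<sigma> p q (k + 1) = column \<sigma> p q k then lvert \<sigma> p q k else lvert \<sigma> p q (k + 1))"

definition right_end :: "side \<Rightarrow> nat \<Rightarrow> nat \<Rightarrow> nat \<Rightarrow> lattice_point" where
  "right_end \<sigma> p q j = (let k = int (j div 2) in
     if even j \<or> column \<sigma> p q (k + 1) \<noteq> column \<sigma> p q k then rvert \<sigma> p q k else rvert \<sigma> p q (k + 1))"

text \<open>Integer multiple of the signed distance from the line of slope p/q through the origin,
  positive on the left.\<close>

definition height :: "nat \<Rightarrow> nat \<Rightarrow> lattice_point \<Rightarrow> int" where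
  "height p q v = int q * snd v - int p * fst v"

definition on_left :: "side \<Rightarrow> nat \<Rightarrow> nat \<Rightarrow> lattice_point \<Rightarrow> bool" where
  "on_left \<sigma> p q v \<longleftrightarrow> 0 < height p q v + offset \<sigma>"

text \<open>The sum of the heights is twice the height of the midpoint. It vanishes when the line
  meets the orbifold point; then a curve pushed to the left crosses in the left half, and one pushed
  to the right in the right half.\<close>

definition near_end :: "side \<Rightarrow> nat \<Rightarrow> nat \<Rightarrow> nat \<Rightarrow> lattice_point" where
  "near_end \<sigma> p q j =
     (if height p q (left_end \<sigma> p q j) + height p q (right_end \<sigma> p q j) + offset \<sigma> \<le> 0
      then left_end \<sigma> p q j else right_end \<sigma> p q j)"

text \<open>The indices start at 2 because the curve starts beyond the origin and first meets the
  antidiagonal x + y = 1; they cover one period.\<close>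

definition ideal_crossings :: "side \<Rightarrow> nat \<Rightarrow> nat \<Rightarrow> (lattice_point set \<times> lattice_point) list" where
  "ideal_crossings \<sigma> p q =
     map (\<lambda>j. ({left_end \<sigma> p q j, right_end \<sigma> p q j}, near_end \<sigma> p q j)) [2..<2 * (p + q) + 2]"

text \<open>The common endpoint of segments j and j + 1, that is, the pivot of the lattice triangle
  between them.\<close>

definition apex :: "side \<Rightarrow> nat \<Rightarrow> nat \<Rightarrow> nat \<Rightarrow> lattice_point" where
  "apex \<sigma> p q j =
     (if left_end \<sigma> p q (Suc j) = left_end \<sigma> p q j then left_end \<sigma> p q j else right_end \<sigma> p q j)"

lemma prod_list_path_mat:
  fixes I :: "int \<Rightarrow> int"
  assumes "\<And>K. I (K + 1) = I K \<or> I (K + 1) = I K + 1"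
  defines "d \<equiv> \<lambda>K::nat. if I (int K + 1) = I (int K) then North else East"
  shows "prod_list (map (\<lambda>K. cross (of_int (I (int K)), of_int (int K - I (int K))) (d K)) [0..<m]) =
    path_mat (map d [0..<m]) (of_int (I 0), of_int (- I 0))"
proof -
  have disp: "(of_int (I 0), of_int (- I 0)) + disp (map d [0..<m]) =
      (of_int (I (int m)), of_int (int m - I (int m)))" for m
  proof (induction m)
    case (Suc m)
    then have "(of_int (I 0), of_int (- I 0)) + disp (map d [0..<Suc m]) =
        (of_int (I (int m)), of_int (int m - I (int m))) + shift (d m)"
      by (simp add: disp_def add.assoc[symmetric])
    also have "\<dots> = (of_int (I (int (Suc m))), of_int (int (Suc m) - I (int (Suc m))))"
      using assms(1)[of "int m"] by (auto simp: d_def add.commute)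
    finally show ?case .
  qed (simp add: disp_def zero_prod_def)
  show ?thesis
  proof (induction m)
    case (Suc m)
    then show ?case using disp[of m] by (simp add: path_mat_append)
  qed simp
qed

lemma tr2_prod_list_rotate:
  fixes B :: "nat \<Rightarrow> mat2"
  assumes "B n = B 0"
  shows "tr2 (prod_list (map B [1..<n + 1])) = tr2 (prod_list (map B [0..<n]))"
proof (cases n)
  case (Suc m)
  have "[0..<n] = 0 # [1..<n]" "[1..<n + 1] = [1..<n] @ [n]"
    using Suc upt_conv_Cons[of 0 n] by simp_all
  then show ?thesis using tr2_commute[of "B 0" "prod_list (map B [1..<n])"] assms by simp
qed simp

locale positive_slope =
  fixes \<sigma> :: side and p q :: nat
  assumes p: "0 < p" and q: "0 < q"
begin

abbreviation "col \<equiv> column \<sigma> p q"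
abbreviation "n \<equiv> int p + int q"
abbreviation "c \<equiv> offset \<sigma>"

lemma offset_cases: "c = 0 \<or> c = 1"
  by (cases \<sigma>) auto

lemma col_eq_iff: "col k = i \<longleftrightarrow> n * i < int q * k + c \<and> int q * k + c \<le> n * i + n"
proof -
  have "0 < n" using p by simp
  then show ?thesis unfolding column_def div_eq_iff_bounds[OF \<open>0 < n\<close>] by auto
qed

lemma col_bounds: "n * col k < int q * k + c" "int q * k + c \<le> n * col k + n"
  using col_eq_iff by blast+

lemma col_Suc: "col (k + 1) = col k \<or> col (k + 1) = col k + 1"
proof -
  have "n * col k < n * (col (k + 1) + 1)" "n * col (k + 1) < n * (col k + 2)"
    using col_bounds[of k] col_bounds[of "k + 1"] p q by (simp_all add: algebra_simps)
  then have "col k < col (k + 1) + 1" "col (k + 1) < col k + 2"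
    using p q by (simp_all add: mult_less_cancel_left_pos)
  then show ?thesis by linarith
qed

lemma col_period: "col (k + n) = col k + int q"
  using col_bounds[of k] by (subst col_eq_iff) (simp add: algebra_simps)

lemma height_vert:
  "height p q (lvert \<sigma> p q k) = int q * k - n * col k"
  "height p q (rvert \<sigma> p q k) = int q * k - n * col k - n"
  by (simp_all add: height_def lvert_def rvert_def algebra_simps)

lemma on_left_vert: "on_left \<sigma> p q (lvert \<sigma> p q k)" "\<not> on_left \<sigma> p q (rvert \<sigma> p q k)"
  using col_bounds[of k] by (auto simp: on_left_def height_vert)

lemma on_left_end [simp]: "on_left \<sigma> p q (left_end \<sigma> p q j)" "\<not> on_left \<sigma> p q (right_end \<sigma> p q j)"
  by (simp_all add: left_end_def right_end_def Let_def on_left_vert)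

lemma left_end_ne_right_end: "left_end \<sigma> p q i \<noteq> right_end \<sigma> p q j"
  using on_left_end by metis

lemma end_Suc: "left_end \<sigma> p q (Suc j) = left_end \<sigma> p q j \<longleftrightarrow> right_end \<sigma> p q (Suc j) \<noteq> right_end \<sigma> p q j"
proof (cases "even j")
  case True
  then have "Suc j div 2 = j div 2" by simp
  then show ?thesis using True by (auto simp: left_end_def right_end_def Let_def lvert_def rvert_def)
next
  case False
  then have "int (Suc j div 2) = int (j div 2) + 1" by (simp add: odd_Suc_div_two)
  then show ?thesis using False
    by (auto simp: left_end_def right_end_def Let_def lvert_def rvert_def add.commute[of 1])
qed

lemma segment_Int:
  "{left_end \<sigma> p q j, right_end \<sigma> p q j} \<inter> {left_end \<sigma> p q (Suc j), right_end \<sigma> p q (Suc j)} = {apex \<sigma> p q j}"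
  using end_Suc[of j] left_end_ne_right_end unfolding apex_def by auto

lemma apex_in: "apex \<sigma> p q j \<in> {left_end \<sigma> p q j, right_end \<sigma> p q j}"
  "apex \<sigma> p q j \<in> {left_end \<sigma> p q (Suc j), right_end \<sigma> p q (Suc j)}"
  using segment_Int by blast+

lemma near_end_in: "near_end \<sigma> p q j \<in> {left_end \<sigma> p q j, right_end \<sigma> p q j}"
  by (simp add: near_end_def)

lemma same_side_iff:
  assumes "v \<in> {left_end \<sigma> p q j, right_end \<sigma> p q j}" "w \<in> {left_end \<sigma> p q j, right_end \<sigma> p q j}"
  shows "w = v \<longleftrightarrow> (on_left \<sigma> p q w \<longleftrightarrow> on_left \<sigma> p q v)"
  using assms left_end_ne_right_end by auto

lemma end_period:
  "left_end \<sigma> p q (j + 2 * (p + q)) = left_end \<sigma> p q j + (int q, int p)"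
  "right_end \<sigma> p q (j + 2 * (p + q)) = right_end \<sigma> p q j + (int q, int p)"
proof -
  have k: "int ((j + 2 * (p + q)) div 2) = int (j div 2) + n" by simp
  have e: "even (j + 2 * (p + q)) \<longleftrightarrow> even j" by simp
  have "col (int (j div 2) + n + 1) = col (int (j div 2) + 1) + int q"
    using col_period[of "int (j div 2) + 1"] by (simp add: add_ac)
  then show "left_end \<sigma> p q (j + 2 * (p + q)) = left_end \<sigma> p q j + (int q, int p)"
    "right_end \<sigma> p q (j + 2 * (p + q)) = right_end \<sigma> p q j + (int q, int p)"
    unfolding left_end_def right_end_def Let_def k e
    by (simp_all add: lvert_def rvert_def col_period)
qed

lemma apex_period: "apex \<sigma> p q (j + 2 * (p + q)) = apex \<sigma> p q j + (int q, int p)"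
  using end_period[of j] end_period[of "Suc j"] by (simp add: apex_def)

lemma on_left_period: "on_left \<sigma> p q (v + (int q, int p)) \<longleftrightarrow> on_left \<sigma> p q v"
  by (simp add: on_left_def height_def algebra_simps)

section \<open>Pivots of the ideal crossing sequence\<close>

definition pivot_list :: "nat \<Rightarrow> nat \<Rightarrow> lattice_point list" where
  "pivot_list a b = concat (map (\<lambda>j. [near_end \<sigma> p q j, apex \<sigma> p q j]) [a..<b])"

lemma pivots_ideal: "pivots (int q, int p) (ideal_crossings \<sigma> p q) = pivot_list 2 (2 * (p + q) + 2)"
proof -
  let ?s = "\<lambda>j. {left_end \<sigma> p q j, right_end \<sigma> p q j}"
  let ?N = "2 * (p + q) + 2"
  have ne: "2 < ?N" "3 \<le> ?N" using p by auto
  have ss: "map fst (ideal_crossings \<sigma> p q) = map ?s [2..<?N]"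
    by (simp add: ideal_crossings_def comp_def)
  \<comment> \<open>The translate of the first segment is the segment with the next index, so the
    closing triangle follows the pattern of the others.\<close>
  have hd: "(\<lambda>v. v + (int q, int p)) ` ?s 2 = ?s ?N"
    using end_period[of 2] by (simp add: add.commute)
  have "tl (map ?s [2..<?N]) @ [(\<lambda>v. v + (int q, int p)) ` hd (map ?s [2..<?N])] = map ?s [3..<?N] @ [?s ?N]"
    using ne hd by (simp add: upt_conv_Cons del: upt_Suc)
  also have "\<dots> = map ?s [3..<Suc ?N]" using ne by simp
  also have "\<dots> = map (\<lambda>j. ?s (Suc j)) [2..<?N]"
    by (subst numeral_3_eq_3, subst numeral_2_eq_2[symmetric], subst map_Suc_upt[symmetric]) (simp add: comp_def)
  finally have ss': "tl (map ?s [2..<?N]) @ [(\<lambda>v. v + (int q, int p)) ` hd (map ?s [2..<?N])] =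
      map (\<lambda>j. ?s (Suc j)) [2..<?N]" .
  show ?thesis
    unfolding pivots_def Let_def ss ss' unfolding ideal_crossings_def pivot_list_def
    by (simp add: zip_map_map zip_same_conv_map segment_Int comp_def)
qed

text \<open>Neighbouring pivots are endpoints of a common crossed segment, whose two ends lie on
  different sides of the line.\<close>

lemma successively_pivot_list:
  assumes "a \<le> b"
  shows "successively (\<lambda>v w. w = v \<longleftrightarrow> (on_left \<sigma> p q w \<longleftrightarrow> on_left \<sigma> p q v)) (apex \<sigma> p q a # pivot_list (Suc a) (Suc b))"
  using assms
proof (induction a rule: inc_induct)
  case base
  show ?case by (simp add: pivot_list_def)
next
  case (step a)
  have "pivot_list (Suc a) (Suc b) = near_end \<sigma> p q (Suc a) # apex \<sigma> p q (Suc a) # pivot_list (Suc (Suc a)) (Suc b)"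
    using step.hyps by (simp add: pivot_list_def upt_conv_Cons del: upt_Suc)
  then show ?case
    using step.IH same_side_iff[OF apex_in(2)[of a] near_end_in[of "Suc a"]]
      same_side_iff[OF near_end_in[of "Suc a"] apex_in(1)[of "Suc a"]]
    by simp
qed

section \<open>From segment crossings to steps in the half lattice\<close>

definition block :: "nat \<Rightarrow> mat2" where
  "block j = letter (on_left \<sigma> p q (near_end \<sigma> p q j)) * letter (on_left \<sigma> p q (apex \<sigma> p q j))"

lemma prod_list_pivot_list:
  "prod_list (map (letter \<circ> on_left \<sigma> p q) (pivot_list a b)) = prod_list (map block [a..<b])"
proof -
  have "prod_list (map (letter \<circ> on_left \<sigma> p q) (concat (map (\<lambda>j. [near_end \<sigma> p q j, apex \<sigma> p q j]) xs))) =
      prod_list (map block xs)" for xs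
    by (induction xs) (simp_all add: block_def mult.assoc)
  then show ?thesis by (simp add: pivot_list_def)
qed

lemma prod_list_pairs:
  "prod_list (map f [2 * a..<2 * b]) = prod_list (map (\<lambda>k. f (2 * k) * f (2 * k + 1)) [a..<b])"
  for f :: "nat \<Rightarrow> mat2"
proof (cases "a \<le> b")
  case True
  then show ?thesis
  proof (induction b rule: dec_induct)
    case (step b)
    have "[2 * a..<2 * Suc b] = [2 * a..<2 * b] @ [2 * b, 2 * b + 1]" using step.hyps by simp
    then show ?case using step by simp
  qed simp
qed simp

definition half_cross :: "nat \<Rightarrow> mat2" where
  "half_cross K = cross (of_int (col (int K)), of_int (int K - col (int K))) (column_step \<sigma> p q K)"

lemma near_end_left_iff:
  "on_left \<sigma> p q (near_end \<sigma> p q j) \<longleftrightarrow>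
    height p q (left_end \<sigma> p q j) + height p q (right_end \<sigma> p q j) + c \<le> 0"
  by (simp add: near_end_def)

lemma apex_left_iff: "on_left \<sigma> p q (apex \<sigma> p q j) \<longleftrightarrow> left_end \<sigma> p q (Suc j) = left_end \<sigma> p q j"
  by (simp add: apex_def)

lemma col_le_iff: "col k \<le> i \<longleftrightarrow> int q * k + c \<le> n * i + n"
proof
  assume "col k \<le> i"
  then have "n * col k \<le> n * i" by (rule mult_left_mono) simp
  then show "int q * k + c \<le> n * i + n" using col_bounds(2)[of k] by linarith
next
  assume "int q * k + c \<le> n * i + n"
  then have "n * col k < n * (i + 1)" using col_bounds(1)[of k] by (simp add: algebra_simps)
  then show "col k \<le> i" using p by (simp add: mult_less_cancel_left_pos)
qed

text \<open>Midpoints of antidiagonal segments lie on even antidiagonals of the half lattice, those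
  of the other segments on odd ones. So \<open>col (2 * k)\<close> and
  \<open>col (2 * k + 1)\<close> tell which halves of two consecutive segments are crossed, and the
  columns at 2k, 2k + 1 and 2k + 2 determine all four letters. There are eight patterns, and
  \<open>cross\<close> distributes the letters over the two steps in each of them.\<close>

lemma block_pair: "block (2 * k) * block (2 * k + 1) = half_cross (2 * k) * half_cross (2 * k + 1)"
proof -
  define i where "i = col (int k)"
  have E: "left_end \<sigma> p q (2 * k) = lvert \<sigma> p q (int k)" "right_end \<sigma> p q (2 * k) = rvert \<sigma> p q (int k)"
    "left_end \<sigma> p q (Suc (2 * k)) = (if col (int k + 1) = i then lvert \<sigma> p q (int k) else lvert \<sigma> p q (int k + 1))"
    "right_end \<sigma> p q (Suc (2 * k)) = (if col (int k + 1) = i then rvert \<sigma> p q (int k + 1) else rvert \<sigma> p q (int k))"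
    "left_end \<sigma> p q (Suc (Suc (2 * k))) = lvert \<sigma> p q (int k + 1)"
    by (simp_all add: left_end_def right_end_def Let_def i_def add.commute)
  have ne: "lvert \<sigma> p q (int k + 1) \<noteq> lvert \<sigma> p q (int k)" by (simp add: lvert_def)
  define I0 I1 I2 where "I0 = col (2 * int k)" and "I1 = col (2 * int k + 1)" and "I2 = col (2 + 2 * int k)"
  have b: "n * i < int q * int k + c" "int q * int k + c \<le> n * i + n"
    using col_bounds[of "int k"] by (simp_all add: i_def)
  have n: "0 < n" using p by simp
  have I: "I0 = 2 * i \<or> I0 = 2 * i + 1"
  proof -
    have "\<not> I0 \<le> 2 * i - 1" unfolding I0_def col_le_iff using b(1) offset_cases by (auto simp: algebra_simps)
    moreover have "I0 \<le> 2 * i + 1" unfolding I0_def col_le_iff using b(2) offset_cases by (auto simp: algebra_simps)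
    ultimately show ?thesis by linarith
  qed
  have b': "n * col (int k + 1) < int q * (int k + 1) + c" "int q * (int k + 1) + c \<le> n * col (int k + 1) + n"
    using col_bounds[of "int k + 1"] by simp_all
  have I': "I2 = 2 * col (int k + 1) \<or> I2 = 2 * col (int k + 1) + 1"
  proof -
    have "\<not> I2 \<le> 2 * col (int k + 1) - 1" unfolding I2_def col_le_iff using b'(1) offset_cases by (auto simp: algebra_simps)
    moreover have "I2 \<le> 2 * col (int k + 1) + 1" unfolding I2_def col_le_iff using b'(2) offset_cases by (auto simp: algebra_simps)
    ultimately show ?thesis by linarith
  qed
  have S: "I1 = I0 \<or> I1 = I0 + 1" "I2 = I1 \<or> I2 = I1 + 1" "col (int k + 1) = i \<or> col (int k + 1) = i + 1"
    using col_Suc[of "2 * int k"] col_Suc[of "2 * int k + 1"] col_Suc[of "int k"]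
    by (simp_all add: I0_def I1_def I2_def i_def)
  have N0: "on_left \<sigma> p q (near_end \<sigma> p q (2 * k)) \<longleftrightarrow> I0 \<le> 2 * i"
    unfolding near_end_left_iff E height_vert I0_def col_le_iff i_def[symmetric] by (auto simp: algebra_simps)
  have N1: "on_left \<sigma> p q (near_end \<sigma> p q (Suc (2 * k))) \<longleftrightarrow> I1 \<le> 2 * i + (if col (int k + 1) = i then 0 else 1)"
    unfolding near_end_left_iff E I1_def col_le_iff using S(3)
    by (auto simp: height_vert i_def[symmetric] algebra_simps)
  have A0: "on_left \<sigma> p q (apex \<sigma> p q (2 * k)) \<longleftrightarrow> col (int k + 1) = i"
    using ne by (simp add: apex_left_iff E)
  have A1: "on_left \<sigma> p q (apex \<sigma> p q (Suc (2 * k))) \<longleftrightarrow> col (int k + 1) \<noteq> i"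
    using ne by (simp add: apex_left_iff E)
  have H: "half_cross (2 * k) = cross (of_int I0, of_int (2 * int k - I0)) (if I1 = I0 then North else East)"
    "half_cross (2 * k + 1) = cross (of_int I1, of_int (2 * int k + 1 - I1)) (if I2 = I1 then North else East)"
    by (simp_all add: half_cross_def column_step_def I0_def I1_def I2_def add.commute)
  have of_int_even: "of_int (2 * x) = (0 :: bit)" "of_int (2 * x + 1) = (1 :: bit)"
    "of_int (2 * x + 2) = (0 :: bit)" "of_int (2 * x - 1) = (1 :: bit)" for x by simp_all
  define y where "y = int k - i"
  have y: "2 * int k - 2 * i = 2 * y" "2 * int k - (2 * i + 1) = 2 * (y - 1) + 1"
    "2 * int k + 1 - 2 * i = 2 * y + 1" "2 * int k + 1 - (2 * i + 1) = 2 * y"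
    "2 * int k + 1 - (2 * i + 2) = 2 * (y - 1) + 1"
    by (simp_all add: y_def algebra_simps)
  have B: "block (2 * k) * block (2 * k + 1) =
      letter (I0 \<le> 2 * i) * letter (col (int k + 1) = i) *
      (letter (I1 \<le> 2 * i + (if col (int k + 1) = i then 0 else 1)) * letter (col (int k + 1) \<noteq> i))"
    by (simp add: block_def N0 N1 A0 A1)
  have "(col (int k + 1) = i \<and> I0 = 2 * i \<and> I1 = 2 * i \<and> I2 = 2 * i) \<or>
      (col (int k + 1) = i \<and> I0 = 2 * i \<and> I1 = 2 * i \<and> I2 = 2 * i + 1) \<or>
      (col (int k + 1) = i \<and> I0 = 2 * i \<and> I1 = 2 * i + 1 \<and> I2 = 2 * i + 1) \<or>
      (col (int k + 1) = i \<and> I0 = 2 * i + 1 \<and> I1 = 2 * i + 1 \<and> I2 = 2 * i + 1) \<or>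
      (col (int k + 1) = i + 1 \<and> I0 = 2 * i \<and> I1 = 2 * i + 1 \<and> I2 = 2 * i + 2) \<or>
      (col (int k + 1) = i + 1 \<and> I0 = 2 * i + 1 \<and> I1 = 2 * i + 1 \<and> I2 = 2 * i + 2) \<or>
      (col (int k + 1) = i + 1 \<and> I0 = 2 * i + 1 \<and> I1 = 2 * i + 2 \<and> I2 = 2 * i + 2) \<or>
      (col (int k + 1) = i + 1 \<and> I0 = 2 * i + 1 \<and> I1 = 2 * i + 2 \<and> I2 = 2 * i + 3)"
    using I I' S by (elim disjE) simp_all
  then show ?thesis
    unfolding H B
    by (elim disjE conjE)
      (simp_all add: y of_int_even letter_def mult.assoc del: of_int_add of_int_mult of_int_diff)
qed

lemma half_cross_period: "half_cross (K + 2 * (p + q)) = half_cross K"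
proof -
  define K' where "K' = K + 2 * (p + q)"
  have K': "int K' = int K + n + n" "int K' + 1 = int K + 1 + n + n" by (simp_all add: K'_def)
  have "col (int K') = col (int K) + 2 * int q" unfolding K'(1) col_period by simp
  moreover have "col (int K' + 1) = col (int K + 1) + 2 * int q" unfolding K'(2) col_period by simp
  moreover from calculation(1) have "int K' - col (int K') = int K - col (int K) + 2 * int p"
    using K' by simp
  moreover have "of_int (x + 2 * y) = (of_int x :: bit)" for x y by simp
  ultimately have "of_int (col (int K')) = (of_int (col (int K)) :: bit)"
    "of_int (int K' - col (int K')) = (of_int (int K - col (int K)) :: bit)"
    "column_step \<sigma> p q K' = column_step \<sigma> p q K"
    by (simp_all only: column_step_def add_right_cancel)
  then show ?thesis
    unfolding K'_def[symmetric] half_cross_def by (simp only:)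
qed

text \<open>The shape of the path repeats after p + q steps of the half lattice, but the parities
  only after twice as many, so a full period needs both copies.\<close>

lemma christoffel_square: "map (column_step \<sigma> p q) [0..<2 * (p + q)] = christoffel \<sigma> p q @ christoffel \<sigma> p q"
proof -
  have "column_step \<sigma> p q (p + q + K) = column_step \<sigma> p q K" for K
    using col_period[of "int K"] col_period[of "int K + 1"]
    by (simp add: column_step_def add_ac)
  moreover have "[0..<2 * (p + q)] = [0..<p + q] @ map (\<lambda>K. p + q + K) [0..<p + q]"
    using upt_add_eq_append[of 0 "p + q" "p + q"] by (simp add: map_add_upt mult_2 add_ac)
  ultimately show ?thesis by (simp add: christoffel_def comp_def)
qed

theorem card_good_matchings_ideal:
  "int (card (good_matchings (band_graph (int q, int p) (ideal_crossings \<sigma> p q)))) = closed_trace \<sigma> p q"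
proof -
  let ?N = "2 * (p + q) + 2"
  let ?vs = "pivot_list 2 ?N"
  have N: "[2..<?N] = [2..<Suc (2 * (p + q))] @ [Suc (2 * (p + q))]" using p by auto
  then have vs: "?vs \<noteq> []" "last ?vs = apex \<sigma> p q (1 + 2 * (p + q))"
    unfolding pivot_list_def by simp_all
  \<comment> \<open>Index 1 lies before the first crossing of the curve, but \<open>apex\<close> is
    defined there too and gives the pivot preceding the first tile.\<close>
  have last: "last ?vs - (int q, int p) = apex \<sigma> p q 1"
    unfolding vs(2) apex_period by simp
  have "int (card (good_matchings (band_graph (int q, int p) (ideal_crossings \<sigma> p q)))) =
      tr2 (prod_list (map (letter \<circ> on_left \<sigma> p q) ?vs))"
  proof (rule card_good_matchings_band[OF pivots_ideal vs(1)])
    show "successively (\<lambda>v w. w = v \<longleftrightarrow> (on_left \<sigma> p q w \<longleftrightarrow> on_left \<sigma> p q v)) ((last ?vs - (int q, int p)) # ?vs)"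
      unfolding last using successively_pivot_list[of 1 "Suc (2 * (p + q))"]
      by (simp add: numeral_2_eq_2)
    show "on_left \<sigma> p q (last ?vs - (int q, int p)) \<longleftrightarrow> on_left \<sigma> p q (last ?vs)"
      using on_left_period[of "last ?vs - (int q, int p)"] by simp
  qed
  also have "\<dots> = tr2 (prod_list (map block [2 * 1..<2 * (p + q + 1)]))"
    by (simp add: prod_list_pivot_list)
  also have "\<dots> = tr2 (prod_list (map (\<lambda>k. half_cross (2 * k) * half_cross (2 * k + 1)) [1..<p + q + 1]))"
    unfolding prod_list_pairs block_pair ..
  \<comment> \<open>The crossings start at the antidiagonal 1, the Christoffel word at 0; the trace
    allows the cyclic shift.\<close>
  also have "\<dots> = tr2 (prod_list (map (\<lambda>k. half_cross (2 * k) * half_cross (2 * k + 1)) [0..<p + q]))"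
    using half_cross_period[of 0] half_cross_period[of 1] by (intro tr2_prod_list_rotate) simp
  also have "\<dots> = tr2 (prod_list (map half_cross [0..<2 * (p + q)]))"
    using prod_list_pairs[of half_cross 0 "p + q"] by simp
  also have "\<dots> = tr2 (path_mat (map (column_step \<sigma> p q) [0..<2 * (p + q)]) (of_int (col 0), of_int (- col 0)))"
    using prod_list_path_mat[of col "2 * (p + q)"] col_Suc
    by (simp add: half_cross_def[abs_def] column_step_def[abs_def])
  also have "(of_int (col 0), of_int (- col 0)) = base_point \<sigma>"
    using p col_eq_iff[of 0 "-1"] col_eq_iff[of 0 0] by (cases \<sigma>) auto
  finally show ?thesis by (simp only: christoffel_square closed_trace_def)
qed

end

section \<open>Crossings of a curve with the lattice\<close>

lemma mem_hull_segment:
  "z \<in> convex hull (pt ` {v, w}) \<longleftrightarrow>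
    (\<exists>u. 0 \<le> u \<and> u \<le> 1 \<and> z = (1 - u) *\<^sub>R pt v + u *\<^sub>R pt w)"
  by (auto simp: segment_convex_hull[symmetric] in_segment)

lemma hull_segment_iff:
  fixes x y :: real
  shows "(x, y) \<in> convex hull (pt ` {(a, b), (a, b) + (d, e)}) \<longleftrightarrow>
    (\<exists>u. 0 \<le> u \<and> u \<le> 1 \<and> x = of_int a + u * of_int d \<and> y = of_int b + u * of_int e)"
  unfolding mem_hull_segment by (simp add: pt_def algebra_simps)

lemma lattice_segments_cases:
  assumes "s \<in> lattice_segments"
  obtains a b d e where "s = {(a, b), (a, b) + (d, e)}" "(d, e) \<in> {(1, 0), (0, 1), (1, - 1)}"
  using assms unfolding lattice_segments_def by force

text \<open>Away from the vertices the parameter of a point on its segment is not an integer. Two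
  segments of the same direction through it then coincide, while two of different directions would
  force an integral parameter.\<close>

lemma lattice_segment_unique:
  assumes s: "s \<in> lattice_segments" "(x, y) \<in> convex hull (pt ` s)"
    and s': "s' \<in> lattice_segments" "(x, y) \<in> convex hull (pt ` s')"
    and not_vertex: "\<not> (x \<in> \<int> \<and> y \<in> \<int>)"
  shows "s = s'"
proof -
  obtain a b d e where se: "s = {(a, b), (a, b) + (d, e)}" and de: "(d, e) \<in> {(1, 0), (0, 1), (1, - 1)}"
    using lattice_segments_cases[OF s(1)] .
  obtain a' b' d' e' where se': "s' = {(a', b'), (a', b') + (d', e')}"
    and de': "(d', e') \<in> {(1, 0), (0, 1), (1, - 1)}"
    using lattice_segments_cases[OF s'(1)] .
  obtain u where u: "0 \<le> u" "u \<le> 1" "x = of_int a + u * of_int d" "y = of_int b + u * of_int e"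
    using s(2) unfolding se hull_segment_iff by blast
  obtain u' where u': "0 \<le> u'" "u' \<le> 1" "x = of_int a' + u' * of_int d'" "y = of_int b' + u' * of_int e'"
    using s'(2) unfolding se' hull_segment_iff by blast
  have nz: "u \<notin> \<int>" using not_vertex unfolding u(3) u(4) by auto
  have nz': "u' \<notin> \<int>" using not_vertex unfolding u'(3) u'(4) by auto
  have "u \<noteq> 0" "u \<noteq> 1" "u' \<noteq> 0" "u' \<noteq> 1" using nz nz' by auto
  then have bd: "0 < u" "u < 1" "0 < u'" "u' < 1" using u u' by auto
  have eq: "a = a'" if "real_of_int a + u = real_of_int a' + u'" for a a'
  proof -
    have "real_of_int a < real_of_int (a' + 1)" "real_of_int a' < real_of_int (a + 1)"
      using that bd by auto
    then show ?thesis unfolding of_int_less_iff by linarith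
  qed
  have ni: False if "real_of_int k = u \<or> real_of_int k = u' \<or> real_of_int k = - u \<or> real_of_int k = - u'" for k
    using that nz nz' by (metis Ints_minus Ints_of_int minus_minus)
  have *: "real_of_int a + u * of_int d = of_int a' + u' * of_int d'" "of_int b + u * of_int e = of_int b' + u' * of_int e'"
    using u u' by simp_all
  consider "(d, e) = (d', e')" | "(d, e) \<noteq> (d', e')" by blast
  then show ?thesis
  proof cases
    case 1
    then show ?thesis
      using de * eq[of a a'] eq[of b b'] eq[of b' b] bd unfolding se se' by auto
  next
    case 2
    have False
      using de de' 2 * ni[of "a' - a"] ni[of "a - a'"] ni[of "b - b'"] ni[of "b' - b"] ni[of "a' - a + (b' - b)"] ni[of "a - a' + (b - b')"]
      by auto
    then show ?thesis ..
  qed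
qed

lemma lattice_line_iff:
  "(\<exists>s \<in> lattice_segments. (x, y) \<in> convex hull (pt ` s)) \<longleftrightarrow> x \<in> \<int> \<or> y \<in> \<int> \<or> x + y \<in> \<int>"
proof
  assume "\<exists>s \<in> lattice_segments. (x, y) \<in> convex hull (pt ` s)"
  then obtain s where "s \<in> lattice_segments" "(x, y) \<in> convex hull (pt ` s)" by blast
  then obtain a b d e where "(d, e) \<in> {(1, 0), (0, 1), (1, - 1 :: int)}"
    "(x, y) \<in> convex hull (pt ` {(a, b), (a, b) + (d, e)})"
    using lattice_segments_cases by metis
  then show "x \<in> \<int> \<or> y \<in> \<int> \<or> x + y \<in> \<int>" unfolding hull_segment_iff by auto
next
  have seg: "{(a, b), (a, b) + (d, e)} \<in> lattice_segments" if "(d, e) \<in> {(1, 0), (0, 1), (1, - 1)}" for a b d e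
    using that unfolding lattice_segments_def by blast
  have fl: "0 \<le> z - of_int \<lfloor>z\<rfloor>" "z - of_int \<lfloor>z\<rfloor> \<le> 1" for z :: real by linarith+
  assume "x \<in> \<int> \<or> y \<in> \<int> \<or> x + y \<in> \<int>"
  then consider k where "x = of_int k" | k where "y = of_int k" | k where "x + y = of_int k"
    by (auto elim!: Ints_cases)
  then show "\<exists>s \<in> lattice_segments. (x, y) \<in> convex hull (pt ` s)"
  proof cases
    case 1
    then have "(x, y) \<in> convex hull (pt ` {(k, \<lfloor>y\<rfloor>), (k, \<lfloor>y\<rfloor>) + (0, 1)})"
      unfolding hull_segment_iff using fl[of y] by (intro exI[of _ "y - of_int \<lfloor>y\<rfloor>"]) auto
    then show ?thesis using seg by blast
  next
    case 2
    then have "(x, y) \<in> convex hull (pt ` {(\<lfloor>x\<rfloor>, k), (\<lfloor>x\<rfloor>, k) + (1, 0)})"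
      unfolding hull_segment_iff using fl[of x] by (intro exI[of _ "x - of_int \<lfloor>x\<rfloor>"]) auto
    then show ?thesis using seg by blast
  next
    case 3
    then have "(x, y) \<in> convex hull (pt ` {(\<lfloor>x\<rfloor>, k - \<lfloor>x\<rfloor>), (\<lfloor>x\<rfloor>, k - \<lfloor>x\<rfloor>) + (1, - 1)})"
      unfolding hull_segment_iff using fl[of x] by (intro exI[of _ "x - of_int \<lfloor>x\<rfloor>"]) auto
    then show ?thesis using seg by blast
  qed
qed

lemma segment_at_eq:
  assumes "s \<in> lattice_segments" "z \<in> convex hull (pt ` s)" "\<not> (fst z \<in> \<int> \<and> snd z \<in> \<int>)"
  shows "segment_at z = s"
  unfolding segment_at_def
proof (rule the_equality)
  show "s \<in> lattice_segments \<and> z \<in> convex hull (pt ` s)" using assms by blast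
  show "s' = s" if "s' \<in> lattice_segments \<and> z \<in> convex hull (pt ` s')" for s'
    using that assms lattice_segment_unique[of s' "fst z" "snd z" s] by simp
qed

lemma nearer_endpoint_eq:
  assumes "segment_at z = {v, w}" "dist z (pt v) < dist z (pt w)"
  shows "nearer_endpoint z = v"
  unfolding nearer_endpoint_def assms(1)
proof (rule the_equality)
  show "v \<in> {v, w} \<and> (\<forall>w \<in> {v, w} - {v}. dist z (pt v) < dist z (pt w))" using assms(2) by auto
  fix v' assume v': "v' \<in> {v, w} \<and> (\<forall>w \<in> {v, w} - {v'}. dist z (pt v') < dist z (pt w))"
  show "v' = v"
  proof (rule ccontr)
    assume "v' \<noteq> v"
    then have "v' = w" "v \<in> {v, w} - {v'}" using v' by auto
    then have "dist z (pt w) < dist z (pt v)" using v' by blast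
    then show False using assms(2) by simp
  qed
qed

lemma pt_eq_iff: "pt v = pt w \<longleftrightarrow> v = w"
  by (cases v; cases w) (simp add: pt_def)

lemma crossing_point:
  assumes s: "{v, w} \<in> lattice_segments" and ne: "v \<noteq> w"
    and z: "z = (1 - u) *\<^sub>R pt v + u *\<^sub>R pt w" and u: "0 < u" "u < 1" "u \<noteq> 1 / 2"
  shows "segment_at z = {v, w}" "nearer_endpoint z = (if u < 1 / 2 then v else w)"
proof -
  have nv: "\<not> (fst z \<in> \<int> \<and> snd z \<in> \<int>)"
  proof
    assume Z: "fst z \<in> \<int> \<and> snd z \<in> \<int>"
    have nu: "u \<notin> \<int>" using u by (auto elim!: Ints_cases)
    obtain a b d e where vw: "{v, w} = {(a, b), (a, b) + (d, e)}" and de: "(d, e) \<in> {(1, 0), (0, 1), (1, - 1)}"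
      using lattice_segments_cases[OF s] .
    have diff: "fst z = of_int (fst v) + u * of_int (fst w - fst v)" "snd z = of_int (snd v) + u * of_int (snd w - snd v)"
      by (simp_all add: z pt_def algebra_simps)
    have "u * of_int (fst w - fst v) \<in> \<int>" "u * of_int (snd w - snd v) \<in> \<int>"
      using Z unfolding diff by (metis Ints_diff Ints_of_int add_diff_cancel_left')+
    moreover have "(w = v + (d, e)) \<or> (v = w + (d, e))"
      using vw ne by (auto simp: doubleton_eq_iff)
    moreover have "fst w - fst v \<in> {1, -1} \<or> snd w - snd v \<in> {1, -1}"
      using calculation(3) de by (cases v; cases w) auto
    ultimately show False
      using nu by auto
  qed
  show seg: "segment_at z = {v, w}"
  proof (rule segment_at_eq[OF s _ nv])
    show "z \<in> convex hull (pt ` {v, w})"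
      unfolding mem_hull_segment using z u by (intro exI[of _ u]) auto
  qed
  have pos: "0 < dist (pt v) (pt w)" using ne by (simp add: pt_eq_iff)
  have "z - pt v = u *\<^sub>R (pt w - pt v)" "z - pt w = (1 - u) *\<^sub>R (pt v - pt w)"
    by (simp_all add: z algebra_simps)
  then have d: "dist z (pt v) = u * dist (pt v) (pt w)" "dist z (pt w) = (1 - u) * dist (pt v) (pt w)"
    using u by (simp_all add: dist_norm norm_minus_commute)
  show "nearer_endpoint z = (if u < 1 / 2 then v else w)"
  proof (cases "u < 1 / 2")
    case True
    then have "dist z (pt v) < dist z (pt w)"
      unfolding d using pos by (intro mult_strict_right_mono) auto
    then show ?thesis using nearer_endpoint_eq[OF seg] True by simp
  next
    case False
    then have "dist z (pt w) < dist z (pt v)"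
      unfolding d using pos u by (intro mult_strict_right_mono) auto
    moreover have "segment_at z = {w, v}" using seg by (simp add: insert_commute)
    ultimately show ?thesis using nearer_endpoint_eq False by simp
  qed
qed

lemma crossing_times_eq:
  "crossing_times \<gamma> = {t \<in> {0..1}. fst (\<gamma> t) \<in> \<int> \<or> snd (\<gamma> t) \<in> \<int> \<or> fst (\<gamma> t) + snd (\<gamma> t) \<in> \<int>}"
  unfolding crossing_times_def lattice_line_iff[symmetric] by simp

lemma crossings_eq:
  fixes \<tau> :: "nat \<Rightarrow> real"
  assumes "crossing_times \<gamma> = \<tau> ` {a..<b}"
    and "\<And>i. a \<le> i \<Longrightarrow> Suc i < b \<Longrightarrow> \<tau> i < \<tau> (Suc i)"
  shows "crossings \<gamma> = map (\<lambda>j. (segment_at (\<gamma> (\<tau> j)), nearer_endpoint (\<gamma> (\<tau> j)))) [a..<b]"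
proof -
  have mono: "\<tau> i < \<tau> j" if "a \<le> i" "i < j" "j < b" for i j
    using that(2,3)
  proof (induction j rule: less_induct)
    case (less j)
    then obtain j' where j': "j = Suc j'" by (cases j) auto
    then have "\<tau> j' < \<tau> j" using assms(2)[of j'] less.prems that(1) by simp
    then show ?case using less.IH[of j'] less.prems j' by (cases "i = j'") auto
  qed
  have "sorted_wrt (<) (map \<tau> [a..<b])"
    unfolding sorted_wrt_iff_nth_less using mono by simp
  then have "sorted_list_of_set (set (map \<tau> [a..<b])) = map \<tau> [a..<b]"
    by (simp only: sorted_list_of_set.idem_if_sorted_distinct strict_sorted_iff)
  then show ?thesis
    by (simp add: crossings_def assms(1))
qed

text \<open>The coordinate \<open>g\<close> orders the crossings; \<open>\<delta>\<close> measures the distance from the line of slope \<open>p/q\<close>, and its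
  sign matters only where that line meets a midpoint or vertex, that is for \<open>g\<close> near \<open>(p + q) / 2\<close> or
  \<open>p + q\<close>.\<close>

locale transversal = positive_slope +
  fixes \<gamma> :: "real \<Rightarrow> real \<times> real"
  fixes X Y g \<delta> :: "real \<Rightarrow> real"
  defines "X \<equiv> \<lambda>t. fst (\<gamma> t)" and "Y \<equiv> \<lambda>t. snd (\<gamma> t)"
    and "g \<equiv> \<lambda>t. X t + Y t" and "\<delta> \<equiv> \<lambda>t. real q * Y t - real p * X t"
  assumes coprime: "gcd p q = 1"
    and cont: "continuous_on {0..1} \<gamma>"
    and g_mono: "\<And>s t. 0 \<le> s \<Longrightarrow> s < t \<Longrightarrow> t \<le> 1 \<Longrightarrow> g s < g t"
    and pos: "\<And>t. 0 \<le> t \<Longrightarrow> t \<le> 1 \<Longrightarrow> 0 < X t \<and> 0 < Y t"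
    and g_0: "g 0 < 1" and g_1: "real (p + q) < g 1" "g 1 < real (p + q) + 1"
    and end_1: "real q < X 1" "real p < Y 1"
    and inj_X: "\<And>s t. s \<in> {0..1} \<Longrightarrow> t \<in> {0..1} \<Longrightarrow> X s = X t \<Longrightarrow> X t \<in> \<int> \<Longrightarrow> s = t"
    and inj_Y: "\<And>s t. s \<in> {0..1} \<Longrightarrow> t \<in> {0..1} \<Longrightarrow> Y s = Y t \<Longrightarrow> Y t \<in> \<int> \<Longrightarrow> s = t"
    and \<delta>_small: "\<And>t. t \<in> {0..1} \<Longrightarrow> \<bar>\<delta> t\<bar> < 1 / 4"
    and \<delta>_sign: "\<And>t. t \<in> crossing_times \<gamma> \<Longrightarrow> real (p + q) - 1 \<le> 2 * g t \<Longrightarrow>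
      (if \<sigma> = LeftSide then 0 < \<delta> t else \<delta> t < 0)"
begin

lemma contX: "continuous_on {0..1} X" and contY: "continuous_on {0..1} Y" and contg: "continuous_on {0..1} g"
  unfolding X_def Y_def g_def using cont by (auto intro!: continuous_intros)

lemma crossing_iff: "t \<in> crossing_times \<gamma> \<longleftrightarrow> t \<in> {0..1} \<and> (X t \<in> \<int> \<or> Y t \<in> \<int> \<or> g t \<in> \<int>)"
  by (simp add: crossing_times_eq X_def Y_def g_def)

lemma g_less_iff: "s \<in> {0..1} \<Longrightarrow> t \<in> {0..1} \<Longrightarrow> g s < g t \<longleftrightarrow> s < t"
  using g_mono[of s t] g_mono[of t s] by (cases s t rule: linorder_cases) auto

lemma n_dvd: 
  assumes "int q * G = n * m"
  shows "n dvd G"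
proof -
  have "coprime n (int q)"
    using coprime gcd_add1[of "int p" "int q"] gcd_int_int_eq[of p q]
    by (simp only: coprime_iff_gcd_eq_1 of_nat_1)
  moreover have "n dvd int q * G" using assms by simp
  ultimately show ?thesis using coprime_dvd_mult_right_iff by blast
qed

text \<open>Since 2 \<delta> is less than 1/2 in absolute value, a nonzero integer z decides the
  comparison alone. If z = 0, coprimality makes G a positive multiple of p + q, so g is large enough
  for \<open>\<delta>_sign\<close> to break the tie as the offset does. For a midpoint, G is the
  level in the half lattice, whence the factor 2 in the bound.\<close>

lemma \<delta>_compare:
  fixes G m :: int
  assumes t: "t \<in> crossing_times \<gamma>" and G: "0 < G" "real_of_int G \<le> 2 * g t + 1"
  defines "z \<equiv> int q * G - n * m"
  shows "real_of_int z < \<delta> t \<longleftrightarrow> z + c \<le> 0" "\<delta> t < real_of_int z \<longleftrightarrow> 0 < z + c"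
    "real_of_int z < 2 * \<delta> t \<longleftrightarrow> z + c \<le> 0" "real_of_int z \<noteq> 2 * \<delta> t"
proof -
  have d: "\<bar>\<delta> t\<bar> < 1 / 4" using t \<delta>_small by (simp add: crossing_iff)
  have c: "c = (if \<sigma> = LeftSide then 0 else 1)" by (cases \<sigma>) auto
  have "(real_of_int z < \<delta> t \<longleftrightarrow> z + c \<le> 0) \<and> (\<delta> t < real_of_int z \<longleftrightarrow> 0 < z + c) \<and>
    (real_of_int z < 2 * \<delta> t \<longleftrightarrow> z + c \<le> 0) \<and> real_of_int z \<noteq> 2 * \<delta> t"
  proof (cases z "0 :: int" rule: linorder_cases)
    case less
    then have "real_of_int z \<le> - 1" by linarith
    with d have "real_of_int z < \<delta> t" "\<not> \<delta> t < real_of_int z" "real_of_int z < 2 * \<delta> t" by linarith+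
    moreover have "z + c \<le> 0" "\<not> 0 < z + c" using less c by (auto split: if_splits)
    ultimately show ?thesis by simp
  next
    case greater
    then have "real_of_int z \<ge> 1" by linarith
    with d have "\<not> real_of_int z < \<delta> t" "\<delta> t < real_of_int z" "\<not> real_of_int z < 2 * \<delta> t" "real_of_int z \<noteq> 2 * \<delta> t"
      by linarith+
    moreover have "\<not> z + c \<le> 0" "0 < z + c" using greater c by (auto split: if_splits)
    ultimately show ?thesis by simp
  next
    case equal
    then have "n dvd G" using n_dvd by (simp add: z_def)
    then have "n \<le> G" using G(1) zdvd_imp_le by blast
    then have "real_of_int n \<le> real_of_int G" by (simp only: of_int_le_iff)
    then have "real (p + q) - 1 \<le> 2 * g t" using G(2) by simp
    then have "if \<sigma> = LeftSide then 0 < \<delta> t else \<delta> t < 0" by (rule \<delta>_sign[OF t])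
    then show ?thesis using c equal by (auto split: if_splits)
  qed
  then show "real_of_int z < \<delta> t \<longleftrightarrow> z + c \<le> 0" "\<delta> t < real_of_int z \<longleftrightarrow> 0 < z + c"
    "real_of_int z < 2 * \<delta> t \<longleftrightarrow> z + c \<le> 0" "real_of_int z \<noteq> 2 * \<delta> t" by blast+
qed

lemma nX: "real_of_int n * X t = real q * g t - \<delta> t" and nY: "real_of_int n * Y t = real p * g t + \<delta> t"
  by (simp_all add: g_def \<delta>_def algebra_simps)

section \<open>Crossing times of a transversal curve\<close>

lemma diagonal_ex:
  assumes "1 \<le> k" "k \<le> p + q"
  shows "\<exists>t \<in> {0..1}. g t = real k"
  using IVT'[of g 0 "real k" 1] assms g_0 g_1 contg by (auto simp: Bex_def)

text \<open>The curve ends before the antidiagonal p + q + 1; the value 1, its end, takes the place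
  of that crossing and bounds the last interval.\<close>

definition diag_time :: "nat \<Rightarrow> real" where
  "diag_time k = (if k \<le> p + q then SOME t. t \<in> {0..1} \<and> g t = real k else 1)"

lemma diag_time:
  assumes "1 \<le> k" "k \<le> p + q"
  shows "diag_time k \<in> {0..1}" "g (diag_time k) = real k" "diag_time k \<in> crossing_times \<gamma>"
proof -
  show *: "diag_time k \<in> {0..1}" "g (diag_time k) = real k"
    using someI_ex[OF diagonal_ex[OF assms, unfolded Bex_def]] assms by (simp_all add: diag_time_def)
  then show "diag_time k \<in> crossing_times \<gamma>" unfolding crossing_iff by simp
qed

lemma diag_time_mono:
  assumes "1 \<le> k" "k \<le> p + q"
  shows "diag_time k < diag_time (Suc k)" "diag_time (Suc k) \<in> {0..1}"
proof -
  have "g (diag_time k) < g (diag_time (Suc k)) \<and> diag_time (Suc k) \<in> {0..1}"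
  proof (cases "k = p + q")
    case True
    then show ?thesis using diag_time[OF assms] g_1 by (simp add: diag_time_def)
  next
    case False
    then show ?thesis using diag_time[OF assms] diag_time[of "Suc k"] assms by simp
  qed
  then show "diag_time k < diag_time (Suc k)" "diag_time (Suc k) \<in> {0..1}"
    using g_less_iff diag_time[OF assms] by blast+
qed

lemma diag_height:
  assumes "1 \<le> k" "k \<le> p + q"
  shows "real_of_int (height p q (rvert \<sigma> p q k)) < \<delta> (diag_time k)"
    "\<delta> (diag_time k) < real_of_int (height p q (lvert \<sigma> p q k))"
proof -
  have h: "height p q (lvert \<sigma> p q k) = int q * int k - n * col k"
    "height p q (rvert \<sigma> p q k) = int q * int k - n * (col k + 1)"
    by (simp_all add: height_vert algebra_simps)
  note dt = diag_time[OF assms]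
  have G: "0 < int k" "real_of_int (int k) \<le> 2 * g (diag_time k) + 1" using assms dt by simp_all
  have "int q * int k - n * (col k + 1) + c \<le> 0" "0 < int q * int k - n * col k + c"
    using col_bounds[where k = "int k"] by (simp_all add: algebra_simps)
  then show "real_of_int (height p q (rvert \<sigma> p q k)) < \<delta> (diag_time k)"
    "\<delta> (diag_time k) < real_of_int (height p q (lvert \<sigma> p q k))"
    unfolding h using \<delta>_compare(1,2)[OF dt(3) G] by blast+
qed

definition on_axis :: "nat \<Rightarrow> real \<Rightarrow> bool" where
  "on_axis k t \<longleftrightarrow> (if col (int k + 1) = col k then Y t = real_of_int (int k - col k)
     else X t = real_of_int (col k + 1))"

text \<open>Past the antidiagonal through (q, p) one crossing remains: with x = q for the left
  curve, with y = p for the right one. \<open>end_1\<close> guarantees that the curve gets beyond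
  it.\<close>

lemma col_last: "col n = int q - 1 + c" "col (n + 1) = int q"
proof -
  have c: "c = 0 \<or> c = 1" by (rule offset_cases)
  have "col 0 = c - 1" using p q c unfolding col_eq_iff by auto
  moreover have "col 1 = 0" using p q c unfolding col_eq_iff by auto
  ultimately show "col n = int q - 1 + c" "col (n + 1) = int q"
    using col_period[of 0] col_period[of 1] by (simp_all add: add.commute)
qed

lemma axis_ex:
  assumes k: "1 \<le> k" "k \<le> p + q"
  shows "\<exists>t. diag_time k < t \<and> t < diag_time (Suc k) \<and> on_axis k t"
proof -
  have n: "0 < real_of_int n" using p by simp
  note dt = diag_time[OF k] and dm = diag_time_mono[OF k]
  have sub: "{diag_time k..diag_time (Suc k)} \<subseteq> {0..1}" using dt(1) dm(2) by auto
  note cX = continuous_on_subset[OF contX sub] and cY = continuous_on_subset[OF contY sub]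
  note dh = diag_height[OF k, unfolded height_vert]
  have nxt: "real_of_int (height p q (rvert \<sigma> p q (int k + 1))) < \<delta> (diag_time (Suc k))"
    "\<delta> (diag_time (Suc k)) < real_of_int (height p q (lvert \<sigma> p q (int k + 1)))"
    "g (diag_time (Suc k)) = real k + 1" if "k < p + q"
    using diag_height[of "Suc k"] diag_time[of "Suc k"] that by (simp_all add: add.commute)
  show ?thesis
  proof (cases "col (int k + 1) = col k")
    case True
    let ?y = "real_of_int (int k - col k)"
    have "real_of_int n * Y (diag_time k) < real_of_int n * ?y"
      unfolding nY dt(2) using dh(2) by (simp add: algebra_simps)
    then have 1: "Y (diag_time k) < ?y" using n by simp
    have 2: "?y < Y (diag_time (Suc k))"
    proof (cases "k = p + q")
      case kn: True
      then have "col (int k) = int q" using True col_last by simp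
      then show ?thesis using end_1 kn by (simp add: diag_time_def)
    next
      case False
      then have kn: "k < p + q" using k by simp
      have "real_of_int n * ?y < real_of_int n * Y (diag_time (Suc k))"
        unfolding nY nxt(3)[OF kn] using nxt(1)[OF kn] True by (simp add: height_vert algebra_simps)
      then show ?thesis using n by simp
    qed
    obtain t where "diag_time k \<le> t" "t \<le> diag_time (Suc k)" "Y t = ?y"
      using IVT'[of Y "diag_time k" ?y "diag_time (Suc k)"] 1 2 dm(1) cY by auto
    moreover from this have "t \<noteq> diag_time k" "t \<noteq> diag_time (Suc k)" using 1 2 by auto
    ultimately show ?thesis using True by (auto simp: on_axis_def intro!: exI[of _ t])
  next
    case False
    then have cS: "col (int k + 1) = col k + 1" using col_Suc by blast
    let ?x = "real_of_int (col k + 1)"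
    have "real_of_int n * X (diag_time k) < real_of_int n * ?x"
      unfolding nX dt(2) using dh(1) by (simp add: algebra_simps)
    then have 1: "X (diag_time k) < ?x" using n by simp
    have 2: "?x < X (diag_time (Suc k))"
    proof (cases "k = p + q")
      case kn: True
      then have "col (int k) + 1 = int q" using cS col_last by simp
      then have "?x = real q" by linarith
      then show ?thesis using end_1 kn by (simp add: diag_time_def)
    next
      case False
      then have kn: "k < p + q" using k by simp
      have "real_of_int n * ?x < real_of_int n * X (diag_time (Suc k))"
        unfolding nX nxt(3)[OF kn] using nxt(2)[OF kn] cS by (simp add: height_vert algebra_simps)
      then show ?thesis using n by simp
    qed
    obtain t where "diag_time k \<le> t" "t \<le> diag_time (Suc k)" "X t = ?x"
      using IVT'[of X "diag_time k" ?x "diag_time (Suc k)"] 1 2 dm(1) cX by auto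
    moreover from this have "t \<noteq> diag_time k" "t \<noteq> diag_time (Suc k)" using 1 2 by auto
    ultimately show ?thesis using False by (auto simp: on_axis_def intro!: exI[of _ t])
  qed
qed

definition axis_time :: "nat \<Rightarrow> real" where
  "axis_time k = (SOME t. diag_time k < t \<and> t < diag_time (Suc k) \<and> on_axis k t)"

lemma axis_time:
  assumes "1 \<le> k" "k \<le> p + q"
  shows "diag_time k < axis_time k" "axis_time k < diag_time (Suc k)" "on_axis k (axis_time k)"
    "axis_time k \<in> {0..1}" "axis_time k \<in> crossing_times \<gamma>"
    "real k < g (axis_time k)" "g (axis_time k) < real k + 1"
proof -
  show *: "diag_time k < axis_time k" "axis_time k < diag_time (Suc k)" "on_axis k (axis_time k)"
    using someI_ex[OF axis_ex[OF assms]] by (simp_all add: axis_time_def)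
  show 01: "axis_time k \<in> {0..1}"
    using * diag_time(1)[OF assms] diag_time_mono(2)[OF assms] by auto
  have "X (axis_time k) \<in> \<int> \<or> Y (axis_time k) \<in> \<int>"
    using *(3) unfolding on_axis_def by (auto split: if_splits)
  then show "axis_time k \<in> crossing_times \<gamma>" using 01 by (auto simp: crossing_iff)
  show "real k < g (axis_time k)"
    using *(1) g_less_iff[OF diag_time(1)[OF assms] 01] diag_time(2)[OF assms] by simp
  have "g (axis_time k) < g (diag_time (Suc k))"
    using *(2) g_less_iff[OF 01 diag_time_mono(2)[OF assms]] by simp
  also have "\<dots> \<le> real k + 1"
    using diag_time(2)[of "Suc k"] g_1 assms by (cases "k = p + q") (simp_all add: diag_time_def)
  finally show "g (axis_time k) < real k + 1" .
qed

text \<open>Antidiagonals are met once because g increases. For any other crossing, comparing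
  \<delta> at the levels k and k + 1 fixes which integral coordinate it has, and
  \<open>inj_X\<close> and \<open>inj_Y\<close> leave a single time for it.\<close>

lemma crossing_cases:
  assumes t: "t \<in> crossing_times \<gamma>"
  shows "\<exists>k. 1 \<le> k \<and> k \<le> p + q \<and> (t = diag_time k \<or> t = axis_time k)"
proof -
  have t01: "t \<in> {0..1}" using t by (simp add: crossing_iff)
  have gt: "0 < g t" "g t < real (p + q) + 1"
    using pos[of t] t01 g_1 g_less_iff[of t 1] unfolding g_def by (cases "t = 1"; force)+
  define k where "k = nat \<lfloor>g t\<rfloor>"
  have kg: "real k \<le> g t" "g t < real k + 1" using gt by (simp_all add: k_def)
  then have kn: "k \<le> p + q" using gt by linarith
  have n: "0 < real_of_int n" using p by simp
  show ?thesis
  proof (cases "g t = real k")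
    case True
    then have "1 \<le> k" using gt by (cases k) auto
    moreover have "t = diag_time k"
      using diag_time[OF \<open>1 \<le> k\<close> kn] True t01 g_less_iff[of t "diag_time k"] g_less_iff[of "diag_time k" t]
      by (cases t "diag_time k" rule: linorder_cases) auto
    ultimately show ?thesis using kn by blast
  next
    case False
    then have kg': "real k < g t" using kg by simp
    have "g t \<notin> \<int>"
    proof
      assume "g t \<in> \<int>"
      then obtain i where "g t = of_int i" by (auto elim: Ints_cases)
      then have "int k < i" "i < int k + 1" using kg' kg(2) by linarith+
      then show False by simp
    qed
    then have XY: "X t \<in> \<int> \<or> Y t \<in> \<int>" using t by (simp add: crossing_iff)
    \<comment> \<open>Before the first antidiagonal the curve is in the interior of a lattice
      triangle.\<close>
    have k1: "1 \<le> k"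
    proof (rule ccontr)
      assume "\<not> 1 \<le> k"
      then have "X t + Y t < 1" "0 < X t" "0 < Y t" using kg pos[of t] t01 by (auto simp: g_def)
      then have "0 < X t" "X t < 1" "0 < Y t" "Y t < 1" by auto
      then show False using XY by (auto elim!: Ints_cases)
    qed
    have G: "0 < int k" "real_of_int (int k) \<le> 2 * g t + 1" "0 < int k + 1" "real_of_int (int k + 1) \<le> 2 * g t + 1"
      using k1 kg' by simp_all
    note cmp = \<delta>_compare(1,2)[OF t G(1,2)] \<delta>_compare(1,2)[OF t G(3,4)]
    have q': "0 < real q * (g t - real k)" "0 < real q * (real k + 1 - g t)"
      "0 < real p * (g t - real k)" "0 < real p * (real k + 1 - g t)"
      using kg' kg(2) p q by simp_all
    have "on_axis k t"
    proof (cases "X t \<in> \<int>")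
      case True
      then obtain m where m: "X t = of_int m" by (auto elim: Ints_cases)
      have e: "\<delta> t = real q * g t - real_of_int n * of_int m" using nX[of t] m by simp
      have "real_of_int (int q * int k - n * m) < \<delta> t"
        unfolding e using q'(1) by (simp add: algebra_simps)
      then have "col (int k) \<le> m - 1"
        unfolding cmp(1) col_le_iff by (simp add: algebra_simps)
      moreover have "\<delta> t < real_of_int (int q * (int k + 1) - n * m)"
        unfolding e using q'(2) by (simp add: algebra_simps)
      then have "\<not> col (int k + 1) \<le> m - 1"
        unfolding cmp(4) col_le_iff by (simp add: algebra_simps)
      ultimately show ?thesis
        using col_Suc[of "int k"] m by (auto simp: on_axis_def)
    next
      case False
      then obtain m where m: "Y t = of_int m" using XY by (auto elim: Ints_cases)
      have e: "\<delta> t = real_of_int n * of_int m - real p * g t" using nY[of t] m by simp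
      have "\<delta> t < real_of_int (int q * int k - n * (int k - m))"
        unfolding e using q'(3) by (simp add: algebra_simps)
      then have "\<not> col (int k) \<le> int k - m - 1"
        unfolding cmp(2) col_le_iff by (simp add: algebra_simps)
      moreover have "real_of_int (int q * (int k + 1) - n * (int k + 1 - m)) < \<delta> t"
        unfolding e using q'(4) by (simp add: algebra_simps)
      then have "col (int k + 1) \<le> int k - m"
        unfolding cmp(3) col_le_iff by (simp add: algebra_simps)
      ultimately show ?thesis
        using col_Suc[of "int k"] m by (auto simp: on_axis_def)
    qed
    moreover note axis_time[OF k1 kn]
    ultimately have "t = axis_time k"
      using inj_X[OF t01, of "axis_time k"] inj_Y[OF t01, of "axis_time k"]
      unfolding on_axis_def by (auto split: if_splits)
    then show ?thesis using k1 kn by blast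
  qed
qed

definition crossing_time :: "nat \<Rightarrow> real" where
  "crossing_time j = (if even j then diag_time (j div 2) else axis_time (j div 2))"

lemma crossing_times_image: "crossing_times \<gamma> = crossing_time ` {2..<2 * (p + q) + 2}"
proof (intro equalityI subsetI)
  fix t assume "t \<in> crossing_times \<gamma>"
  then obtain k where k: "1 \<le> k" "k \<le> p + q" "t = diag_time k \<or> t = axis_time k"
    using crossing_cases by blast
  then have "t = crossing_time (2 * k) \<or> t = crossing_time (2 * k + 1)"
    by (auto simp: crossing_time_def)
  then show "t \<in> crossing_time ` {2..<2 * (p + q) + 2}" using k by force
next
  fix t assume "t \<in> crossing_time ` {2..<2 * (p + q) + 2}"
  then obtain j where j: "2 \<le> j" "j < 2 * (p + q) + 2" "t = crossing_time j" by auto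
  then have "1 \<le> j div 2" "j div 2 \<le> p + q" by auto
  then show "t \<in> crossing_times \<gamma>"
    using diag_time(3) axis_time(5) j(3) by (simp add: crossing_time_def)
qed

lemma crossing_time_Suc:
  assumes "2 \<le> j" "Suc j < 2 * (p + q) + 2"
  shows "crossing_time j < crossing_time (Suc j)"
proof -
  have k: "1 \<le> j div 2" "j div 2 \<le> p + q" using assms by auto
  show ?thesis
    using axis_time(1,2)[OF k] by (cases "even j") (auto simp: crossing_time_def odd_Suc_div_two)
qed

text \<open>Along the segment \<delta> is affine, with the heights of the ends as end values. Its
  value therefore locates the crossing, and u < 1/2 means that \<delta> exceeds the mean of the two
  heights.\<close>

lemma crossing_at:
  assumes seg: "{v, w} \<in> lattice_segments"
    and \<gamma>: "\<gamma> t = (1 - u) *\<^sub>R pt v + u *\<^sub>R pt w"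
    and h: "real_of_int (height p q w) < \<delta> t" "\<delta> t < real_of_int (height p q v)"
    and near: "real_of_int (height p q v + height p q w) < 2 * \<delta> t \<longleftrightarrow> height p q v + height p q w + c \<le> 0"
      "real_of_int (height p q v + height p q w) \<noteq> 2 * \<delta> t"
  shows "segment_at (\<gamma> t) = {v, w}"
    "nearer_endpoint (\<gamma> t) = (if height p q v + height p q w + c \<le> 0 then v else w)"
proof -
  let ?v = "real_of_int (height p q v)" and ?w = "real_of_int (height p q w)"
  have d: "\<delta> t = ?v + u * (?w - ?v)"
    by (simp add: \<delta>_def X_def Y_def \<gamma> height_def pt_def algebra_simps)
  have wv: "?w < ?v" using h by simp
  have "u * (?v - ?w) < 1 * (?v - ?w)" "0 * (?v - ?w) < u * (?v - ?w)"
    using h unfolding d by (simp_all add: algebra_simps)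
  then have u: "0 < u" "u < 1" using wv by (simp_all only: mult_less_cancel_right_pos diff_gt_0_iff_gt)
  have ne: "v \<noteq> w" using wv by auto
  have nu: "u \<noteq> 1 / 2"
  proof
    assume "u = 1 / 2"
    then have u2: "2 * u = 1" by simp
    have "2 * \<delta> t = 2 * ?v + (2 * u) * (?w - ?v)" by (simp add: d)
    then have "2 * \<delta> t = ?v + ?w" unfolding u2 by simp
    then show False using near(2) by simp
  qed
  have "u < 1 / 2 \<longleftrightarrow> u * (?v - ?w) < 1 / 2 * (?v - ?w)"
    using wv by (simp only: mult_less_cancel_right_pos diff_gt_0_iff_gt)
  also have "\<dots> \<longleftrightarrow> real_of_int (height p q v + height p q w) < 2 * \<delta> t"
    unfolding d by (auto simp: algebra_simps)
  finally have "u < 1 / 2 \<longleftrightarrow> height p q v + height p q w + c \<le> 0" using near(1) by simp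
  then show "segment_at (\<gamma> t) = {v, w}"
    "nearer_endpoint (\<gamma> t) = (if height p q v + height p q w + c \<le> 0 then v else w)"
    using crossing_point[OF seg ne \<gamma> u nu] by simp_all
qed

lemma lattice_segmentI:
  "(d, e) \<in> {(1, 0), (0, 1), (1, - 1)} \<Longrightarrow> w = v + (d, e) \<Longrightarrow> {v, w} \<in> lattice_segments"
  "(d, e) \<in> {(1, 0), (0, 1), (1, - 1)} \<Longrightarrow> v = w + (d, e) \<Longrightarrow> {v, w} \<in> lattice_segments"
  unfolding lattice_segments_def by (blast, subst insert_commute, blast)

lemma ideal_crossing:
  assumes j: "2 \<le> j" "j < 2 * (p + q) + 2"
  shows "segment_at (\<gamma> (crossing_time j)) = {left_end \<sigma> p q j, right_end \<sigma> p q j}"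
    "nearer_endpoint (\<gamma> (crossing_time j)) = near_end \<sigma> p q j"
proof -
  define k where "k = j div 2"
  define t where "t = crossing_time j"
  have k: "1 \<le> k" "k \<le> p + q" using j by (auto simp: k_def)
  have \<gamma>t: "\<gamma> t = (X t, Y t)" by (simp add: X_def Y_def)
  have tc: "t \<in> crossing_times \<gamma>" unfolding t_def crossing_times_image using j by auto
  have "segment_at (\<gamma> t) = {left_end \<sigma> p q j, right_end \<sigma> p q j} \<and>
    nearer_endpoint (\<gamma> t) = near_end \<sigma> p q j"
  proof (cases "even j")
    case True
    then have t: "t = diag_time k" by (simp add: t_def crossing_time_def k_def)
    have lr: "left_end \<sigma> p q j = lvert \<sigma> p q k" "right_end \<sigma> p q j = rvert \<sigma> p q k"
      using True by (simp_all add: left_end_def right_end_def Let_def k_def)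
    have G: "0 < 2 * int k" "real_of_int (2 * int k) \<le> 2 * g t + 1"
      using k diag_time(2)[OF k] by (simp_all add: t)
    have s: "height p q (lvert \<sigma> p q k) + height p q (rvert \<sigma> p q k) = int q * (2 * int k) - n * (2 * col k + 1)"
      by (simp add: height_vert algebra_simps)
    have "Y t = real k - X t" using diag_time(2)[OF k] by (simp add: g_def t)
    then have "\<gamma> t = (1 - (X t - col k)) *\<^sub>R pt (lvert \<sigma> p q k) + (X t - col k) *\<^sub>R pt (rvert \<sigma> p q k)"
      by (simp add: \<gamma>t pt_def lvert_def rvert_def algebra_simps)
    moreover have "{lvert \<sigma> p q k, rvert \<sigma> p q k} \<in> lattice_segments"
      by (rule lattice_segmentI(1)[of 1 "-1"]) (simp_all add: lvert_def rvert_def)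
    ultimately show ?thesis
      using crossing_at diag_height[OF k] \<delta>_compare(3,4)[OF tc G, of "2 * col k + 1", folded s]
      unfolding near_end_def lr t by blast
  next
    case False
    then have t: "t = axis_time k" by (simp add: t_def crossing_time_def k_def)
    note at = axis_time[OF k, folded t]
    have G: "0 < 2 * int k + 1" "real_of_int (2 * int k + 1) \<le> 2 * g t + 1"
      using k at(6) by simp_all
    have pq: "0 < real q * (g t - real k)" "0 < real q * (real k + 1 - g t)"
      "0 < real p * (g t - real k)" "0 < real p * (real k + 1 - g t)"
      using at(6,7) p q by simp_all
    show ?thesis
    proof (cases "col (int k + 1) = col k")
      case True
      then have True': "col (1 + int k) = col k" by (simp add: add.commute)
      let ?v = "lvert \<sigma> p q k" and ?w = "rvert \<sigma> p q (int k + 1)"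
      have lr: "left_end \<sigma> p q j = ?v" "right_end \<sigma> p q j = ?w"
        using True False by (simp_all add: left_end_def right_end_def Let_def k_def)
      have s: "height p q ?v + height p q ?w = int q * (2 * int k + 1) - n * (2 * col k + 1)"
        by (simp add: height_vert True True' algebra_simps)
      have y: "Y t = real_of_int (int k - col k)" using at(3) True by (simp add: on_axis_def)
      have "\<gamma> t = (1 - (X t - col k)) *\<^sub>R pt ?v + (X t - col k) *\<^sub>R pt ?w"
        by (simp add: \<gamma>t y pt_def lvert_def rvert_def True True' algebra_simps)
      moreover have "{?v, ?w} \<in> lattice_segments"
        by (rule lattice_segmentI(1)[of 1 0]) (simp_all add: lvert_def rvert_def True)
      moreover have "real_of_int (height p q ?w) < \<delta> t" "\<delta> t < real_of_int (height p q ?v)"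
        using nY[of t] y pq(3,4) by (simp_all add: height_vert True True' algebra_simps)
      ultimately show ?thesis
        using crossing_at \<delta>_compare(3,4)[OF tc G, of "2 * col k + 1", folded s]
        unfolding near_end_def lr by blast
    next
      case ncol: False
      then have cS: "col (int k + 1) = col k + 1" using col_Suc by blast
      then have cS': "col (1 + int k) = col k + 1" by (simp add: add.commute)
      let ?v = "lvert \<sigma> p q (int k + 1)" and ?w = "rvert \<sigma> p q k"
      have lr: "left_end \<sigma> p q j = ?v" "right_end \<sigma> p q j = ?w"
        using ncol False by (simp_all add: left_end_def right_end_def Let_def k_def)
      have s: "height p q ?v + height p q ?w = int q * (2 * int k + 1) - n * (2 * col k + 2)"
        by (simp add: height_vert cS cS' algebra_simps)
      have x: "X t = real_of_int (col k + 1)" using at(3) ncol by (simp add: on_axis_def)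
      have "\<gamma> t = (1 - (real_of_int (int k - col k) - Y t)) *\<^sub>R pt ?v + (real_of_int (int k - col k) - Y t) *\<^sub>R pt ?w"
        by (simp add: \<gamma>t x pt_def lvert_def rvert_def cS cS' algebra_simps)
      moreover have "{?v, ?w} \<in> lattice_segments"
        by (rule lattice_segmentI(2)[of 0 1]) (simp_all add: lvert_def rvert_def cS)
      moreover have "real_of_int (height p q ?w) < \<delta> t" "\<delta> t < real_of_int (height p q ?v)"
        using nX[of t] x pq(1,2) by (simp_all add: height_vert cS cS' algebra_simps)
      ultimately show ?thesis
        using crossing_at \<delta>_compare(3,4)[OF tc G, of "2 * col k + 2", folded s]
        unfolding near_end_def lr by blast
    qed
  qed
  then show "segment_at (\<gamma> (crossing_time j)) = {left_end \<sigma> p q j, right_end \<sigma> p q j}"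
    "nearer_endpoint (\<gamma> (crossing_time j)) = near_end \<sigma> p q j" unfolding t_def by blast+
qed

theorem crossings_ideal: "crossings \<gamma> = ideal_crossings \<sigma> p q"
proof -
  have "crossings \<gamma> = map (\<lambda>j. (segment_at (\<gamma> (crossing_time j)), nearer_endpoint (\<gamma> (crossing_time j))))
      [2..<2 * (p + q) + 2]"
    by (rule crossings_eq[OF crossing_times_image]) (rule crossing_time_Suc)
  also have "\<dots> = ideal_crossings \<sigma> p q"
    unfolding ideal_crossings_def by (rule map_cong[OF refl]) (simp only: set_upt atLeastLessThan_iff ideal_crossing)
  finally show ?thesis .
qed

end

section \<open>The two closed curves\<close>

text \<open>One coordinate of a polyline with two pieces, running from a through a + d to a + d +
  d'. Linear combinations such as g and \<delta> are of the same form.\<close>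

definition bent :: "real \<Rightarrow> real \<Rightarrow> real \<Rightarrow> real \<Rightarrow> real" where
  "bent a d d' t = (if t \<le> 1 / 2 then a + 2 * t * d else a + d + (2 * t - 1) * d')"

lemma bent_mono:
  assumes "0 < d" "0 < d'" "s < t"
  shows "bent a d d' s < bent a d d' t"
proof -
  have m: "x * d < y * d" "x * d' < y * d'" if "x < y" for x y
    using that assms by (simp_all add: mult_strict_right_mono)
  consider "t \<le> 1 / 2" | "s \<le> 1 / 2" "1 / 2 < t" | "1 / 2 < s" using assms(3) by linarith
  then show ?thesis
  proof cases
    case 1
    then show ?thesis using m(1)[of "2 * s" "2 * t"] assms(3) by (simp add: bent_def)
  next
    case 2
    then have "2 * s * d \<le> 1 * d" using assms(1) by (intro mult_right_mono) auto
    moreover have "0 < (2 * t - 1) * d'" using 2 assms(2) by simp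
    ultimately show ?thesis using 2 by (simp add: bent_def)
  next
    case 3
    then show ?thesis using m(2)[of "2 * s - 1" "2 * t - 1"] assms(3) by (simp add: bent_def)
  qed
qed

lemma not_Ints_between:
  assumes "real_of_int m < x" "x < real_of_int m + 1"
  shows "x \<notin> \<int>"
  using assms by (auto elim!: Ints_cases)

text \<open>On the second piece the coordinate moves back, but stays strictly between two
  consecutive integers.\<close>

lemma bent_inj:
  assumes d: "0 < d" "d' < 0" and m: "real_of_int m < a + d + d'" "a + d < real_of_int m + 1"
    and t: "s \<in> {0..1}" "t \<in> {0..1}" "bent a d d' s = bent a d d' t" "bent a d d' t \<in> \<int>"
  shows "s = t"
proof -
  have "r \<le> 1 / 2" if "r \<in> {0..1}" "bent a d d' r \<in> \<int>" for r
  proof (rule ccontr)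
    assume r: "\<not> r \<le> 1 / 2"
    then have "1 * d' \<le> (2 * r - 1) * d'" "(2 * r - 1) * d' < 0"
      using that(1) d by (auto intro: mult_right_mono_neg mult_pos_neg)
    then have "bent a d d' r \<notin> \<int>"
      using m r by (intro not_Ints_between[of m]) (simp_all add: bent_def)
    then show False using that by simp
  qed
  then have "s \<le> 1 / 2" "t \<le> 1 / 2" using t by metis+
  then show ?thesis using t(3) d by (simp add: bent_def)
qed

lemma bent_bounds:
  assumes "t \<in> {0..1}"
  shows "\<bar>bent a d d' t\<bar> \<le> \<bar>a\<bar> + \<bar>d\<bar> + \<bar>d'\<bar>"
proof (cases "t \<le> 1 / 2")
  case True
  then have "\<bar>2 * t\<bar> * \<bar>d\<bar> \<le> 1 * \<bar>d\<bar>" using assms by (intro mult_right_mono) auto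
  then have "\<bar>2 * t * d\<bar> \<le> \<bar>d\<bar>" by (simp add: abs_mult)
  then show ?thesis using True by (simp add: bent_def)
next
  case False
  then have "\<bar>2 * t - 1\<bar> * \<bar>d'\<bar> \<le> 1 * \<bar>d'\<bar>" using assms by (intro mult_right_mono) auto
  then have "\<bar>(2 * t - 1) * d'\<bar> \<le> \<bar>d'\<bar>" by (simp add: abs_mult)
  then show ?thesis using False by (simp add: bent_def)
qed

lemma bent_pos:
  assumes "0 < a" "0 < d" "0 < a + d + d'" "t \<in> {0..1}"
  shows "0 < bent a d d' t"
proof (cases "t \<le> 1 / 2")
  case True
  then show ?thesis using assms by (simp add: bent_def add_pos_nonneg)
next
  case False
  have "0 \<le> (2 * t - 1) * d' \<or> d' \<le> (2 * t - 1) * d'"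
  proof (cases "0 \<le> d'")
    case True
    then show ?thesis using False by simp
  next
    case neg: False
    then have "1 * d' \<le> (2 * t - 1) * d'" using False assms(4) by (intro mult_right_mono_neg) auto
    then show ?thesis by simp
  qed
  moreover have "bent a d d' t = a + d + (2 * t - 1) * d'" using False by (simp add: bent_def)
  ultimately show ?thesis using assms(1-3) by linarith
qed

lemma bent_ends: "bent a d d' 0 = a" "bent a d d' 1 = a + d + d'"
  by (simp_all add: bent_def)

lemma bent_linear: "x * bent a d d' t + y * bent b e e' t = bent (x * a + y * b) (x * d + y * e) (x * d' + y * e') t"
  by (simp add: bent_def algebra_simps)

lemma closed_curve_bent:
  "closed_curve LeftSide p q \<epsilon> t = (bent \<epsilon> (real q - 2 * \<epsilon>) (2 * \<epsilon>) t, bent \<epsilon> (real p + \<epsilon>) (- \<epsilon>) t)"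
  "closed_curve RightSide p q \<epsilon> t = (bent \<epsilon> (real q + \<epsilon>) (- \<epsilon>) t, bent \<epsilon> (real p - 2 * \<epsilon>) (2 * \<epsilon>) t)"
  by (simp_all add: joinpaths_def linepath_def bent_def algebra_simps)

lemma continuous_closed_curve: "continuous_on {0..1} (closed_curve \<sigma> p q \<epsilon>)"
  by (cases \<sigma>) (simp_all add: path_def[symmetric] path_join)

text \<open>The factor 32 makes \<delta>, which is at most 5 (p + q) \<epsilon> in absolute value,
  less than 5/32, and gives \<epsilon> < 1/64 because p + q is at least 2. At both ends of the curve
  \<delta> is \<epsilon> (q - p), which is nonnegative by p <= q.\<close>

lemma transversal_closed_curve:
  fixes p q :: nat and \<epsilon> :: real and \<sigma> :: side
  assumes pq: "0 < p" "p \<le> q" "gcd p q = 1" and \<epsilon>: "0 < \<epsilon>" "32 * real (p + q) * \<epsilon> < 1"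
  shows "transversal \<sigma> p q (closed_curve \<sigma> p q \<epsilon>)"
proof -
  define X Y where "X = (\<lambda>t. fst (closed_curve \<sigma> p q \<epsilon> t))" and "Y = (\<lambda>t. snd (closed_curve \<sigma> p q \<epsilon> t))"
  define g \<delta> where "g = (\<lambda>t. X t + Y t)" and "\<delta> = (\<lambda>t. real q * Y t - real p * X t)"
  have p1: "1 \<le> real p" "real p \<le> real q" using pq by simp_all
  have "64 * \<epsilon> \<le> 32 * real (p + q) * \<epsilon>" using p1 \<epsilon>(1) by (intro mult_right_mono) auto
  then have \<epsilon>64: "64 * \<epsilon> < 1" using \<epsilon>(2) by linarith
  let ?x = "if \<sigma> = LeftSide then real q - 2 * \<epsilon> else real q + \<epsilon>"
  let ?x' = "if \<sigma> = LeftSide then 2 * \<epsilon> else - \<epsilon>"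
  let ?y = "if \<sigma> = LeftSide then real p + \<epsilon> else real p - 2 * \<epsilon>"
  let ?y' = "if \<sigma> = LeftSide then - \<epsilon> else 2 * \<epsilon>"
  have X: "X t = bent \<epsilon> ?x ?x' t" and Y: "Y t = bent \<epsilon> ?y ?y' t" for t
    by (cases \<sigma>; simp only: X_def Y_def closed_curve_bent; simp)+
  have g: "g t = bent (2 * \<epsilon>) (real (p + q) - \<epsilon>) \<epsilon> t" for t
    using bent_linear[of 1 \<epsilon> ?x ?x' t 1 \<epsilon> ?y ?y'] by (simp add: g_def X Y add.commute[of "real p"] split: if_splits)
  have \<delta>: "\<delta> t = bent (\<epsilon> * (real q - real p))
      (\<epsilon> * (if \<sigma> = LeftSide then real q + 2 * real p else - (2 * real q + real p)))
      (\<epsilon> * (if \<sigma> = LeftSide then - (real q + 2 * real p) else 2 * real q + real p)) t" for t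
    using bent_linear[of "real q" \<epsilon> ?y ?y' t "- real p" \<epsilon> ?x ?x']
    by (simp add: \<delta>_def X Y algebra_simps split: if_splits)
  have sign: "if \<sigma> = LeftSide then 0 < \<delta> t else \<delta> t < 0"
    if t: "t \<in> crossing_times (closed_curve \<sigma> p q \<epsilon>)" and gt: "real (p + q) - 1 \<le> 2 * g t" for t
  proof -
    have t01: "0 \<le> t" "t \<le> 1" and Z: "X t \<in> \<int> \<or> Y t \<in> \<int> \<or> g t \<in> \<int>"
      using t by (simp_all add: crossing_times_eq X_def Y_def g_def)
    \<comment> \<open>The ends must be excluded: there \<delta> vanishes for p = q and has the wrong
      sign for the right curve if p < q.\<close>
    have t0: "t \<noteq> 0" using gt p1 \<epsilon>64 by (auto simp: g bent_ends)
    have t1: "t \<noteq> 1"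
    proof
      assume "t = 1"
      then have "X t = real q + \<epsilon>" "Y t = real p + \<epsilon>" "g t = real (p + q) + 2 * \<epsilon>"
        by (simp_all add: X Y g bent_ends)
      then show False
        using Z \<epsilon> \<epsilon>64 not_Ints_between[of "int q" "X t"] not_Ints_between[of "int p" "Y t"]
          not_Ints_between[of "int (p + q)" "g t"] by auto
    qed
    show ?thesis
    proof (cases "\<sigma> = LeftSide")
      case left: True
      show ?thesis
      proof (cases "t \<le> 1 / 2")
        case True
        have "0 < 2 * t * (\<epsilon> * (real q + 2 * real p))" "0 \<le> \<epsilon> * (real q - real p)"
          using t0 t01 \<epsilon> p1 by simp_all
        moreover have "\<delta> t = \<epsilon> * (real q - real p) + 2 * t * (\<epsilon> * (real q + 2 * real p))"
          using left True by (simp add: \<delta> bent_def)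
        ultimately have "0 < \<delta> t" by linarith
        then show ?thesis using left by simp
      next
        case False
        have "(2 * t - 1) * (real q + 2 * real p) < 1 * (real q + 2 * real p)"
          using t01 t1 p1 by (intro mult_strict_right_mono) auto
        also have "\<dots> \<le> 2 * real q + real p" using p1 by simp
        finally have "0 < 2 * real q + real p - (2 * t - 1) * (real q + 2 * real p)" by simp
        then have "0 < \<epsilon> * (2 * real q + real p - (2 * t - 1) * (real q + 2 * real p))"
          using \<epsilon>(1) by (rule mult_pos_pos[rotated])
        then show ?thesis using left False by (simp add: \<delta> bent_def algebra_simps)
      qed
    next
      case right: False
      show ?thesis
      proof (cases "t \<le> 1 / 2")
        case True
        let ?n = "real p + real q"
        \<comment> \<open>On this piece \<delta> falls from \<epsilon> (q - p) and is negative once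
          2 t (2 q + p) > q - p. The lower bound on g makes t large enough; 17/16 bounds 1 + 4
          \<epsilon>.\<close>
        have "?n - 1 \<le> 2 * (2 * \<epsilon> + 2 * t * (?n - \<epsilon>))" using gt True by (simp add: g bent_def)
        moreover have "2 * t * (?n - \<epsilon>) \<le> 2 * t * ?n" using t01 \<epsilon> by (intro mult_left_mono) auto
        ultimately have "?n - 1 - 4 * \<epsilon> \<le> 4 * t * ?n" by simp
        then have "(?n - 17 / 16) \<le> 4 * t * ?n" using \<epsilon>64 by simp
        then have "(?n - 17 / 16) * (2 * real q + real p) \<le> 4 * t * ?n * (2 * real q + real p)"
          using p1 by (intro mult_right_mono) auto
        moreover have "2 * (real q - real p) * ?n < (?n - 17 / 16) * (2 * real q + real p)"
        proof -
          have "1 * real q \<le> real p * real q" "1 * real p \<le> real p * real p"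
            using p1 by (auto intro!: mult_right_mono)
          moreover have "(?n - 17 / 16) * (2 * real q + real p) = 2 * (real q - real p) * ?n +
              (3 * (real p * real q) + 3 * (real p * real p) - 17 / 8 * real q - 17 / 16 * real p)"
            by (simp add: field_simps)
          ultimately show ?thesis using p1 by linarith
        qed
        ultimately have "2 * (real q - real p) * ?n < 4 * t * ?n * (2 * real q + real p)"
          using less_le_trans by blast
        then have "2 * ?n * (real q - real p) < 2 * ?n * (2 * t * (2 * real q + real p))"
          by (simp add: algebra_simps)
        then have "real q - real p < 2 * t * (2 * real q + real p)"
          using p1 by (subst (asm) mult_less_cancel_left_pos) auto
        then have "\<epsilon> * (real q - real p) < \<epsilon> * (2 * t * (2 * real q + real p))"
          using \<epsilon> by (intro mult_strict_left_mono) auto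
        then show ?thesis using right True by (simp add: \<delta> bent_def algebra_simps)
      next
        case False
        \<comment> \<open>On the detour \<delta> climbs back to a nonnegative value, but the only
          lattice line met there is y = p, at a point to the right of (q, p). This is why
          \<open>\<delta>_sign\<close> is restricted to crossing times.\<close>
        define e where "e = (2 * t - 1) * \<epsilon>"
        have "(2 * t - 1) * \<epsilon> < 1 * \<epsilon>"
          using t01 t1 \<epsilon>(1) by (intro mult_strict_right_mono) auto
        then have s: "0 < e" "e < \<epsilon>" using False \<epsilon>(1) by (simp_all add: e_def)
        have Xt: "X t = real q + 2 * \<epsilon> - e" and Yt: "Y t = real p - \<epsilon> + 2 * e"
          and gt: "g t = real (p + q) + \<epsilon> + e"
          using right False by (simp_all add: X Y g bent_def e_def)
        have "X t \<notin> \<int>" "g t \<notin> \<int>"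
          using s \<epsilon>64 not_Ints_between[of "int q" "X t"] not_Ints_between[of "int (p + q)" "g t"]
          unfolding Xt gt by auto
        then obtain m where m: "Y t = of_int m" using Z by (auto elim: Ints_cases)
        have "real_of_int m < real_of_int (int p + 1)" "real_of_int (int p - 1) < real_of_int m"
          using m s \<epsilon>64 unfolding Yt by auto
        then have "m = int p" unfolding of_int_less_iff by linarith
        then have "\<delta> t = real p * (real q - X t)" using m by (simp add: \<delta>_def algebra_simps)
        moreover have "real q < X t" using s \<epsilon> unfolding Xt by simp
        ultimately show ?thesis using right p1 by (simp add: mult_pos_neg)
      qed
    qed
  qed
  have inj: "s = t" if "0 < d" "0 < d'" "bent a d d' s = bent a d d' t" for a d d' s t
    using bent_mono[OF that(1,2), of s t a] bent_mono[OF that(1,2), of t s a] that(3)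
    by (cases s t rule: linorder_cases) auto
  have d: "0 < ?x" "0 < ?y" using p1 \<epsilon>64 \<epsilon>(1) by auto
  have inj_X: "s = t" if "s \<in> {0..1}" "t \<in> {0..1}" "X s = X t" "X t \<in> \<int>" for s t
  proof (cases "\<sigma> = LeftSide")
    case True
    then show ?thesis using inj[of ?x ?x' \<epsilon> s t] that(3) d \<epsilon> by (simp add: X)
  next
    case False
    then show ?thesis
      using that \<epsilon> \<epsilon>64 d by (intro bent_inj[of ?x ?x' "int q" \<epsilon> s t]) (simp_all add: X)
  qed
  have inj_Y: "s = t" if "s \<in> {0..1}" "t \<in> {0..1}" "Y s = Y t" "Y t \<in> \<int>" for s t
  proof (cases "\<sigma> = LeftSide")
    case True
    then show ?thesis
      using that \<epsilon> \<epsilon>64 d by (intro bent_inj[of ?y ?y' "int p" \<epsilon> s t]) (simp_all add: Y)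
  next
    case False
    then show ?thesis using inj[of ?y ?y' \<epsilon> s t] that(3) d \<epsilon> by (simp add: Y)
  qed
  have small: "\<bar>\<delta> t\<bar> < 1 / 4" if "t \<in> {0..1}" for t
  proof -
    have "\<bar>\<delta> t\<bar> \<le> \<epsilon> * (5 * real (p + q))"
    proof -
      let ?d = "if \<sigma> = LeftSide then real q + 2 * real p else - (2 * real q + real p)"
      have neg: "(if \<sigma> = LeftSide then - (real q + 2 * real p) else 2 * real q + real p) = - ?d" by simp
      have "\<bar>\<delta> t\<bar> \<le> \<bar>\<epsilon> * (real q - real p)\<bar> + \<bar>\<epsilon> * ?d\<bar> + \<bar>\<epsilon> * - ?d\<bar>"
        unfolding \<delta> neg by (rule bent_bounds[OF that])
      also have "\<dots> = \<epsilon> * (real q - real p + 2 * \<bar>?d\<bar>)"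
        using \<epsilon>(1) p1 by (simp add: abs_mult algebra_simps)
      also have "\<dots> \<le> \<epsilon> * (5 * real (p + q))"
        using \<epsilon>(1) p1 by (intro mult_left_mono) auto
      finally show ?thesis .
    qed
    then show ?thesis using \<epsilon>(2) by (simp add: algebra_simps)
  qed
  have mono: "g s < g t" if "s < t" for s t
    unfolding g using that p1 \<epsilon> \<epsilon>64 by (intro bent_mono) auto
  have pos: "0 < X t \<and> 0 < Y t" if "0 \<le> t" "t \<le> 1" for t
    unfolding X Y using that d p1 \<epsilon> \<epsilon>64 by (intro conjI bent_pos) auto
  have ends: "g 0 < 1" "real (p + q) < g 1" "g 1 < real (p + q) + 1" "real q < X 1" "real p < Y 1"
    using \<epsilon> \<epsilon>64 by (auto simp: g X Y bent_ends)
  have "0 < q" using pq by simp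
  note facts = pq(1) this pq(3) continuous_closed_curve mono pos[THEN conjunct1] pos[THEN conjunct2]
    ends inj_X inj_Y small sign
  show ?thesis
    unfolding transversal_def positive_slope_def transversal_axioms_def
    by (intro conjI allI impI) (rule facts[unfolded X_def Y_def g_def \<delta>_def]; assumption)+
qed

theorem theorem5p5:
  fixes p q :: nat
  assumes "0 < p" and "p \<le> q" and "gcd p q = 1"
  shows "\<forall>\<^sub>F \<epsilon> in at_right (0::real).
           of_nat (m_closed LeftSide p q \<epsilon>) = 6 * gen_markov p q - 1 \<and>
           of_nat (m_closed RightSide p q \<epsilon>) = 6 * gen_markov p q - 1"
proof -
  have "of_nat (m_closed \<sigma> p q \<epsilon>) = 6 * gen_markov p q - 1"
    if \<epsilon>: "0 < \<epsilon>" "\<epsilon> < 1 / (32 * real (p + q))" for \<sigma> \<epsilon>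
  proof -
    have "32 * real (p + q) * \<epsilon> < 1" using \<epsilon>(2) assms(1) by (simp add: field_simps)
    then have T: "transversal \<sigma> p q (closed_curve \<sigma> p q \<epsilon>)"
      using transversal_closed_curve[OF assms \<epsilon>(1)] by blast
    have "int (m_closed \<sigma> p q \<epsilon>) = closed_trace \<sigma> p q"
      unfolding m_closed_def transversal.crossings_ideal[OF T]
      using T by (intro positive_slope.card_good_matchings_ideal) (simp add: transversal_def)
    then have "(of_nat (m_closed \<sigma> p q \<epsilon>) :: rat) = of_int (closed_trace \<sigma> p q)"
      by (metis of_int_of_nat_eq)
    also have "\<dots> = 6 * gen_markov p q - 1"
      unfolding gen_markov_eq[OF assms, of \<sigma>] by (simp add: loop_number_def field_simps)
    finally show ?thesis .
  qed
  moreover have "0 < 1 / (32 * real (p + q))" using assms(1) by simp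
  ultimately show ?thesis
    unfolding eventually_at_right_field by (intro exI[of _ "1 / (32 * real (p + q))"]) simp
qed

end
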